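(* Let $\varepsilon\in M_n(\{0,1\})$ be symmetric with zero diagonal and let $x_1,\dots,x_n$ be selfadjoint random variables in a noncommutative probability space $(A,\varphi)$ such that $x_ix_j=x_jx_i$ if $\varepsilon_{ij}=1$. Let $x_1,\dots,x_n$ be $\varepsilon$-independent and identically distributed. (a) Then their distribution is invariant under $S_n^\varepsilon$. (b) If their distribution is even (all odd free cumulants vanish), then it is invariant under $H_n^\varepsilon$. (c) If only free cumulants of blocks of size one or two are non-zero (i.e. the distribution is a shifted semicircular), then the distribution is invariant under $\mathring B_n^\varepsilon$. (d) If only free cumulants of blocks of size two are non-zero (i.e. the distribution is a centered semicircular), then the distribution is invariant under $\mathring O_n^\varepsilon$.
   Context: A noncommutative probability space $(A,\varphi)$ is a unital $*$-algebra $A$ with a unital linear functional $\varphi$. **$\varepsilon$-independence.** Unital subalgebras $A_1,\dots,A_n\subset A$ are $\varepsilon$-independent if (i) $A_i$ and $A_j$ commute whenever $\varepsilon_{ij}=1$; and (ii) for any $k\in\mathbb N$ and any $a_1,\dots,a_k\in A$ with $a_j\in A_{i(j)}$ such that $\varphi(a_j)=0$ for all $j$, and such that for any $1\le p<r\le k$ with $i(p)=i(r)$ there is $q$ with $p<q<r$, $\varepsilon_{i(p)i(q)}=0$ and $i(p)\neq i(q)$, one has $\varphi(a_1\cdots a_k)=0$. Variables $x_1,\dots,x_n$ are $\varepsilon$-independent if the algebras $\mathrm{alg}(x_j,1)$ are. **Identically distributed:** $\varphi(x_i^k)=\varphi(x_j^k)$ for all $k\in\mathbb N$ and all $i,j$.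 The free cumulants referred to are those of the (common) distribution of a single variable $x_i$, i.e. $\kappa_m(x_i,\dots,x_i)$, $m\ge1$. **Invariance.** Let $G$ be a compact matrix quantum group with generators $u_{ij}$ of $C(G)$, $G\subset O_n^+$ (i.e. $C(G)$ is a quotient of $C(O_n^+)$ by a map sending generators to generators). The distribution of $x_1,\dots,x_n$ is invariant under $G$ if for all $k\in\mathbb N$ and all $j(1),\dots,j(k)\in\{1,\dots,n\}$, in $C(G)$, $$\varphi(x_{j(1)}\cdots x_{j(k)})1=\sum_{i(1),\dots,i(k)=1}^n\varphi(x_{i(1)}\cdots x_{i(k)})\,u_{i(1)j(1)}\cdots u_{i(k)j(k)} .$$ **The quantum groups.** The relations $\mathring R^\varepsilon$ are: $u_{ik}u_{jl}=u_{jl}u_{ik}$ if $\varepsilon_{ij}=1$ and $\varepsilon_{kl}=1$; $u_{ik}u_{jl}=0$ if $\varepsilon_{ij}=1$ and $\varepsilon_{kl}=0$; $u_{ik}u_{jl}=0$ if $\varepsilon_{ij}=0$ and $\varepsilon_{kl}=1$. The following are universal unital $C^*$-algebras generated by $u_{ij}$, $1\le i,j\le n$. "$u$ is orthogonal" means $\sum_k u_{ik}u_{jk}=\sum_k u_{ki}u_{kj}=\delta_{ij}$. - $C(O_n^+)$: $u_{ij}=u_{ij}^*$, $u$ orthogonal. - $C(\mathring O_n^\varepsilon)$: $u_{ij}=u_{ij}^*$, $u$ orthogonal, $\mathring R^\varepsilon$. - $C(\mathring B_n^\varepsilon)$: the quotient of $C(\mathring O_n^\varepsilon)$ by the relations $\sum_k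 u_{ik}=\sum_k u_{kj}=1$ for all $i,j$. - $C(H_n^\varepsilon)$: $u_{ij}=u_{ij}^*$, $u$ orthogonal, $u_{ik}u_{jk}=u_{ki}u_{kj}=0$ for all $k$ and all $i\ne j$, and $\mathring R^\varepsilon$. - $C(S_n^\varepsilon)$: $u_{ij}=u_{ij}^*=u_{ij}^2$, $\sum_k u_{ik}=\sum_k u_{kj}=1$ for all $i,j$, and $\mathring R^\varepsilon$. *)

theory Defs
  imports Complex_Main "HOL-Library.Disjoint_Sets" "HOL-Algebra.Module"
begin

section \<open>Noncommutative probability spaces\<close>

text \<open>The algebra \<open>A\<close> is the whole type. The class \<open>ring_1\<close> demands \<open>0 \<noteq> 1\<close>, which excludes nothing,
  since a unital functional separates \<open>0\<close> from \<open>1\<close>.\<close>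

class complex_star_algebra = ring_1 +
  fixes cscale :: "complex \<Rightarrow> 'a \<Rightarrow> 'a"
    and star :: "'a \<Rightarrow> 'a"
  assumes cscale_add_right: "cscale c (a + b) = cscale c a + cscale c b"
    and cscale_add_left: "cscale (c + d) a = cscale c a + cscale d a"
    and cscale_cscale: "cscale c (cscale d a) = cscale (c * d) a"
    and cscale_one: "cscale 1 a = a"
    and cscale_mult_left: "cscale c a * b = cscale c (a * b)"
    and cscale_mult_right: "a * cscale c b = cscale c (a * b)"
    and star_add: "star (a + b) = star a + star b"
    and star_cscale: "star (cscale c a) = cscale (cnj c) (star a)"
    and star_mult: "star (a * b) = star b * star a"
    and star_star: "star (star a) = a"

definition selfadjoint :: "'a::complex_star_algebra \<Rightarrow> bool" where
  "selfadjoint a \<longleftrightarrow> star a = a"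

definition unital_linear_functional :: "('a::complex_star_algebra \<Rightarrow> complex) \<Rightarrow> bool" where
  "unital_linear_functional \<phi> \<longleftrightarrow>
     (\<forall>a b. \<phi> (a + b) = \<phi> a + \<phi> b) \<and> (\<forall>c a. \<phi> (cscale c a) = c * \<phi> a) \<and> \<phi> 1 = 1"

definition unital_subalgebra :: "'a::complex_star_algebra set \<Rightarrow> bool" where
  "unital_subalgebra S \<longleftrightarrow>
     1 \<in> S \<and> (\<forall>a\<in>S. \<forall>b\<in>S. a + b \<in> S \<and> a * b \<in> S) \<and> (\<forall>c. \<forall>a\<in>S. cscale c a \<in> S)"

text \<open>\<open>alg(x, 1)\<close>\<close>

definition generated_subalgebra :: "'a::complex_star_algebra \<Rightarrow> 'a set" where
  "generated_subalgebra x = \<Inter> {S. unital_subalgebra S \<and> x \<in> S}"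


section \<open>Independence with respect to a matrix of zeros and ones\<close>

text \<open>The factors \<open>a\<^sub>1, \<dots>, a\<^sub>k\<close> and the indices \<open>i(1), \<dots>, i(k)\<close> are lists \<open>as\<close> and \<open>is\<close>, so positions
  are counted from zero. The empty product is excluded, its value being \<open>\<phi> 1 = 1\<close>.\<close>

definition eps_independent_subalgebras ::
  "('n \<Rightarrow> 'n \<Rightarrow> nat) \<Rightarrow> ('a::complex_star_algebra \<Rightarrow> complex) \<Rightarrow> ('n \<Rightarrow> 'a set) \<Rightarrow> bool" where
  "eps_independent_subalgebras \<epsilon> \<phi> A \<longleftrightarrow>
     (\<forall>i. unital_subalgebra (A i)) \<and>
     (\<forall>i j. \<epsilon> i j = 1 \<longrightarrow> (\<forall>a\<in>A i. \<forall>b\<in>A j. a * b = b * a)) \<and>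
     (\<forall>is as. as \<noteq> [] \<and> length is = length as \<and>
        (\<forall>p<length as. as ! p \<in> A (is ! p) \<and> \<phi> (as ! p) = 0) \<and>
        (\<forall>p r. p < r \<and> r < length as \<and> is ! p = is ! r \<longrightarrow>
           (\<exists>q. p < q \<and> q < r \<and> \<epsilon> (is ! p) (is ! q) = 0 \<and> is ! p \<noteq> is ! q)) \<longrightarrow>
        \<phi> (prod_list as) = 0)"

definition eps_independent ::
  "('n \<Rightarrow> 'n \<Rightarrow> nat) \<Rightarrow> ('a::complex_star_algebra \<Rightarrow> complex) \<Rightarrow> ('n \<Rightarrow> 'a) \<Rightarrow> bool" where
  "eps_independent \<epsilon> \<phi> x \<longleftrightarrow> eps_independent_subalgebras \<epsilon> \<phi> (\<lambda>j. generated_subalgebra (x j))"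

definition identically_distributed ::
  "('a::complex_star_algebra \<Rightarrow> complex) \<Rightarrow> ('n \<Rightarrow> 'a) \<Rightarrow> bool" where
  "identically_distributed \<phi> x \<longleftrightarrow> (\<forall>k i j. \<phi> (x i ^ k) = \<phi> (x j ^ k))"


section \<open>Free cumulants of a single variable\<close>

definition noncrossing :: "nat set set \<Rightarrow> bool" where
  "noncrossing P \<longleftrightarrow>
     (\<forall>V\<in>P. \<forall>W\<in>P. \<forall>p1\<in>V. \<forall>q1\<in>W. \<forall>p2\<in>V. \<forall>q2\<in>W. p1 < q1 \<and> q1 < p2 \<and> p2 < q2 \<longrightarrow> V = W)"

definition NC :: "nat \<Rightarrow> nat set set set" where
  "NC m = {P. partition_on {1..m} P \<and> noncrossing P}"

lemma NC_block_card_less: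
  assumes "P \<in> NC m - {{{1..m}}}" "V \<in> P"
  shows "card V < m"
proof -
  have P: "partition_on {1..m} P" and ne: "P \<noteq> {{1..m}}"
    using assms(1) by (auto simp: NC_def)
  have sub: "V \<subseteq> {1..m}"
    using P assms(2) by (auto simp: partition_on_def)
  have "V \<noteq> {1..m}"
  proof
    assume V: "V = {1..m}"
    have "W = V" if "W \<in> P" for W
    proof (rule ccontr)
      assume "W \<noteq> V"
      then have "W \<inter> V = {}"
        using P that assms(2) by (auto simp: partition_on_def disjoint_def)
      moreover have "W \<subseteq> V" "W \<noteq> {}"
        using P that V by (auto simp: partition_on_def)
      ultimately show False by blast
    qed
    then show False
      using assms(2) V ne by blast
  qed
  then show ?thesis
    using sub psubset_card_mono[of "{1..m}" V] by auto
qed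

text \<open>The moment-cumulant formula \<open>M m = (\<Sum>\<pi>\<in>NC m. \<Prod>V\<in>\<pi>. \<kappa> (card V))\<close>, solved for the summand of the
  one-block partition; only arguments \<open>m \<ge> 1\<close> are meaningful.\<close>

function free_cumulant_of_moments :: "(nat \<Rightarrow> complex) \<Rightarrow> nat \<Rightarrow> complex" where
  "free_cumulant_of_moments M m =
     M m - (\<Sum>P\<in>NC m - {{{1..m}}}. \<Prod>V\<in>P. free_cumulant_of_moments M (card V))"
  by auto
termination
  by (relation "measure snd") (use NC_block_card_less in auto)

declare free_cumulant_of_moments.simps [simp del]

definition free_cumulant :: "('a::complex_star_algebra \<Rightarrow> complex) \<Rightarrow> 'a \<Rightarrow> nat \<Rightarrow> complex" where
  "free_cumulant \<phi> a m = free_cumulant_of_moments (\<lambda>k. \<phi> (a ^ k)) m"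

lemma moment_cumulant:
  assumes "m \<ge> 1"
  shows "\<phi> (a ^ m) = (\<Sum>P\<in>NC m. \<Prod>V\<in>P. free_cumulant \<phi> a (card V))"
proof -
  have "NC m \<subseteq> Pow (Pow {1..m})"
    by (auto simp: NC_def partition_on_def)
  then have fin: "finite (NC m)"
    by (rule finite_subset) simp
  have "{{1..m}} \<in> NC m"
    using assms by (auto simp: NC_def noncrossing_def intro!: partition_on_space)
  then show ?thesis
    using fin free_cumulant_of_moments.simps[of "\<lambda>k. \<phi> (a ^ k)" m]
    by (simp add: sum.remove free_cumulant_def)
qed


section \<open>Unital C*-algebras\<close>

text \<open>C*-algebras occur as test objects of a universal property, hence the carriers; here the zero
  algebra is allowed.\<close>

definition complex_ring :: "complex ring" where
  "complex_ring = \<lparr>carrier = UNIV, mult = (*), one = 1, zero = 0, add = (+)\<rparr>"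

record 'b cstar_structure = "(complex, 'b) module" +
  adjoint :: "'b \<Rightarrow> 'b"
  cnorm :: "'b \<Rightarrow> real"

locale unital_cstar_algebra = module complex_ring B + ring B
  for B :: "('b, 'm) cstar_structure_scheme" (structure) +
  assumes smult_mult_left:
      "\<lbrakk>x \<in> carrier B; y \<in> carrier B\<rbrakk> \<Longrightarrow> (c \<odot> x) \<otimes> y = c \<odot> (x \<otimes> y)"
    and smult_mult_right:
      "\<lbrakk>x \<in> carrier B; y \<in> carrier B\<rbrakk> \<Longrightarrow> x \<otimes> (c \<odot> y) = c \<odot> (x \<otimes> y)"
    and adjoint_closed: "x \<in> carrier B \<Longrightarrow> adjoint B x \<in> carrier B"
    and adjoint_add:
      "\<lbrakk>x \<in> carrier B; y \<in> carrier B\<rbrakk> \<Longrightarrow> adjoint B (x \<oplus> y) = adjoint B x \<oplus> adjoint B y"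
    and adjoint_smult: "x \<in> carrier B \<Longrightarrow> adjoint B (c \<odot> x) = cnj c \<odot> adjoint B x"
    and adjoint_mult:
      "\<lbrakk>x \<in> carrier B; y \<in> carrier B\<rbrakk> \<Longrightarrow> adjoint B (x \<otimes> y) = adjoint B y \<otimes> adjoint B x"
    and adjoint_adjoint: "x \<in> carrier B \<Longrightarrow> adjoint B (adjoint B x) = x"
    and cnorm_nonneg: "x \<in> carrier B \<Longrightarrow> 0 \<le> cnorm B x"
    and cnorm_eq_zero: "x \<in> carrier B \<Longrightarrow> cnorm B x = 0 \<longleftrightarrow> x = \<zero>"
    and cnorm_triangle:
      "\<lbrakk>x \<in> carrier B; y \<in> carrier B\<rbrakk> \<Longrightarrow> cnorm B (x \<oplus> y) \<le> cnorm B x + cnorm B y"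
    and cnorm_smult: "x \<in> carrier B \<Longrightarrow> cnorm B (c \<odot> x) = cmod c * cnorm B x"
    and cnorm_mult:
      "\<lbrakk>x \<in> carrier B; y \<in> carrier B\<rbrakk> \<Longrightarrow> cnorm B (x \<otimes> y) \<le> cnorm B x * cnorm B y"
    and cstar_identity: "x \<in> carrier B \<Longrightarrow> cnorm B (adjoint B x \<otimes> x) = (cnorm B x)\<^sup>2"
    and complete:
      "\<lbrakk>range f \<subseteq> carrier B; \<forall>e>0. \<exists>N. \<forall>m\<ge>N. \<forall>n\<ge>N. cnorm B (f m \<ominus> f n) < e\<rbrakk>
       \<Longrightarrow> \<exists>l\<in>carrier B. (\<lambda>n. cnorm B (f n \<ominus> l)) \<longlonglongrightarrow> 0"

definition closed_star_subalgebra :: "('b, 'm) cstar_structure_scheme \<Rightarrow> 'b set \<Rightarrow> bool" where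
  "closed_star_subalgebra B S \<longleftrightarrow>
     S \<subseteq> carrier B \<and> \<one>\<^bsub>B\<^esub> \<in> S \<and>
     (\<forall>x\<in>S. \<forall>y\<in>S. x \<oplus>\<^bsub>B\<^esub> y \<in> S \<and> x \<otimes>\<^bsub>B\<^esub> y \<in> S) \<and>
     (\<forall>c. \<forall>x\<in>S. c \<odot>\<^bsub>B\<^esub> x \<in> S) \<and> (\<forall>x\<in>S. adjoint B x \<in> S) \<and>
     (\<forall>f l. range f \<subseteq> S \<and> l \<in> carrier B \<and> (\<lambda>n::nat. cnorm B (f n \<ominus>\<^bsub>B\<^esub> l)) \<longlonglongrightarrow> 0 \<longrightarrow> l \<in> S)"

definition unital_star_hom ::
  "('b, 'm) cstar_structure_scheme \<Rightarrow> ('c, 'k) cstar_structure_scheme \<Rightarrow> ('b \<Rightarrow> 'c) set" where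
  "unital_star_hom B C = {h \<in> ring_hom B C. \<forall>x\<in>carrier B.
     (\<forall>c. h (c \<odot>\<^bsub>B\<^esub> x) = c \<odot>\<^bsub>C\<^esub> h x) \<and> h (adjoint B x) = adjoint C (h x)}"

text \<open>\<open>R C v\<close> says that the matrix \<open>v\<close> over \<open>C\<close> satisfies the relations. \<open>B\<close> is the universal unital
  C*-algebra for \<open>R\<close>: it is generated by the entries of \<open>u\<close>, and every matrix satisfying \<open>R\<close> over a
  unital C*-algebra is the image of \<open>u\<close> under a (then unique) unital *-homomorphism.
  The test algebras \<open>C\<close> have carriers in the same type as \<open>B\<close>. This is no restriction: the index
  type being finite, a C*-algebra generated by \<open>v\<close> is separable, so if nonzero it has the
  cardinality of the continuum. It has a copy in every type that carries a nonzero C*-algebra.\<close>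

definition universal_cstar_algebra ::
  "('b cstar_structure \<Rightarrow> ('n \<Rightarrow> 'n \<Rightarrow> 'b) \<Rightarrow> bool) \<Rightarrow> 'b cstar_structure \<Rightarrow>
   ('n::finite \<Rightarrow> 'n \<Rightarrow> 'b) \<Rightarrow> bool" where
  "universal_cstar_algebra R B u \<longleftrightarrow>
     unital_cstar_algebra B \<and> (\<forall>i j. u i j \<in> carrier B) \<and> R B u \<and>
     (\<forall>S. closed_star_subalgebra B S \<and> (\<forall>i j. u i j \<in> S) \<longrightarrow> S = carrier B) \<and>
     (\<forall>(C :: 'b cstar_structure) v.
        unital_cstar_algebra C \<and> (\<forall>i j. v i j \<in> carrier C) \<and> R C v \<longrightarrow>
        (\<exists>h\<in>unital_star_hom B C. \<forall>i j. h (u i j) = v i j))"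


section \<open>The quantum groups\<close>

definition selfadjoint_entries :: "'b cstar_structure \<Rightarrow> ('n \<Rightarrow> 'n \<Rightarrow> 'b) \<Rightarrow> bool" where
  "selfadjoint_entries B u \<longleftrightarrow> (\<forall>i j. adjoint B (u i j) = u i j)"

definition orthogonal_relations :: "'b cstar_structure \<Rightarrow> ('n::finite \<Rightarrow> 'n \<Rightarrow> 'b) \<Rightarrow> bool" where
  "orthogonal_relations B u \<longleftrightarrow> (\<forall>i j.
     (\<Oplus>\<^bsub>B\<^esub>k\<in>UNIV. u i k \<otimes>\<^bsub>B\<^esub> u j k) = (if i = j then \<one>\<^bsub>B\<^esub> else \<zero>\<^bsub>B\<^esub>) \<and>
     (\<Oplus>\<^bsub>B\<^esub>k\<in>UNIV. u k i \<otimes>\<^bsub>B\<^esub> u k j) = (if i = j then \<one>\<^bsub>B\<^esub> else \<zero>\<^bsub>B\<^esub>))"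

definition row_column_sums_one :: "'b cstar_structure \<Rightarrow> ('n::finite \<Rightarrow> 'n \<Rightarrow> 'b) \<Rightarrow> bool" where
  "row_column_sums_one B u \<longleftrightarrow> (\<forall>i j.
     (\<Oplus>\<^bsub>B\<^esub>k\<in>UNIV. u i k) = \<one>\<^bsub>B\<^esub> \<and> (\<Oplus>\<^bsub>B\<^esub>k\<in>UNIV. u k j) = \<one>\<^bsub>B\<^esub>)"

definition R_ring_eps ::
  "('n \<Rightarrow> 'n \<Rightarrow> nat) \<Rightarrow> 'b cstar_structure \<Rightarrow> ('n \<Rightarrow> 'n \<Rightarrow> 'b) \<Rightarrow> bool" where
  "R_ring_eps \<epsilon> B u \<longleftrightarrow> (\<forall>i j k l.
     (\<epsilon> i j = 1 \<and> \<epsilon> k l = 1 \<longrightarrow> u i k \<otimes>\<^bsub>B\<^esub> u j l = u j l \<otimes>\<^bsub>B\<^esub> u i k) \<and>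
     (\<epsilon> i j = 1 \<and> \<epsilon> k l = 0 \<longrightarrow> u i k \<otimes>\<^bsub>B\<^esub> u j l = \<zero>\<^bsub>B\<^esub>) \<and>
     (\<epsilon> i j = 0 \<and> \<epsilon> k l = 1 \<longrightarrow> u i k \<otimes>\<^bsub>B\<^esub> u j l = \<zero>\<^bsub>B\<^esub>))"

text \<open>\<open>C_S \<epsilon> B u\<close> states that \<open>B\<close> with the generators \<open>u\<close> is \<open>C(S\<^sub>n\<^sup>\<epsilon>)\<close>; similarly for the others.\<close>

definition C_O :: "('n::finite \<Rightarrow> 'n \<Rightarrow> nat) \<Rightarrow> 'b cstar_structure \<Rightarrow> ('n \<Rightarrow> 'n \<Rightarrow> 'b) \<Rightarrow> bool" where
  "C_O \<epsilon> = universal_cstar_algebra (\<lambda>B u.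
     selfadjoint_entries B u \<and> orthogonal_relations B u \<and> R_ring_eps \<epsilon> B u)"

text \<open>A quotient of a universal C*-algebra by further relations is the universal C*-algebra for all
  the relations together.\<close>

definition C_B :: "('n::finite \<Rightarrow> 'n \<Rightarrow> nat) \<Rightarrow> 'b cstar_structure \<Rightarrow> ('n \<Rightarrow> 'n \<Rightarrow> 'b) \<Rightarrow> bool" where
  "C_B \<epsilon> = universal_cstar_algebra (\<lambda>B u.
     selfadjoint_entries B u \<and> orthogonal_relations B u \<and> R_ring_eps \<epsilon> B u \<and>
     row_column_sums_one B u)"

definition C_H :: "('n::finite \<Rightarrow> 'n \<Rightarrow> nat) \<Rightarrow> 'b cstar_structure \<Rightarrow> ('n \<Rightarrow> 'n \<Rightarrow> 'b) \<Rightarrow> bool" where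
  "C_H \<epsilon> = universal_cstar_algebra (\<lambda>B u.
     selfadjoint_entries B u \<and> orthogonal_relations B u \<and>
     (\<forall>i j k. i \<noteq> j \<longrightarrow> u i k \<otimes>\<^bsub>B\<^esub> u j k = \<zero>\<^bsub>B\<^esub> \<and> u k i \<otimes>\<^bsub>B\<^esub> u k j = \<zero>\<^bsub>B\<^esub>) \<and>
     R_ring_eps \<epsilon> B u)"

definition C_S :: "('n::finite \<Rightarrow> 'n \<Rightarrow> nat) \<Rightarrow> 'b cstar_structure \<Rightarrow> ('n \<Rightarrow> 'n \<Rightarrow> 'b) \<Rightarrow> bool" where
  "C_S \<epsilon> = universal_cstar_algebra (\<lambda>B u.
     selfadjoint_entries B u \<and> (\<forall>i j. u i j \<otimes>\<^bsub>B\<^esub> u i j = u i j) \<and>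
     row_column_sums_one B u \<and> R_ring_eps \<epsilon> B u)"

text \<open>Invariance of the distribution of \<open>x\<close> under the compact matrix quantum group \<open>G\<close> with
  \<open>C(G) = B\<close> and generators \<open>u\<close>; the lists \<open>js\<close> and \<open>is\<close> are \<open>j(1), \<dots>, j(k)\<close> and
  \<open>i(1), \<dots>, i(k)\<close>.\<close>

definition invariant_under ::
  "('a::complex_star_algebra \<Rightarrow> complex) \<Rightarrow> ('n::finite \<Rightarrow> 'a) \<Rightarrow> 'b cstar_structure \<Rightarrow>
   ('n \<Rightarrow> 'n \<Rightarrow> 'b) \<Rightarrow> bool" where
  "invariant_under \<phi> x B u \<longleftrightarrow> (\<forall>js :: 'n list.
     \<phi> (prod_list (map x js)) \<odot>\<^bsub>B\<^esub> \<one>\<^bsub>B\<^esub> =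
     (\<Oplus>\<^bsub>B\<^esub>is\<in>{is. length is = length js}.
        \<phi> (prod_list (map x is)) \<odot>\<^bsub>B\<^esub> foldr (\<otimes>\<^bsub>B\<^esub>) (map2 u is js) \<one>\<^bsub>B\<^esub>))"

end

theory Submission
  imports Defs "HOL-Computational_Algebra.Formal_Power_Series" "HOL-Library.Function_Algebras"
begin

text \<open>
  A linear functional on \<open>C(G)\<close> turns the relations for \<open>u\<close> into relations for a functional on words
  in the letters \<open>(i, j)\<close>, and linear functionals separate points; so invariance becomes an identity
  between complex numbers. Think of \<open>y\<^sub>j = \<Sum>i. x\<^sub>i \<otimes> u\<^sub>i\<^sub>j\<close>: its joint moments have to be those of \<open>x\<close>.

  For \<open>S\<^sub>n\<^sup>\<epsilon>\<close> and \<open>H\<^sub>n\<^sup>\<epsilon>\<close> the centred powers satisfy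
  \<open>y\<^sub>j\<^sup>k - m\<^sub>k = \<Sum>i. (x\<^sub>i\<^sup>k - m\<^sub>k) \<otimes> u\<^sub>i\<^sub>j\<^sup>k\<close>. A product of centred powers whose indices \<open>j\<close> satisfy the condition
  in the definition of \<open>\<epsilon>\<close>-independence has expectation zero term by term, because either the indices
  \<open>i\<close> satisfy it, too, or the product of the \<open>u\<^sub>i\<^sub>j\<close> vanishes. Any other product is shortened by
  commuting and merging two factors, so all moments are determined.

  For \<open>B\<^sub>n\<^sup>\<epsilon>\<close> and \<open>O\<^sub>n\<^sup>\<epsilon>\<close> the moments of semicircular variables are vacuum expectations on a Fock space
  spanned by words: \<open>x\<^sub>j\<close> times a Wick product adds the letter \<open>j\<close>, multiplies by the mean, or removes a
  letter \<open>j\<close>, and \<open>u\<close> intertwines these three operations.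
\<close>

text \<open>A functional on \<open>C(G)\<close> is linear but not multiplicative, so every relation
  for \<open>u\<close> is recorded inside an arbitrary word, with a left and a right context. This
  replaces the tensor product of the two algebras, which is never built. That all moments are
  determined is used by comparison with the identity matrix
  \<open>u\<^sub>i\<^sub>j = \<delta>\<^sub>i\<^sub>j\<close>, for which invariance is trivial. For
  \<open>H\<^sub>n\<^sup>\<epsilon>\<close> the relations give powers
  \<open>u\<^sub>i\<^sub>j\<^sup>k\<close> with column sums one only for even \<open>k\<close>. An
  even distribution has no odd moments, so the relations hold once they are weighted with the moment
  \<open>m\<^sub>k\<close>, and in this weighted form they serve
  \<open>S\<^sub>n\<^sup>\<epsilon>\<close> as well. For \<open>S\<^sub>n\<^sup>\<epsilon>\<close>
  the obstacle is that orthogonality of distinct entries of a row or column is not among the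
  relations. It has to follow from the entries being projections with sum one. Instead of a theory
  of positive elements, the argument uses norms only: the unit of a corner is an extreme point of
  the unit ball.\<close>

lemma sum_lists_Suc:
  fixes f :: "'n::finite list \<Rightarrow> 'c::comm_monoid_add"
  shows "(\<Sum>is | length is = Suc n. f is) = (\<Sum>i\<in>UNIV. \<Sum>is | length is = n. f (i # is))"
proof -
  have "{is :: 'n list. length is = Suc n} = (\<lambda>(i, is). i # is) ` (UNIV \<times> {is. length is = n})"
    by (auto simp: length_Suc_conv image_iff)
  moreover have "inj_on (\<lambda>(i, is). i # is) (UNIV \<times> {is :: 'n list. length is = n})"
    by (auto simp: inj_on_def)
  ultimately have "(\<Sum>is | length is = Suc n. f is) =
      (\<Sum>p\<in>UNIV \<times> {is. length is = n}. case p of (i, is) \<Rightarrow> f (i # is))"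
    by (auto simp: sum.reindex intro!: sum.cong)
  then show ?thesis
    by (simp add: sum.cartesian_product)
qed

lemma sum_lists_snoc:
  fixes f :: "'n::finite list \<Rightarrow> 'c::comm_monoid_add"
  shows "(\<Sum>is | length is = Suc n. f is) = (\<Sum>is | length is = n. \<Sum>i\<in>UNIV. f (is @ [i]))"
proof -
  have "{is :: 'n list. length is = Suc n} = (\<lambda>(is, i). is @ [i]) ` ({is. length is = n} \<times> UNIV)"
    by (auto simp: image_iff length_Suc_conv_rev)
  moreover have "inj_on (\<lambda>(is, i). is @ [i]) ({is :: 'n list. length is = n} \<times> UNIV)"
    by (auto simp: inj_on_def)
  ultimately have "(\<Sum>is | length is = Suc n. f is) =
      (\<Sum>p\<in>{is. length is = n} \<times> UNIV. case p of (is, i) \<Rightarrow> f (is @ [i]))"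
    by (auto simp: sum.reindex intro!: sum.cong)
  then show ?thesis
    by (simp add: sum.cartesian_product)
qed

section \<open>Words in partially commuting letters\<close>

text \<open>\<open>remove_letter \<epsilon> a w\<close> deletes the occurrence of \<open>a\<close> in \<open>w\<close> that can be moved to the front by
  commutations, if there is one. As \<open>\<epsilon> a a = 0\<close>, it is the first occurrence of \<open>a\<close>.\<close>

fun remove_letter :: "('n \<Rightarrow> 'n \<Rightarrow> nat) \<Rightarrow> 'n \<Rightarrow> 'n list \<Rightarrow> 'n list option" where
  "remove_letter \<epsilon> a [] = None"
| "remove_letter \<epsilon> a (b # w) = (if a = b then Some w
     else if \<epsilon> a b = 1 then map_option ((#) b) (remove_letter \<epsilon> a w) else None)"

text \<open>A recursive form of the index condition in the definition of \<epsilon>-independence;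
  \<open>alternating_nth\<close> translates it back into positions.\<close>

fun alternating :: "('n \<Rightarrow> 'n \<Rightarrow> nat) \<Rightarrow> 'n list \<Rightarrow> bool" where
  "alternating \<epsilon> [] \<longleftrightarrow> True"
| "alternating \<epsilon> (a # w) \<longleftrightarrow> remove_letter \<epsilon> a w = None \<and> alternating \<epsilon> w"

lemma remove_letter_length: "remove_letter \<epsilon> a w = Some v \<Longrightarrow> length w = Suc (length v)"
  by (induction w arbitrary: v) (auto split: if_splits)

lemma remove_letter_SomeD:
  "remove_letter \<epsilon> a w = Some v \<Longrightarrow> \<exists>s t. w = s @ a # t \<and> v = s @ t \<and> (\<forall>b\<in>set s. \<epsilon> a b = 1)"
proof (induction w arbitrary: v)
  case (Cons b w)
  show ?case
  proof (cases "a = b")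
    case True
    then show ?thesis
      using Cons.prems by (intro exI[of _ "[]"] exI[of _ v]) auto
  next
    case False
    then obtain v' where v': "\<epsilon> a b = 1" "remove_letter \<epsilon> a w = Some v'" "v = b # v'"
      using Cons.prems by (auto split: if_splits)
    then obtain s t where "w = s @ a # t" "v' = s @ t" "\<forall>b\<in>set s. \<epsilon> a b = 1"
      using Cons.IH by blast
    then show ?thesis
      using v' by (intro exI[of _ "b # s"] exI[of _ t]) auto
  qed
qed simp

locale commutation_matrix =
  fixes \<epsilon> :: "'n::finite \<Rightarrow> 'n \<Rightarrow> nat"
  assumes eps_values: "\<epsilon> i j \<in> {0, 1}"
    and eps_sym: "\<epsilon> i j = \<epsilon> j i"
    and eps_diag: "\<epsilon> i i = 0"
begin

lemma eps_eq_0_iff: "\<epsilon> i j = 0 \<longleftrightarrow> \<epsilon> i j \<noteq> 1"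
  using eps_values[of i j] by auto

text \<open>Commuting letters are distinct and never block each other, so deleting one does not
  affect whether and where the other can be deleted. \<open>Option.bind\<close> includes the case of
  failure.\<close>

lemma remove_letter_commute:
  assumes "\<epsilon> a b = 1"
  shows "Option.bind (remove_letter \<epsilon> a w) (remove_letter \<epsilon> b) =
    Option.bind (remove_letter \<epsilon> b w) (remove_letter \<epsilon> a)"
proof (induction w)
  case (Cons c w)
  have "\<epsilon> b a = 1" "a \<noteq> b"
    using assms eps_sym[of a b] eps_diag[of a] by auto
  moreover have "Option.bind (map_option ((#) c) X) (remove_letter \<epsilon> d) =
     map_option ((#) c) (Option.bind X (remove_letter \<epsilon> d))"
    if "\<epsilon> d c = 1" "d \<noteq> c" for X d
    using that by (cases X) auto
  moreover have "Option.bind (map_option ((#) c) X) (remove_letter \<epsilon> d) = None"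
    if "\<epsilon> d c \<noteq> 1" "d \<noteq> c" for X d
    using that by (cases X) auto
  moreover have "Option.bind (map_option ((#) c) X) (remove_letter \<epsilon> c) = X" for X
    by (cases X) auto
  ultimately show ?case
    using assms Cons.IH by auto
qed simp

lemma remove_letter_None_iff:
  assumes "\<epsilon> a b = 1" "remove_letter \<epsilon> a w = Some v"
  shows "remove_letter \<epsilon> b w = None \<longleftrightarrow> remove_letter \<epsilon> b v = None"
  using assms(2)
proof (induction w arbitrary: v)
  case (Cons c w)
  have "\<epsilon> b a = 1" "a \<noteq> b"
    using assms(1) eps_sym[of a b] eps_diag[of a] by auto
  then show ?case
    using Cons by (auto split: if_splits)
qed simp

text \<open>The search for \<open>a\<close> fails only by meeting a letter that differs from
  \<open>a\<close> and does not commute with it, and this happens before any occurrence of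
  \<open>a\<close> is reached.\<close>

lemma remove_letter_None_nth:
  assumes "remove_letter \<epsilon> a w = None" "r < length w" "w ! r = a"
  shows "\<exists>q<r. \<epsilon> a (w ! q) = 0 \<and> a \<noteq> w ! q"
  using assms
proof (induction w arbitrary: r)
  case (Cons b w)
  have ab: "a \<noteq> b"
    using Cons.prems(1) by auto
  then obtain r' where r: "r = Suc r'"
    using Cons.prems(3) by (cases r) auto
  show ?case
  proof (cases "\<epsilon> a b = 1")
    case True
    then have "remove_letter \<epsilon> a w = None"
      using ab Cons.prems(1) by simp
    then obtain q where "q < r'" "\<epsilon> a (w ! q) = 0 \<and> a \<noteq> w ! q"
      using Cons.IH[of r'] Cons.prems r by auto
    then show ?thesis
      using r by (intro exI[of _ "Suc q"]) auto
  next
    case False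
    then show ?thesis
      using ab r eps_eq_0_iff[of a b] by (intro exI[of _ 0]) simp
  qed
qed simp

lemma alternating_nth:
  assumes "alternating \<epsilon> w" "p < r" "r < length w" "w ! p = w ! r"
  shows "\<exists>q. p < q \<and> q < r \<and> \<epsilon> (w ! p) (w ! q) = 0 \<and> w ! p \<noteq> w ! q"
  using assms
proof (induction w arbitrary: p r)
  case (Cons b w)
  obtain r' where r: "r = Suc r'"
    using Cons.prems(2) by (cases r) auto
  show ?case
  proof (cases p)
    case 0
    then obtain q where "q < r'" "\<epsilon> b (w ! q) = 0 \<and> b \<noteq> w ! q"
      using remove_letter_None_nth[of b w r', OF _ _ sym] Cons.prems r by fastforce
    then show ?thesis
      using 0 r by (intro exI[of _ "Suc q"]) auto
  next
    case (Suc p')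
    then obtain q where "p' < q" "q < r'" "\<epsilon> (w ! p') (w ! q) = 0 \<and> w ! p' \<noteq> w ! q"
      using Cons.IH[of p' r'] Cons.prems r by auto
    then show ?thesis
      using Suc r by (intro exI[of _ "Suc q"]) auto
  qed
qed simp

text \<open>The two occurrences of \<open>a\<close> can be brought together by commutations. For
  column indices this permits a merge of two factors; for row indices it leads to a vanishing
  product of entries.\<close>

lemma not_alternatingE:
  assumes "\<not> alternating \<epsilon> w"
  obtains s a t v where "w = s @ a # t @ a # v" "\<forall>b\<in>set t. \<epsilon> a b = 1"
proof -
  have "\<exists>s a t v. w = s @ a # t @ a # v \<and> (\<forall>b\<in>set t. \<epsilon> a b = 1)"
    using assms
  proof (induction w)
    case (Cons b w)
    show ?case
    proof (cases "alternating \<epsilon> w")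
      case True
      then obtain v where "remove_letter \<epsilon> b w = Some v"
        using Cons.prems by auto
      from remove_letter_SomeD[OF this] show ?thesis
        by (metis append_Nil)
    next
      case False
      then show ?thesis
        using Cons.IH by (metis append_Cons)
    qed
  qed simp
  then show thesis
    using that by blast
qed

end

section \<open>Star algebras and unital functionals\<close>

lemma cscale_zero_left [simp]: "cscale 0 (a :: 'a::complex_star_algebra) = 0"
  using cscale_add_left[of 0 0 a] by simp

lemma cscale_zero_right [simp]: "cscale c (0 :: 'a::complex_star_algebra) = 0"
  using cscale_add_right[of c 0 0] by simp

lemma cscale_minus_right: "cscale c (- a :: 'a::complex_star_algebra) = - cscale c a"
  using cscale_add_right[of c a "- a"] by (simp add: eq_neg_iff_add_eq_0 add.commute)

lemma cscale_diff_right: "cscale c (a - b :: 'a::complex_star_algebra) = cscale c a - cscale c b"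
  using cscale_add_right[of c a "- b"] by (simp add: cscale_minus_right)

lemma cscale_minus_left: "cscale (- c) (a :: 'a::complex_star_algebra) = - cscale c a"
  using cscale_add_left[of c "- c" a] by (simp add: eq_neg_iff_add_eq_0 add.commute)

locale unital_functional =
  fixes \<phi> :: "'a::complex_star_algebra \<Rightarrow> complex"
  assumes unital_linear: "unital_linear_functional \<phi>"
begin

lemma phi_add: "\<phi> (a + b) = \<phi> a + \<phi> b"
  and phi_cscale: "\<phi> (cscale c a) = c * \<phi> a"
  and phi_one: "\<phi> 1 = 1"
  using unital_linear by (auto simp: unital_linear_functional_def)

lemma phi_diff: "\<phi> (a - b) = \<phi> a - \<phi> b"
  using phi_add[of "a - b" b] by simp

end

section \<open>Generated subalgebras and products of centred elements\<close>

lemma unital_subalgebra_generated: "unital_subalgebra (generated_subalgebra a)"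
  by (auto simp: generated_subalgebra_def unital_subalgebra_def)

lemma generator_in_generated: "a \<in> generated_subalgebra a"
  by (auto simp: generated_subalgebra_def)

lemma
  assumes "unital_subalgebra S"
  shows subalgebra_one: "1 \<in> S"
    and subalgebra_add: "a \<in> S \<Longrightarrow> b \<in> S \<Longrightarrow> a + b \<in> S"
    and subalgebra_mult: "a \<in> S \<Longrightarrow> b \<in> S \<Longrightarrow> a * b \<in> S"
    and subalgebra_cscale: "a \<in> S \<Longrightarrow> cscale c a \<in> S"
  using assms by (auto simp: unital_subalgebra_def)

lemma subalgebra_diff:
  assumes "unital_subalgebra S" "a \<in> S" "b \<in> S"
  shows "a - b \<in> S"
  using subalgebra_add[OF assms(1,2) subalgebra_cscale[OF assms(1,3), of "- 1"]]
  by (simp add: cscale_minus_left cscale_one)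

lemma subalgebra_power: "unital_subalgebra S \<Longrightarrow> a \<in> S \<Longrightarrow> a ^ k \<in> S"
  by (induction k) (auto intro: subalgebra_one subalgebra_mult)

locale eps_independent_family = commutation_matrix \<epsilon> + unital_functional \<phi>
  for \<epsilon> :: "'n::finite \<Rightarrow> 'n \<Rightarrow> nat" and \<phi> :: "'a::complex_star_algebra \<Rightarrow> complex" +
  fixes x :: "'n \<Rightarrow> 'a"
  assumes independent: "eps_independent \<epsilon> \<phi> x"
begin

lemma generated_commute:
  assumes "\<epsilon> i j = 1" "a \<in> generated_subalgebra (x i)" "b \<in> generated_subalgebra (x j)"
  shows "a * b = b * a"
  using independent assms unfolding eps_independent_def eps_independent_subalgebras_def by meson

lemma phi_alternating_product:
  assumes "as \<noteq> []" "length is = length as" "alternating \<epsilon> is"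
    and "\<And>p. p < length as \<Longrightarrow> as ! p \<in> generated_subalgebra (x (is ! p))"
    and "\<And>p. p < length as \<Longrightarrow> \<phi> (as ! p) = 0"
  shows "\<phi> (prod_list as) = 0"
proof -
  have "\<forall>p r. p < r \<and> r < length as \<and> is ! p = is ! r \<longrightarrow>
      (\<exists>q. p < q \<and> q < r \<and> \<epsilon> (is ! p) (is ! q) = 0 \<and> is ! p \<noteq> is ! q)"
    using alternating_nth[OF assms(3)] assms(2) by auto
  moreover have "\<forall>is as. as \<noteq> [] \<and> length is = length as \<and>
        (\<forall>p<length as. as ! p \<in> generated_subalgebra (x (is ! p)) \<and> \<phi> (as ! p) = 0) \<and>
        (\<forall>p r. p < r \<and> r < length as \<and> is ! p = is ! r \<longrightarrow>
           (\<exists>q. p < q \<and> q < r \<and> \<epsilon> (is ! p) (is ! q) = 0 \<and> is ! p \<noteq> is ! q)) \<longrightarrow>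
        \<phi> (prod_list as) = 0"
    using independent unfolding eps_independent_def eps_independent_subalgebras_def by argo
  ultimately show ?thesis
    using assms by (elim allE[of _ "is"] allE[of _ "as"]) simp
qed

end

text \<open>\<open>\<tau> w\<close> stands for the value of a linear functional at the product of
  the entries \<open>u i j\<close> along \<open>w\<close>. The contexts \<open>w\<close> and
  \<open>w'\<close> are part of the axioms because such a functional is not multiplicative.\<close>

locale eps_word_functional = commutation_matrix \<epsilon>
  for \<epsilon> :: "'n::finite \<Rightarrow> 'n \<Rightarrow> nat" +
  fixes \<tau> :: "('n \<times> 'n) list \<Rightarrow> complex"
  assumes swap: "\<lbrakk>\<epsilon> i j = 1; \<epsilon> k l = 1\<rbrakk> \<Longrightarrow> \<tau> (w @ (i, k) # (j, l) # w') = \<tau> (w @ (j, l) # (i, k) # w')"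
    and mixed_zero: "(\<epsilon> i j = 1) \<noteq> (\<epsilon> k l = 1) \<Longrightarrow> \<tau> (w @ (i, k) # (j, l) # w') = 0"

section \<open>Wick products for shifted semicircular variables\<close>

text \<open>Rescaled Chebyshev polynomials: the orthogonal polynomials of the semicircular distribution
  with mean \<open>c\<close> and variance \<open>d\<close>.\<close>

fun cheb :: "complex \<Rightarrow> complex \<Rightarrow> 'a::complex_star_algebra \<Rightarrow> nat \<Rightarrow> 'a" where
  "cheb c d a 0 = 1"
| "cheb c d a (Suc 0) = a - cscale c 1"
| "cheb c d a (Suc (Suc n)) = (a - cscale c 1) * cheb c d a (Suc n) - cscale d (cheb c d a n)"

lemma cheb_in_generated: "cheb c d a n \<in> generated_subalgebra a"
proof (induction n rule: cheb.induct[where P = "\<lambda>_ _ _ n. cheb c d a n \<in> generated_subalgebra a"])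
qed (auto intro!: subalgebra_one subalgebra_diff subalgebra_mult subalgebra_cscale
      unital_subalgebra_generated generator_in_generated)

text \<open>Vanishing of \<open>\<phi>\<close> on the Chebyshev polynomials is all that the Wick
  calculus needs from the distribution; free cumulants enter only when this is verified.\<close>

locale semicircular_family = eps_independent_family \<epsilon> \<phi> x
  for \<epsilon> :: "'n::finite \<Rightarrow> 'n \<Rightarrow> nat" and \<phi> :: "'a::complex_star_algebra \<Rightarrow> complex"
    and x :: "'n \<Rightarrow> 'a" +
  fixes c d :: complex
  assumes phi_cheb: "n \<ge> 1 \<Longrightarrow> \<phi> (cheb c d (x i) n) = 0"
begin

text \<open>The polynomial in the variables that sends the vacuum to the basis word. The equation is
  the Fock space rule, creation plus mean plus annihilation, solved for the created word.\<close>

function wick :: "'n list \<Rightarrow> 'a" where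
  "wick [] = 1"
| "wick (a # w) = (x a - cscale c 1) * wick w -
     (case remove_letter \<epsilon> a w of None \<Rightarrow> 0 | Some v \<Rightarrow> cscale d (wick v))"
  by pat_completeness auto
termination
  by (relation "Wellfounded.measure length") (auto dest: remove_letter_length)

definition wick_opt :: "'n list option \<Rightarrow> 'a" where
  "wick_opt w = (case w of None \<Rightarrow> 0 | Some v \<Rightarrow> wick v)"

lemma wick_opt_simps [simp]: "wick_opt None = 0" "wick_opt (Some v) = wick v"
  by (auto simp: wick_opt_def)

lemma wick_Cons: "wick (a # w) = (x a - cscale c 1) * wick w - cscale d (wick_opt (remove_letter \<epsilon> a w))"
  by (cases "remove_letter \<epsilon> a w") auto

declare wick.simps(2) [simp del]

text \<open>Wick products depend on a word only up to commutations. Expanding both leading letters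
  gives an expression that is symmetric in them.\<close>

lemma wick_front:
  "remove_letter \<epsilon> a w = Some v \<Longrightarrow> wick w = wick (a # v)"
proof (induction "length w" arbitrary: w v rule: less_induct)
  case less
  obtain k w0 where w: "w = k # w0"
    using less.prems by (cases w) auto
  show ?case
  proof (cases "a = k")
    case True
    then show ?thesis
      using less.prems w by simp
  next
    case False
    then obtain v0 where v0: "\<epsilon> a k = 1" "remove_letter \<epsilon> a w0 = Some v0" "v = k # v0"
      using less.prems w by (auto split: if_splits)
    let ?y = "\<lambda>i. x i - cscale c 1"
    let ?r = "remove_letter \<epsilon>"
    have comm: "?y k * ?y a = ?y a * ?y k"
      by (intro generated_commute[of k a])
        (use v0 eps_sym[of a k] in \<open>auto intro!: subalgebra_one subalgebra_diff subalgebra_mult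
           subalgebra_cscale unital_subalgebra_generated generator_in_generated\<close>)
    have IH: "wick w0 = wick (a # v0)"
      using less.hyps v0(2) w by simp
    \<comment> \<open>If \<open>k\<close> occurs removably in \<open>w0\<close>, deleting it leaves
      a word that still has \<open>a\<close> removable. This shorter word is not a suffix of
      \<open>w\<close>, which is why the induction is on the length.\<close>
    have tail: "wick_opt (?r k w0) =
      ?y a * wick_opt (?r k v0) - cscale d (wick_opt (Option.bind (?r a v0) (?r k)))"
    proof (cases "?r k w0")
      case None
      then have "?r k v0 = None"
        using remove_letter_None_iff[OF v0(1,2)] by simp
      moreover have "Option.bind (?r a v0) (?r k) = Option.bind (?r k v0) (?r a)"
        by (rule remove_letter_commute[OF v0(1)])
      ultimately show ?thesis
        using None by simp
    next
      case (Some y)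
      have "Option.bind (?r a w0) (?r k) = Option.bind (?r k w0) (?r a)"
        by (rule remove_letter_commute[OF v0(1)])
      then have ay: "?r k v0 = ?r a y"
        using Some v0 by simp
      moreover have "?r k v0 \<noteq> None"
        using remove_letter_None_iff[OF v0(1,2)] Some by simp
      ultimately obtain y' where y': "?r a y = Some y'" "?r k v0 = Some y'"
        by auto
      have "length y < length w"
        using remove_letter_length[OF Some] w by simp
      then have "wick y = wick (a # y')"
        using less.hyps y'(1) by simp
      moreover have "Option.bind (?r a v0) (?r k) = Option.bind (?r k v0) (?r a)"
        by (rule remove_letter_commute[OF v0(1)])
      ultimately show ?thesis
        using Some y' by (simp add: wick_Cons)
    qed
    have head: "wick_opt (?r a (k # v0)) =
      ?y k * wick_opt (?r a v0) - cscale d (wick_opt (Option.bind (?r a v0) (?r k)))"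
      using v0(1) False by (cases "?r a v0") (auto simp: wick_Cons)
    have "wick w = ?y k * (?y a * wick v0 - cscale d (wick_opt (?r a v0))) -
        cscale d (?y a * wick_opt (?r k v0) - cscale d (wick_opt (Option.bind (?r a v0) (?r k))))"
      unfolding w wick_Cons[of k] IH tail wick_Cons[of a] ..
    \<comment> \<open>The exchange of \<open>a\<close> and \<open>k\<close>: the linear factors
      commute by independence, and the term with two deletions is symmetric by
      \<open>remove_letter_commute\<close>.\<close>
    also have "\<dots> = ?y a * (?y k * wick v0 - cscale d (wick_opt (?r k v0))) -
        cscale d (?y k * wick_opt (?r a v0) - cscale d (wick_opt (Option.bind (?r a v0) (?r k))))"
    proof -
      have "?y k * (?y a * wick v0) = ?y a * (?y k * wick v0)"
        by (simp only: comm mult.assoc[symmetric])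
      then show ?thesis
        by (simp only: right_diff_distrib[of "?y k"] right_diff_distrib[of "?y a"]
            cscale_diff_right cscale_mult_right) simp
    qed
    also have "\<dots> = wick (a # v)"
      unfolding v0(3) wick_Cons[of a] head wick_Cons[of k] ..
    finally show ?thesis .
  qed
qed

text \<open>Collecting all copies of \<open>a\<close> that can reach the front turns the Wick
  recursion into the three-term recursion of \<open>cheb\<close>. The last conjunct supplies the
  annihilation term for the next copy; the one on other letters \<open>b\<close> keeps blocked
  letters blocked, as the factorization below requires.\<close>

lemma wick_split_letter:
  "\<exists>n v. wick w = cheb c d (x a) n * wick v \<and> length w = n + length v \<and>
     remove_letter \<epsilon> a v = None \<and> (n = 0 \<longleftrightarrow> remove_letter \<epsilon> a w = None) \<and>
     (\<forall>b. \<epsilon> a b = 1 \<longrightarrow> remove_letter \<epsilon> b w = None \<longrightarrow> remove_letter \<epsilon> b v = None) \<and>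
     (n \<ge> 1 \<longrightarrow> wick_opt (remove_letter \<epsilon> a w) = cheb c d (x a) (n - 1) * wick v)"
proof (induction "length w" arbitrary: w rule: less_induct)
  case less
  show ?case
  proof (cases "remove_letter \<epsilon> a w")
    case None
    then show ?thesis
      by (intro exI[of _ 0] exI[of _ w]) auto
  next
    case (Some u)
    have "length u < length w"
      using remove_letter_length[OF Some] by simp
    from less.hyps[OF this] obtain n v where nv:
      "wick u = cheb c d (x a) n * wick v" "length u = n + length v"
      "remove_letter \<epsilon> a v = None" "n = 0 \<longleftrightarrow> remove_letter \<epsilon> a u = None"
      "\<forall>b. \<epsilon> a b = 1 \<longrightarrow> remove_letter \<epsilon> b u = None \<longrightarrow> remove_letter \<epsilon> b v = None"
      "n \<ge> 1 \<longrightarrow> wick_opt (remove_letter \<epsilon> a u) = cheb c d (x a) (n - 1) * wick v"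
      by (elim exE conjE) (rule that; assumption)
    have "wick w = (x a - cscale c 1) * wick u - cscale d (wick_opt (remove_letter \<epsilon> a u))"
      unfolding wick_front[OF Some] wick_Cons ..
    also have "\<dots> = cheb c d (x a) (Suc n) * wick v"
    proof (cases n)
      case 0
      then show ?thesis
        using nv by simp
    next
      case (Suc m)
      have "wick_opt (remove_letter \<epsilon> a u) = cheb c d (x a) m * wick v"
        using nv(6) Suc by simp
      then show ?thesis
        using nv(1) Suc by (simp add: left_diff_distrib cscale_mult_left mult.assoc)
    qed
    finally have "wick w = cheb c d (x a) (Suc n) * wick v" .
    moreover have "remove_letter \<epsilon> b v = None" if "\<epsilon> a b = 1" "remove_letter \<epsilon> b w = None" for b
      using nv(5) that remove_letter_None_iff[OF that(1) Some] by simp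
    ultimately show ?thesis
      using nv Some remove_letter_length[OF Some]
      by (intro exI[of _ "Suc n"] exI[of _ v]) auto
  qed
qed

text \<open>Splitting off one letter after another gives blocks with alternating indices. The last
  conjunct strengthens the induction: applied to the letter just split off, it is the condition for
  prepending its block.\<close>

lemma wick_factorization:
  "\<exists>L. wick w = prod_list (map (\<lambda>(a, n). cheb c d (x a) n) L) \<and> (\<forall>(a, n)\<in>set L. n \<ge> 1) \<and>
     alternating \<epsilon> (map fst L) \<and> (w \<noteq> [] \<longrightarrow> L \<noteq> []) \<and>
     (\<forall>b. remove_letter \<epsilon> b w = None \<longrightarrow> remove_letter \<epsilon> b (map fst L) = None)"
proof (induction "length w" arbitrary: w rule: less_induct)
  case less
  show ?case
  proof (cases w)
    case Nil
    then show ?thesis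
      by (intro exI[of _ "[]"]) auto
  next
    case (Cons a w0)
    obtain n v where nv: "wick w = cheb c d (x a) n * wick v" "length w = n + length v"
      "remove_letter \<epsilon> a v = None" "n = 0 \<longleftrightarrow> remove_letter \<epsilon> a w = None"
      "\<forall>b. \<epsilon> a b = 1 \<longrightarrow> remove_letter \<epsilon> b w = None \<longrightarrow> remove_letter \<epsilon> b v = None"
      using wick_split_letter[of w a] by (elim exE conjE) (rule that; assumption)
    have n: "n \<ge> 1"
      using nv(4) Cons by (cases n) auto
    then obtain L where L: "wick v = prod_list (map (\<lambda>(a, n). cheb c d (x a) n) L)"
      "\<forall>(a, n)\<in>set L. n \<ge> 1" "alternating \<epsilon> (map fst L)"
      "\<forall>b. remove_letter \<epsilon> b v = None \<longrightarrow> remove_letter \<epsilon> b (map fst L) = None"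
      using less[of v] nv(2) by auto
    have "remove_letter \<epsilon> b (map fst ((a, n) # L)) = None" if "remove_letter \<epsilon> b w = None" for b
    proof -
      have "b \<noteq> a"
        using that Cons by auto
      moreover have "remove_letter \<epsilon> b (map fst L) = None" if "\<epsilon> b a = 1"
        using L(4) nv(5) \<open>remove_letter \<epsilon> b w = None\<close> that eps_sym[of b a] by simp
      ultimately show ?thesis
        by simp
    qed
    then show ?thesis
      using L nv n by (intro exI[of _ "(a, n) # L"]) auto
  qed
qed

text \<open>By the factorization, a nonempty word gives a product of centred elements with
  alternating indices, to which independence applies.\<close>

lemma phi_wick: "\<phi> (wick w) = (if w = [] then 1 else 0)"
proof (cases "w = []")
  case False
  obtain L where L: "wick w = prod_list (map (\<lambda>(a, n). cheb c d (x a) n) L)"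
    "\<forall>(a, n)\<in>set L. n \<ge> 1" "alternating \<epsilon> (map fst L)" "L \<noteq> []"
    using wick_factorization[of w] False by blast
  have "\<phi> (prod_list (map (\<lambda>(a, n). cheb c d (x a) n) L)) = 0"
  proof (rule phi_alternating_product[of _ "map fst L"])
    fix p assume "p < length (map (\<lambda>(a, n). cheb c d (x a) n) L)"
    then have "L ! p \<in> set L"
      by simp
    then have "snd (L ! p) \<ge> 1"
      using L(2) by (auto simp: case_prod_beta)
    then show "\<phi> (map (\<lambda>(a, n). cheb c d (x a) n) L ! p) = 0"
      using phi_cheb \<open>p < _\<close> by (simp add: case_prod_beta)
  qed (use L in \<open>auto simp: case_prod_beta cheb_in_generated\<close>)
  then show ?thesis
    using L(1) False by simp
qed (simp add: phi_one)

lemma variable_times_wick: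
  "x j * wick v = wick (j # v) + cscale c (wick v) + cscale d (wick_opt (remove_letter \<epsilon> j v))"
  by (simp add: wick_Cons left_diff_distrib cscale_mult_left)

text \<open>The vacuum coefficient after the variables of \<open>w\<close> act on the Fock space
  vector \<open>v\<close>. Moments are the case of empty \<open>v\<close>; general \<open>v\<close>
  lets an induction peel off the variable that acts first.\<close>

definition wick_moment :: "'n list \<Rightarrow> 'n list \<Rightarrow> complex" where
  "wick_moment w v = \<phi> (prod_list (map x w) * wick v)"

lemma wick_moment_snoc:
  "wick_moment (w @ [j]) v = wick_moment w (j # v) + c * wick_moment w v +
     d * (case remove_letter \<epsilon> j v of None \<Rightarrow> 0 | Some u \<Rightarrow> wick_moment w u)"
proof -
  have "wick_moment (w @ [j]) v = \<phi> (prod_list (map x w) * (x j * wick v))"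
    by (simp add: wick_moment_def mult.assoc)
  then show ?thesis
    unfolding variable_times_wick
    by (cases "remove_letter \<epsilon> j v")
       (simp_all add: wick_moment_def distrib_left phi_add phi_cscale cscale_mult_right)
qed

end

section \<open>Orthogonal matrices acting on Fock space words\<close>

locale orthogonal_word_functional = eps_word_functional \<epsilon> \<tau>
  for \<epsilon> :: "'n::finite \<Rightarrow> 'n \<Rightarrow> nat" and \<tau> +
  assumes orthogonal:
    "(\<Sum>i\<in>UNIV. \<tau> (w @ (i, k) # (i, l) # w')) = (if k = l then \<tau> (w @ w') else 0)"
begin

text \<open>The matrix \<open>u\<close> intertwines the removal of letters.\<close>

lemma sum_remove_letter:
  fixes q :: "'n list \<Rightarrow> complex"
  shows "(\<Sum>i\<in>UNIV. \<Sum>vs | length vs = length v.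
       (case remove_letter \<epsilon> i vs of None \<Rightarrow> 0 | Some u \<Rightarrow> q u) * \<tau> (w @ (i, j) # zip vs v)) =
     (case remove_letter \<epsilon> j v of None \<Rightarrow> 0
      | Some u \<Rightarrow> \<Sum>us | length us = length u. q us * \<tau> (w @ zip us u))"
proof (induction v arbitrary: q w)
  case Nil
  then show ?case by simp
next
  case (Cons k v)
  define P where "P = (\<lambda>f :: 'n list \<Rightarrow> complex. \<lambda>u. case u of None \<Rightarrow> 0 | Some u \<Rightarrow> f u)"
  \<comment> \<open>Either the head is deleted, or a commuting head is skipped. The two resulting
    sums match the two clauses of \<open>remove_letter\<close> on the column side.\<close>
  have split: "P q (remove_letter \<epsilon> i (l # vs)) = (if i = l then q vs else 0) +
     (if \<epsilon> i l = 1 then P (\<lambda>us. q (l # us)) (remove_letter \<epsilon> i vs) else 0)" for i l vs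
    using eps_diag[of i] by (cases "remove_letter \<epsilon> i vs") (auto simp: P_def)
  have "(\<Sum>i\<in>UNIV. \<Sum>vs | length vs = length (k # v).
       P q (remove_letter \<epsilon> i vs) * \<tau> (w @ (i, j) # zip vs (k # v))) =
     (\<Sum>i\<in>UNIV. \<Sum>l\<in>UNIV. \<Sum>vs | length vs = length v.
       P q (remove_letter \<epsilon> i (l # vs)) * \<tau> (w @ (i, j) # (l, k) # zip vs v))"
    by (simp only: list.size(4) add_Suc_right add_0_right sum_lists_Suc zip_Cons_Cons)
  also have "\<dots> =
     (\<Sum>i\<in>UNIV. \<Sum>l\<in>UNIV. \<Sum>vs | length vs = length v.
       (if i = l then q vs else 0) * \<tau> (w @ (i, j) # (l, k) # zip vs v)) +
     (\<Sum>i\<in>UNIV. \<Sum>l\<in>UNIV. \<Sum>vs | length vs = length v.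
       (if \<epsilon> i l = 1 then P (\<lambda>us. q (l # us)) (remove_letter \<epsilon> i vs) else 0) *
         \<tau> (w @ (i, j) # (l, k) # zip vs v))"
    by (simp only: split distrib_right sum.distrib)
  also have "(\<Sum>i\<in>UNIV. \<Sum>l\<in>UNIV. \<Sum>vs | length vs = length v.
       (if i = l then q vs else 0) * \<tau> (w @ (i, j) # (l, k) # zip vs v)) =
     (\<Sum>i\<in>UNIV. \<Sum>vs | length vs = length v. q vs * \<tau> (w @ (i, j) # (i, k) # zip vs v))"
  proof (rule sum.cong[OF refl])
    fix i
    have "(\<Sum>l\<in>UNIV. \<Sum>vs | length vs = length v.
        (if i = l then q vs else 0) * \<tau> (w @ (i, j) # (l, k) # zip vs v)) =
      (\<Sum>l\<in>UNIV. if i = l then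
         \<Sum>vs | length vs = length v. q vs * \<tau> (w @ (i, j) # (l, k) # zip vs v) else 0)"
      by (intro sum.cong) auto
    then show "(\<Sum>l\<in>UNIV. \<Sum>vs | length vs = length v.
        (if i = l then q vs else 0) * \<tau> (w @ (i, j) # (l, k) # zip vs v)) =
      (\<Sum>vs | length vs = length v. q vs * \<tau> (w @ (i, j) # (i, k) # zip vs v))"
      by simp
  qed
  also have "\<dots> = (\<Sum>vs | length vs = length v.
      q vs * (\<Sum>i\<in>UNIV. \<tau> (w @ (i, j) # (i, k) # zip vs v)))"
    by (subst sum.swap) (simp only: sum_distrib_left)
  also have "\<dots> = (if j = k then \<Sum>vs | length vs = length v. q vs * \<tau> (w @ zip vs v) else 0)"
    by (simp add: orthogonal)
  also have "(\<Sum>i\<in>UNIV. \<Sum>l\<in>UNIV. \<Sum>vs | length vs = length v.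
       (if \<epsilon> i l = 1 then P (\<lambda>us. q (l # us)) (remove_letter \<epsilon> i vs) else 0) *
         \<tau> (w @ (i, j) # (l, k) # zip vs v)) =
     (if \<epsilon> j k = 1 then \<Sum>l\<in>UNIV. \<Sum>i\<in>UNIV. \<Sum>vs | length vs = length v.
        P (\<lambda>us. q (l # us)) (remove_letter \<epsilon> i vs) * \<tau> ((w @ [(l, k)]) @ (i, j) # zip vs v) else 0)"
  proof (cases "\<epsilon> j k = 1")
    case True
    have "(if \<epsilon> i l = 1 then p else 0) * \<tau> (w @ (i, j) # (l, k) # s) =
        p * \<tau> ((w @ [(l, k)]) @ (i, j) # s)" for i l p s
    proof (cases "\<epsilon> i l = 1")
      case False
      then have "\<tau> (w @ (l, k) # (i, j) # s) = 0"
        using True eps_sym[of i l] eps_sym[of j k] by (intro mixed_zero) auto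
      then show ?thesis
        using False by simp
    qed (use True swap[of i l j k w s] in simp)
    then show ?thesis
      using True by (simp only: simp_thms if_True) (rule sum.swap)
  next
    case False
    then have "(if \<epsilon> i l = 1 then p else 0) * \<tau> (w @ (i, j) # (l, k) # s) = 0" for i l p s
      using mixed_zero[of i l j k w s] by simp
    then show ?thesis
      using False by (simp only: sum.neutral_const if_False)
  qed
  also have "(\<Sum>l\<in>UNIV. \<Sum>i\<in>UNIV. \<Sum>vs | length vs = length v.
        P (\<lambda>us. q (l # us)) (remove_letter \<epsilon> i vs) * \<tau> ((w @ [(l, k)]) @ (i, j) # zip vs v)) =
      (\<Sum>l\<in>UNIV. case remove_letter \<epsilon> j v of None \<Rightarrow> 0
      | Some u \<Rightarrow> \<Sum>us | length us = length u. q (l # us) * \<tau> ((w @ [(l, k)]) @ zip us u))"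
    unfolding P_def by (simp only: Cons.IH)
  also have "\<dots> = (case remove_letter \<epsilon> j v of None \<Rightarrow> 0
      | Some u \<Rightarrow> \<Sum>us | length us = length (k # u). q us * \<tau> (w @ zip us (k # u)))"
    by (cases "remove_letter \<epsilon> j v") (simp_all add: sum_lists_Suc)
  finally show ?case
    using eps_diag[of j] by (cases "remove_letter \<epsilon> j v") (auto simp: P_def)
qed

end

text \<open>The column condition carries the factor \<open>c\<close> so that it holds both for a
  centred distribution, where \<open>c\<close> is zero, and for a matrix with column sums
  one.\<close>

lemma semicircular_invariance:
  fixes \<epsilon> :: "'n::finite \<Rightarrow> 'n \<Rightarrow> nat"
  assumes "semicircular_family \<epsilon> \<phi> x c d" "orthogonal_word_functional \<epsilon> \<tau>"
    and column: "\<And>w w' j. c * (\<Sum>i\<in>UNIV. \<tau> (w @ (i, j) # w')) = c * \<tau> (w @ w')"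
  shows "(\<Sum>is | length is = length js. \<phi> (prod_list (map x is)) * \<tau> (zip is js)) =
    \<phi> (prod_list (map x js)) * \<tau> []"
proof -
  interpret semicircular_family \<epsilon> \<phi> x c d by fact
  interpret orthogonal_word_functional \<epsilon> \<tau> by fact
  \<comment> \<open>The induction needs \<open>u\<close> to act on an additional Fock space word
    \<open>v\<close>. The last variable moves from \<open>js\<close> into \<open>v\<close> by
    \<open>wick_moment_snoc\<close>, and each of its three terms is intertwined separately;
    invariance is the case of empty \<open>v\<close>.\<close>
  have "(\<Sum>is | length is = length js. \<Sum>vs | length vs = length v.
      wick_moment is vs * \<tau> (zip is js @ zip vs v)) = wick_moment js v * \<tau> []" for v
  proof (induction js arbitrary: v rule: rev_induct)
    case Nil
    have "(\<Sum>vs | length vs = length v. wick_moment [] vs * \<tau> (zip vs v)) =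
      (\<Sum>vs | length vs = length v. if (vs :: 'n list) = [] then \<tau> [] else 0)"
      by (intro sum.cong) (auto simp: wick_moment_def phi_wick)
    also have "\<dots> = wick_moment [] v * \<tau> []"
      by (cases v) (auto simp: wick_moment_def phi_wick phi_one length_Suc_conv intro!: sum.neutral)
    finally show ?case
      by simp
  next
    case (snoc j js)
    let ?R = "\<lambda>w u. case u of None \<Rightarrow> 0 | Some u \<Rightarrow> wick_moment w u"
    have "(\<Sum>is | length is = length (js @ [j]). \<Sum>vs | length vs = length v.
      wick_moment is vs * \<tau> (zip is (js @ [j]) @ zip vs v)) =
      (\<Sum>is | length is = length js. \<Sum>i\<in>UNIV. \<Sum>vs | length vs = length v.
        wick_moment (is @ [i]) vs * \<tau> (zip (is @ [i]) (js @ [j]) @ zip vs v))"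
      by (simp add: sum_lists_snoc)
    also have "\<dots> = (\<Sum>is | length is = length js. \<Sum>i\<in>UNIV. \<Sum>vs | length vs = length v.
        wick_moment (is @ [i]) vs * \<tau> (zip is js @ (i, j) # zip vs v))"
      by (intro sum.cong refl) simp
    also have "\<dots> =
      (\<Sum>is | length is = length js. \<Sum>i\<in>UNIV. \<Sum>vs | length vs = length v.
        wick_moment is (i # vs) * \<tau> (zip is js @ (i, j) # zip vs v)) +
      (\<Sum>is | length is = length js. \<Sum>i\<in>UNIV. \<Sum>vs | length vs = length v.
        c * wick_moment is vs * \<tau> (zip is js @ (i, j) # zip vs v)) +
      (\<Sum>is | length is = length js. \<Sum>i\<in>UNIV. \<Sum>vs | length vs = length v.
        d * ?R is (remove_letter \<epsilon> i vs) * \<tau> (zip is js @ (i, j) # zip vs v))"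
      by (simp only: wick_moment_snoc distrib_right sum.distrib)
    also have "(\<Sum>is | length is = length js. \<Sum>i\<in>UNIV. \<Sum>vs | length vs = length v.
        wick_moment is (i # vs) * \<tau> (zip is js @ (i, j) # zip vs v)) =
      (\<Sum>is | length is = length js. \<Sum>vs | length vs = length (j # v).
        wick_moment is vs * \<tau> (zip is js @ zip vs (j # v)))"
      by (simp add: sum_lists_Suc)
    also have "\<dots> = wick_moment js (j # v) * \<tau> []"
      by (rule snoc.IH)
    also have "(\<Sum>is | length is = length js. \<Sum>i\<in>UNIV. \<Sum>vs | length vs = length v.
        c * wick_moment is vs * \<tau> (zip is js @ (i, j) # zip vs v)) =
      (\<Sum>is | length is = length js. \<Sum>vs | length vs = length v.
        wick_moment is vs * (c * (\<Sum>i\<in>UNIV. \<tau> (zip is js @ (i, j) # zip vs v))))"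
      by (subst sum.swap) (simp add: sum_distrib_left mult_ac)
    also have "\<dots> = c * (wick_moment js v * \<tau> [])"
      unfolding column snoc.IH[symmetric] by (simp add: sum_distrib_left mult_ac)
    also have "(\<Sum>is | length is = length js. \<Sum>i\<in>UNIV. \<Sum>vs | length vs = length v.
        d * ?R is (remove_letter \<epsilon> i vs) * \<tau> (zip is js @ (i, j) # zip vs v)) =
      d * (\<Sum>is | length is = length js. \<Sum>i\<in>UNIV. \<Sum>vs | length vs = length v.
        ?R is (remove_letter \<epsilon> i vs) * \<tau> (zip is js @ (i, j) # zip vs v))"
      by (simp add: sum_distrib_left mult_ac)
    also have "\<dots> = d * (?R js (remove_letter \<epsilon> j v) * \<tau> [])"
      unfolding sum_remove_letter using snoc.IH
      by (cases "remove_letter \<epsilon> j v") simp_all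
    finally show ?case
      unfolding wick_moment_snoc by (simp add: algebra_simps)
  qed
  from this[of "[]"] show ?thesis
    by (simp add: wick_moment_def)
qed

section \<open>Moments of shifted semicircular variables\<close>

text \<open>\<open>NC m\<close> is the case of the set \<open>{1..m}\<close>. General sets of
  positions are needed for the intervals that remain when the block of \<open>1\<close> is
  removed.\<close>

definition noncrossing_partitions :: "nat set \<Rightarrow> nat set set set" where
  "noncrossing_partitions I = {P. partition_on I P \<and> noncrossing P}"

definition noncrossing_sum :: "(nat \<Rightarrow> complex) \<Rightarrow> nat set \<Rightarrow> complex" where
  "noncrossing_sum \<kappa> I = (\<Sum>P\<in>noncrossing_partitions I. \<Prod>V\<in>P. \<kappa> (card V))"

lemma finite_noncrossing_partitions: "finite I \<Longrightarrow> finite (noncrossing_partitions I)"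
  by (rule finite_subset[of _ "Pow (Pow I)"]) (auto simp: noncrossing_partitions_def partition_on_def)

lemma noncrossing_sum_empty [simp]: "noncrossing_sum \<kappa> {} = 1"
proof -
  have "noncrossing_partitions {} = {{}}"
    by (auto simp: noncrossing_partitions_def noncrossing_def partition_on_empty)
  then show ?thesis
    by (simp add: noncrossing_sum_def)
qed

lemma noncrossingD:
  "\<lbrakk>noncrossing P; V \<in> P; W \<in> P; p1 \<in> V; q1 \<in> W; p2 \<in> V; q2 \<in> W; p1 < q1; q1 < p2; p2 < q2\<rbrakk> \<Longrightarrow> V = W"
  unfolding noncrossing_def by blast

text \<open>A crossing of image blocks pulls back to a crossing. It suffices that \<open>f\<close>
  reflects the order on the points of \<open>P\<close>, so truncated subtraction is allowed.\<close>

lemma noncrossing_image: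
  assumes "noncrossing P" "\<And>x y. \<lbrakk>x \<in> \<Union>P; y \<in> \<Union>P; f x < f y\<rbrakk> \<Longrightarrow> x < y"
  shows "noncrossing ((`) f ` P)"
  unfolding noncrossing_def
proof (intro ballI impI)
  fix V W p1 q1 p2 q2
  assume "V \<in> (`) f ` P" "W \<in> (`) f ` P" and mem: "p1 \<in> V" "q1 \<in> W" "p2 \<in> V" "q2 \<in> W"
    and less: "p1 < q1 \<and> q1 < p2 \<and> p2 < q2"
  then obtain V' W' where VW: "V' \<in> P" "V = f ` V'" "W' \<in> P" "W = f ` W'"
    by blast
  then obtain a1 b1 a2 b2 where "a1 \<in> V'" "b1 \<in> W'" "a2 \<in> V'" "b2 \<in> W'"
    "p1 = f a1" "q1 = f b1" "p2 = f a2" "q2 = f b2"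
    using mem by blast
  moreover from this have "a1 < b1" "b1 < a2" "a2 < b2"
    using assms(2) VW less by auto
  ultimately have "V' = W'"
    using noncrossingD[OF assms(1) VW(1,3)] by simp
  then show "V = W"
    using VW by simp
qed

lemma partition_on_image:
  assumes "partition_on I P" "inj_on f I"
  shows "partition_on (f ` I) ((`) f ` P)"
proof -
  have "{} \<notin> (`) f ` P"
    using assms(1) by (auto simp: partition_on_def)
  then show ?thesis
    using partition_on_inj_image[OF assms] by simp
qed

lemma partition_on_Un:
  assumes "partition_on I P" "partition_on J Q" "I \<inter> J = {}"
  shows "partition_on (I \<union> J) (P \<union> Q)"
proof (rule partition_onI)
  have sub: "\<And>V. V \<in> P \<Longrightarrow> V \<subseteq> I" "\<And>V. V \<in> Q \<Longrightarrow> V \<subseteq> J"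
    using assms(1,2) by (auto simp: partition_on_def)
  fix V W assume VW: "V \<in> P \<union> Q" "W \<in> P \<union> Q" "V \<noteq> W"
  show "disjnt V W"
  proof (cases "(V \<in> P \<and> W \<in> P) \<or> (V \<in> Q \<and> W \<in> Q)")
    case True
    then show ?thesis
      using VW(3) disjointD[OF partition_onD2[OF assms(1)]] disjointD[OF partition_onD2[OF assms(2)]]
      unfolding disjnt_def by blast
  next
    case False
    then have "(V \<subseteq> I \<and> W \<subseteq> J) \<or> (V \<subseteq> J \<and> W \<subseteq> I)"
      using VW sub by auto
    then show ?thesis
      using assms(3) by (auto simp: disjnt_def)
  qed
qed (use assms in \<open>auto simp: partition_on_def\<close>)

lemma noncrossing_sum_shift: "noncrossing_sum \<kappa> ((+) a ` I) = noncrossing_sum \<kappa> I"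
  unfolding noncrossing_sum_def
proof (rule sum.reindex_bij_witness[of _ "\<lambda>P. (`) ((+) a) ` P" "\<lambda>P. (`) (\<lambda>k. k - a) ` P"])
  fix P assume P: "P \<in> noncrossing_partitions ((+) a ` I)"
  then have part: "partition_on ((+) a ` I) P" "noncrossing P"
    by (auto simp: noncrossing_partitions_def)
  then have ge: "a \<le> k" if "k \<in> \<Union>P" for k
    using that by (auto simp: partition_on_def)
  have "(+) a ` (\<lambda>k. k - a) ` V = V" if "V \<in> P" for V
    using ge that by (force simp: image_image)
  then show "(`) ((+) a) ` (`) (\<lambda>k. k - a) ` P = P"
    by (force simp: image_image)
  have "partition_on ((\<lambda>k. k - a) ` (+) a ` I) ((`) (\<lambda>k. k - a) ` P)"
    by (rule partition_on_image[OF part(1)]) (auto simp: inj_on_def)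
  moreover have "noncrossing ((`) (\<lambda>k. k - a) ` P)"
    by (rule noncrossing_image[OF part(2)]) (use ge in auto)
  ultimately show "(`) (\<lambda>k. k - a) ` P \<in> noncrossing_partitions I"
    by (simp add: noncrossing_partitions_def image_image)
  have "inj_on (\<lambda>k. k - a) {a..}"
    by (auto simp: inj_on_def)
  then have "inj_on (\<lambda>k. k - a) V" if "V \<in> P" for V
    by (rule inj_on_subset) (use ge that in auto)
  moreover have "inj_on ((`) (\<lambda>k. k - a)) P"
    using \<open>\<And>V. V \<in> P \<Longrightarrow> (+) a ` (\<lambda>k. k - a) ` V = V\<close> by (metis inj_onI)
  ultimately show "(\<Prod>V\<in>(`) (\<lambda>k. k - a) ` P. \<kappa> (card V)) = (\<Prod>V\<in>P. \<kappa> (card V))"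
    by (simp add: prod.reindex card_image)
next
  fix P assume "P \<in> noncrossing_partitions I"
  then have part: "partition_on I P" "noncrossing P"
    by (auto simp: noncrossing_partitions_def)
  show "(`) (\<lambda>k. k - a) ` (`) ((+) a) ` P = P"
    by (simp add: image_image)
  have "partition_on ((+) a ` I) ((`) ((+) a) ` P)"
    by (rule partition_on_image[OF part(1)]) auto
  moreover have "noncrossing ((`) ((+) a) ` P)"
    by (rule noncrossing_image[OF part(2)]) auto
  ultimately show "(`) ((+) a) ` P \<in> noncrossing_partitions ((+) a ` I)"
    by (simp add: noncrossing_partitions_def)
qed

lemma noncrossing_sum_interval: "noncrossing_sum \<kappa> {a + 1..a + m} = noncrossing_sum \<kappa> {1..m}"
proof -
  have "{a + 1..a + m} = (+) a ` {1..m}"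
    by simp
  then show ?thesis
    by (simp only: noncrossing_sum_shift)
qed

text \<open>A block with a point between \<open>1\<close> and \<open>b\<close> and a point beyond
  \<open>b\<close> would cross \<open>{1, b}\<close>.\<close>

lemma block_inside_or_outside:
  assumes P: "partition_on {1..Suc m} P" "noncrossing P" "{1, b} \<in> P" and W: "W \<in> P" "W \<noteq> {1, b}"
  shows "W \<subseteq> {2..b - 1} \<or> W \<subseteq> {b + 1..Suc m}"
proof (rule ccontr)
  assume "\<not> ?thesis"
  then obtain q1 q2 where q: "q1 \<in> W" "q1 \<notin> {2..b - 1}" "q2 \<in> W" "q2 \<notin> {b + 1..Suc m}"
    by blast
  have "W \<inter> {1, b} = {}"
    using P(1,3) W by (auto simp: partition_on_def disjoint_def)
  then have notin: "1 \<notin> W" "b \<notin> W"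
    by auto
  have sub: "k \<in> {1..Suc m}" if "k \<in> W" for k
    using P(1) W(1) that by (auto simp: partition_on_def)
  have "q1 \<noteq> 1" "q1 \<noteq> b" "q2 \<noteq> 1" "q2 \<noteq> b"
    using notin q(1,3) by metis+
  then have less: "1 < q2" "q2 < b" "b < q1"
    using sub[OF q(1)] sub[OF q(3)] q(2,4) unfolding atLeastAtMost_iff by linarith+
  then show False
    using noncrossingD[OF P(2,3) W(1), of 1 q2 b q1] q(1,3) W(2) by simp
qed

text \<open>\<open>{1, b}\<close> is the block of \<open>1\<close>, a singleton for \<open>b = 1\<close>; the truncated \<open>b - 1\<close> makes
  \<open>{2..b - 1}\<close> empty in that case.\<close>

lemma noncrossing_partitions_block_of_one:
  assumes b: "b \<in> {1..Suc m}"
  shows "bij_betw (\<lambda>(Q, R). insert {1, b} (Q \<union> R))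
    (noncrossing_partitions {2..b - 1} \<times> noncrossing_partitions {b + 1..Suc m})
    {P \<in> noncrossing_partitions {1..Suc m}. {1, b} \<in> P}"
    (is "bij_betw ?f (?A \<times> ?B) ?C")
proof (rule bij_betwI[where g = "\<lambda>P. ({W \<in> P. W \<subseteq> {2..b - 1}}, {W \<in> P. W \<subseteq> {b + 1..Suc m}})"])
  show "?f \<in> ?A \<times> ?B \<rightarrow> ?C"
  proof (clarsimp simp only: Pi_iff mem_Sigma_iff case_prod_conv mem_Collect_eq insertI1 simp_thms)
    fix Q R assume Q: "Q \<in> ?A" and R: "R \<in> ?B"
    then have pQ: "partition_on {2..b - 1} Q" "noncrossing Q"
      and pR: "partition_on {b + 1..Suc m} R" "noncrossing R"
      by (auto simp: noncrossing_partitions_def)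
    have Qsub: "2 \<le> k \<and> k < b" if "k \<in> V" "V \<in> Q" for k V
    proof -
      have "k \<in> {2..b - 1}"
        unfolding partition_onD1[OF pQ(1)] using that by blast
      then show ?thesis
        by auto
    qed
    have Rsub: "b < k \<and> k \<le> Suc m" if "k \<in> V" "V \<in> R" for k V
    proof -
      have "k \<in> {b + 1..Suc m}"
        unfolding partition_onD1[OF pR(1)] using that by blast
      then show ?thesis
        by auto
    qed
    have "partition_on ({2..b - 1} \<union> {b + 1..Suc m}) (Q \<union> R)"
      using pQ(1) pR(1) by (intro partition_on_Un) auto
    then have "partition_on (({2..b - 1} \<union> {b + 1..Suc m}) \<union> {1, b}) (insert {1, b} (Q \<union> R))"
      using partition_on_Un[OF _ partition_on_space[of "{1, b}"]] b by fastforce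
    moreover have "({2..b - 1} \<union> {b + 1..Suc m}) \<union> {1, b} = {1..Suc m}"
      using b by auto
    moreover have "noncrossing (insert {1, b} (Q \<union> R))"
      unfolding noncrossing_def
    proof (intro ballI impI)
      fix V W p1 q1 p2 q2
      assume VW: "V \<in> insert {1, b} (Q \<union> R)" "W \<in> insert {1, b} (Q \<union> R)"
        and mem: "p1 \<in> V" "q1 \<in> W" "p2 \<in> V" "q2 \<in> W"
        and less: "p1 < q1 \<and> q1 < p2 \<and> p2 < q2"
      show "V = W"
        using VW(1)
      proof (elim insertE UnE)
        assume V: "V = {1, b}"
        then have "p1 = 1" "p2 = b"
          using mem less b by auto
        then have "W \<notin> Q" "W \<notin> R"
          using Qsub[OF mem(4)] Rsub[OF mem(2)] less by auto
        then show ?thesis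
          using V VW(2) by simp
      next
        assume V: "V \<in> Q"
        have "W \<noteq> {1, b}" "W \<notin> R"
          using Qsub[OF mem(1) V] Qsub[OF mem(3) V] Rsub[OF mem(2)] mem(2) less by auto
        then show ?thesis
          using VW(2) V noncrossingD[OF pQ(2) V _ mem] less by simp
      next
        assume V: "V \<in> R"
        have "W \<noteq> {1, b}" "W \<notin> Q"
          using Rsub[OF mem(1) V] Qsub[OF mem(2)] mem(2) less b by auto
        then show ?thesis
          using VW(2) V noncrossingD[OF pR(2) V _ mem] less by simp
      qed
    qed
    ultimately show "insert {1, b} (Q \<union> R) \<in> noncrossing_partitions {1..Suc m}"
      by (simp add: noncrossing_partitions_def)
  qed
next
  show "(\<lambda>P. ({W \<in> P. W \<subseteq> {2..b - 1}}, {W \<in> P. W \<subseteq> {b + 1..Suc m}})) \<in> ?C \<rightarrow> ?A \<times> ?B"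
  proof
    fix P assume "P \<in> ?C"
    then have P: "partition_on {1..Suc m} P" "noncrossing P" "{1, b} \<in> P"
      by (auto simp: noncrossing_partitions_def)
    have part: "partition_on J {W \<in> P. W \<subseteq> J}" if J: "J \<subseteq> {1..Suc m} - {1, b}"
      "\<And>W. W \<in> P \<Longrightarrow> W \<noteq> {1, b} \<Longrightarrow> W \<inter> J \<noteq> {} \<Longrightarrow> W \<subseteq> J" for J
    proof (rule partition_onI)
      show "\<Union> {W \<in> P. W \<subseteq> J} = J"
      proof (intro equalityI subsetI)
        fix k assume k: "k \<in> J"
        then have "k \<in> \<Union>P"
          using J(1) P(1) by (auto simp: partition_on_def)
        then obtain W where "W \<in> P" "k \<in> W"
          by blast
        moreover from this have "W \<noteq> {1, b}"
          using J(1) k by blast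
        ultimately show "k \<in> \<Union> {W \<in> P. W \<subseteq> J}"
          using J(2)[of W] k by blast
      qed auto
    qed (use P(1) in \<open>auto simp: partition_on_def disjoint_def disjnt_def\<close>)
    have nc: "noncrossing {W \<in> P. W \<subseteq> J}" for J
      using P(2) unfolding noncrossing_def by blast
    have "{2..b - 1} \<inter> {b + 1..Suc m} = {}"
      by auto
    then have "partition_on {2..b - 1} {W \<in> P. W \<subseteq> {2..b - 1}}"
      "partition_on {b + 1..Suc m} {W \<in> P. W \<subseteq> {b + 1..Suc m}}"
      using block_inside_or_outside[OF P] b by (intro part; fastforce)+
    then show "({W \<in> P. W \<subseteq> {2..b - 1}}, {W \<in> P. W \<subseteq> {b + 1..Suc m}}) \<in> ?A \<times> ?B"
      using nc by (simp add: noncrossing_partitions_def)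
  qed
next
  fix QR assume "QR \<in> ?A \<times> ?B"
  then obtain Q R where QR: "QR = (Q, R)" and Q: "Q \<in> ?A" and R: "R \<in> ?B"
    by blast
  have Q': "V \<noteq> {}" "V \<subseteq> {2..b - 1}" if "V \<in> Q" for V
    using Q that by (auto simp: noncrossing_partitions_def partition_on_def)
  have R': "V \<noteq> {}" "V \<subseteq> {b + 1..Suc m}" if "V \<in> R" for V
    using R that by (auto simp: noncrossing_partitions_def partition_on_def)
  have "{2..b - 1} \<inter> {b + 1..Suc m} = {}" "1 \<notin> {2..b - 1}" "1 \<notin> {b + 1..Suc m}"
    using b by auto
  then have "{W \<in> insert {1, b} (Q \<union> R). W \<subseteq> {2..b - 1}} = Q"
    "{W \<in> insert {1, b} (Q \<union> R). W \<subseteq> {b + 1..Suc m}} = R"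
    using Q' R' by blast+
  then show "({W \<in> ?f QR. W \<subseteq> {2..b - 1}}, {W \<in> ?f QR. W \<subseteq> {b + 1..Suc m}}) = QR"
    by (simp add: QR)
next
  fix P assume "P \<in> ?C"
  then have P: "partition_on {1..Suc m} P" "noncrossing P" "{1, b} \<in> P"
    by (auto simp: noncrossing_partitions_def)
  then show "?f ({W \<in> P. W \<subseteq> {2..b - 1}}, {W \<in> P. W \<subseteq> {b + 1..Suc m}}) = P"
    using block_inside_or_outside[OF P] by auto
qed

text \<open>Partitions are sorted by the block of \<open>1\<close>. If it is not of the form
  \<open>{1, b}\<close>, it has at least three elements and the weight is zero; otherwise the
  remaining blocks form independent partitions of the two intervals on either side of
  \<open>b\<close>.\<close>

lemma noncrossing_sum_Suc:
  assumes small: "\<And>k. k \<ge> 3 \<Longrightarrow> \<kappa> k = 0"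
  shows "noncrossing_sum \<kappa> {1..Suc m} = (\<Sum>b\<in>{1..Suc m}.
    \<kappa> (card {1, b}) * noncrossing_sum \<kappa> {2..b - 1} * noncrossing_sum \<kappa> {b + 1..Suc m})"
proof -
  let ?w = "\<lambda>P. \<Prod>V\<in>P. \<kappa> (card V)"
  let ?C = "\<lambda>b. {P \<in> noncrossing_partitions {1..Suc m}. {1, b} \<in> P}"
  have fin: "finite (noncrossing_partitions {1..Suc m})"
    by (simp add: finite_noncrossing_partitions)
  have "noncrossing_sum \<kappa> {1..Suc m} = sum ?w (\<Union>b\<in>{1..Suc m}. ?C b)"
    unfolding noncrossing_sum_def
  proof (intro sum.mono_neutral_right fin ballI)
    fix P assume P: "P \<in> noncrossing_partitions {1..Suc m} - (\<Union>b\<in>{1..Suc m}. ?C b)"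
    then have part: "partition_on {1..Suc m} P"
      by (auto simp: noncrossing_partitions_def)
    have "1 \<in> \<Union>P"
      unfolding partition_onD1[OF part, symmetric] by simp
    then obtain V where V: "V \<in> P" "1 \<in> V"
      by blast
    have sub: "V \<subseteq> {1..Suc m}"
      using part V by (auto simp: partition_on_def)
    then have finV: "finite V"
      using finite_subset by blast
    have "card V \<ge> 3"
    proof (rule ccontr)
      assume "\<not> card V \<ge> 3"
      then have "card (V - {1}) \<le> Suc 0"
        using card.remove[OF finV V(2)] by simp
      then have "\<forall>k\<in>V - {1}. \<forall>l\<in>V - {1}. k = l"
        using finV by (simp add: card_le_Suc0_iff_eq)
      then obtain b where "b \<in> V" "V = {1, b}"
        using V(2) by (cases "V - {1} = {}") blast+
      then show False
        using P V sub by blast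
    qed
    moreover have "finite P"
      using part by (rule finite_elements[rotated]) simp
    ultimately show "?w P = 0"
      using small V by (intro prod_zero) auto
  qed blast
  also have "\<dots> = (\<Sum>b\<in>{1..Suc m}. sum ?w (?C b))"
  proof (rule sum.UNION_disjoint)
    show "\<forall>b\<in>{1..Suc m}. \<forall>b'\<in>{1..Suc m}. b \<noteq> b' \<longrightarrow> ?C b \<inter> ?C b' = {}"
    proof (intro ballI impI, rule ccontr)
      fix b b' :: nat assume "b \<noteq> b'" "?C b \<inter> ?C b' \<noteq> {}"
      then obtain P where "partition_on {1..Suc m} P" "{1, b} \<in> P" "{1, b'} \<in> P"
        by (auto simp: noncrossing_partitions_def)
      then have "{1, b} = {1, b'}"
        using disjointD[OF partition_onD2, of "{1..Suc m}" P "{1, b}" "{1, b'}"] by auto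
      then show False
        using \<open>b \<noteq> b'\<close> unfolding doubleton_eq_iff by blast
    qed
  qed (auto intro: finite_subset[OF _ fin])
  also have "\<dots> = (\<Sum>b\<in>{1..Suc m}.
    \<kappa> (card {1, b}) * noncrossing_sum \<kappa> {2..b - 1} * noncrossing_sum \<kappa> {b + 1..Suc m})"
  proof (rule sum.cong[OF refl])
    fix b assume b: "b \<in> {1..Suc m}"
    let ?A = "noncrossing_partitions {2..b - 1}" and ?B = "noncrossing_partitions {b + 1..Suc m}"
    have "sum ?w (?C b) = (\<Sum>(Q, R)\<in>?A \<times> ?B. ?w (insert {1, b} (Q \<union> R)))"
      using sum.reindex_bij_betw[OF noncrossing_partitions_block_of_one[OF b], of ?w]
      by (simp add: case_prod_beta)
    also have "\<dots> = (\<Sum>(Q, R)\<in>?A \<times> ?B. \<kappa> (card {1, b}) * (?w Q * ?w R))"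
    proof (rule sum.cong[OF refl], clarify)
      fix Q R assume Q: "Q \<in> ?A" and R: "R \<in> ?B"
      then have pQ: "partition_on {2..b - 1} Q" and pR: "partition_on {b + 1..Suc m} R"
        by (auto simp: noncrossing_partitions_def)
      have fin: "finite Q" "finite R"
        using pQ pR by (auto intro: finite_elements[rotated])
      have "V \<noteq> {}" "V \<subseteq> {2..b - 1}" if "V \<in> Q" for V
        using pQ that by (auto simp: partition_on_def)
      moreover have "V \<noteq> {}" "V \<subseteq> {b + 1..Suc m}" if "V \<in> R" for V
        using pR that by (auto simp: partition_on_def)
      moreover have "{2..b - 1} \<inter> {b + 1..Suc m} = {}" "1 \<notin> {2..b - 1}" "1 \<notin> {b + 1..Suc m}"
        using b by auto
      ultimately have "{1, b} \<notin> Q \<union> R" "Q \<inter> R = {}"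
        by blast+
      then show "?w (insert {1, b} (Q \<union> R)) = \<kappa> (card {1, b}) * (?w Q * ?w R)"
        using fin by (simp add: prod.union_disjoint)
    qed
    also have "\<dots> = \<kappa> (card {1, b}) * (sum ?w ?A * sum ?w ?B)"
      by (simp add: sum.cartesian_product[symmetric] sum_distrib_left[symmetric] sum_product)
    finally show "sum ?w (?C b) =
        \<kappa> (card {1, b}) * noncrossing_sum \<kappa> {2..b - 1} * noncrossing_sum \<kappa> {b + 1..Suc m}"
      by (simp add: noncrossing_sum_def mult.assoc)
  qed
  finally show ?thesis .
qed

section \<open>Moments and free cumulants of one variable\<close>

context unital_functional
begin

lemma moment_eq_noncrossing_sum: "\<phi> (a ^ m) = noncrossing_sum (free_cumulant \<phi> a) {1..m}"
proof (cases "m = 0")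
  case False
  then show ?thesis
    using moment_cumulant[of m \<phi> a] by (simp add: noncrossing_sum_def noncrossing_partitions_def NC_def)
qed (simp add: phi_one)

text \<open>A partition of a set of odd size has a block of odd size, so every summand contains a
  vanishing cumulant.\<close>

lemma odd_moment_zero:
  assumes "\<And>k. odd k \<Longrightarrow> free_cumulant \<phi> a k = 0" "odd m"
  shows "\<phi> (a ^ m) = 0"
proof -
  have "(\<Prod>V\<in>P. free_cumulant \<phi> a (card V)) = 0" if P: "P \<in> noncrossing_partitions {1..m}" for P
  proof -
    have part: "partition_on {1..m} P"
      using P by (auto simp: noncrossing_partitions_def)
    have fin: "finite P"
      by (rule finite_elements[OF _ part]) simp
    have "m = card (\<Union>P)"
      using part by (simp add: partition_on_def)
    also have "\<dots> = (\<Sum>V\<in>P. card V)"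
    proof (rule card_Union_disjoint)
      show "pairwise disjnt P"
        by (rule partition_onD2[OF part])
      show "finite V" if "V \<in> P" for V
        by (rule finite_subset[of _ "{1..m}"]) (use part that in \<open>auto simp: partition_on_def\<close>)
    qed
    finally have "\<exists>V\<in>P. odd (card V)"
      using assms(2) dvd_sum[of P 2 card] by auto
    then show ?thesis
      using fin assms(1) by (auto intro: prod_zero)
  qed
  then show ?thesis
    by (simp add: moment_eq_noncrossing_sum noncrossing_sum_def)
qed

text \<open>In the recursion by the block of \<open>1\<close>, the partner is
  \<open>b = k + 2\<close>, with \<open>k\<close> points between \<open>1\<close> and
  \<open>b\<close> and \<open>m - 1 - k\<close> points after \<open>b\<close>; the singleton gives
  the term with the mean.\<close>

lemma semicircular_moment_Suc:
  assumes "\<And>k. k \<ge> 3 \<Longrightarrow> free_cumulant \<phi> a k = 0"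
  shows "\<phi> (a ^ Suc m) = free_cumulant \<phi> a 1 * \<phi> (a ^ m) +
    free_cumulant \<phi> a 2 * (\<Sum>k<m. \<phi> (a ^ k) * \<phi> (a ^ (m - 1 - k)))"
proof -
  let ?\<kappa> = "free_cumulant \<phi> a"
  have "\<phi> (a ^ Suc m) = (\<Sum>b\<in>{1..Suc m}.
    ?\<kappa> (card {1, b}) * noncrossing_sum ?\<kappa> {2..b - 1} * noncrossing_sum ?\<kappa> {b + 1..Suc m})"
    unfolding moment_eq_noncrossing_sum by (rule noncrossing_sum_Suc[OF assms])
  also have "{1..Suc m} = insert 1 ((\<lambda>k. k + 2) ` {..<m})"
  proof (intro equalityI subsetI)
    fix b assume "b \<in> {1..Suc m}"
    then show "b \<in> insert 1 ((\<lambda>k. k + 2) ` {..<m})"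
      by (cases "b = 1") (auto intro!: image_eqI[of _ _ "b - 2"])
  qed auto
  also have "(\<Sum>b\<in>\<dots>.
    ?\<kappa> (card {1, b}) * noncrossing_sum ?\<kappa> {2..b - 1} * noncrossing_sum ?\<kappa> {b + 1..Suc m}) =
    ?\<kappa> 1 * noncrossing_sum ?\<kappa> {2..Suc m} + (\<Sum>k<m.
    ?\<kappa> (card {1, k + 2}) * noncrossing_sum ?\<kappa> {2..k + 1} * noncrossing_sum ?\<kappa> {k + 3..Suc m})"
    by (subst sum.insert) (auto simp: sum.reindex inj_on_def numeral_2_eq_2 numeral_3_eq_3)
  also have "noncrossing_sum ?\<kappa> {2..Suc m} = \<phi> (a ^ m)"
    using noncrossing_sum_interval[of ?\<kappa> 1 m]
    by (simp add: moment_eq_noncrossing_sum numeral_2_eq_2)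
  also have "(\<Sum>k<m.
    ?\<kappa> (card {1, k + 2}) * noncrossing_sum ?\<kappa> {2..k + 1} * noncrossing_sum ?\<kappa> {k + 3..Suc m}) =
    (\<Sum>k<m. ?\<kappa> 2 * (\<phi> (a ^ k) * \<phi> (a ^ (m - 1 - k))))"
  proof (rule sum.cong[OF refl])
    fix k assume "k \<in> {..<m}"
    then have "Suc m = (k + 2) + (m - 1 - k)"
      by simp
    then have "noncrossing_sum ?\<kappa> {k + 3..Suc m} = \<phi> (a ^ (m - 1 - k))"
      using noncrossing_sum_interval[of ?\<kappa> "k + 2" "m - 1 - k"]
      by (simp add: moment_eq_noncrossing_sum numeral_3_eq_3)
    moreover have "noncrossing_sum ?\<kappa> {2..k + 1} = \<phi> (a ^ k)"
      using noncrossing_sum_interval[of ?\<kappa> 1 k]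
      by (simp add: moment_eq_noncrossing_sum numeral_2_eq_2)
    ultimately show "?\<kappa> (card {1, k + 2}) * noncrossing_sum ?\<kappa> {2..k + 1} *
        noncrossing_sum ?\<kappa> {k + 3..Suc m} = ?\<kappa> 2 * (\<phi> (a ^ k) * \<phi> (a ^ (m - 1 - k)))"
      by (simp add: numeral_2_eq_2)
  qed
  finally show ?thesis
    by (simp add: sum_distrib_left)
qed

text \<open>With \<open>M\<close> the generating function of the moments and \<open>F n\<close> that of
  \<open>\<phi> (a\<^sup>m U\<^sub>n(a))\<close>, the recursion reads \<open>M = 1 + c X M + d X\<^sup>2 M\<^sup>2\<close>, whence \<open>F n = d\<^sup>n X\<^sup>n M\<^sup>n\<^sup>+\<^sup>1\<close>.\<close>

lemma phi_cheb_cumulants: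
  assumes small: "\<And>k. k \<ge> 3 \<Longrightarrow> free_cumulant \<phi> a k = 0" and "n \<ge> 1"
  shows "\<phi> (cheb (free_cumulant \<phi> a 1) (free_cumulant \<phi> a 2) a n) = 0"
proof -
  define c d where "c = free_cumulant \<phi> a 1" and "d = free_cumulant \<phi> a 2"
  define F where "F n = Abs_fps (\<lambda>m. \<phi> (a ^ m * cheb c d a n))" for n
  define M where "M = F 0"
  define C D :: "complex fps" where "C = fps_const c" and "D = fps_const d"
  have M: "M = 1 + C * (fps_X * M) + D * (fps_X * (fps_X * (M * M)))"
  proof (rule fps_ext)
    fix m
    show "fps_nth M m = fps_nth (1 + C * (fps_X * M) + D * (fps_X * (fps_X * (M * M)))) m"
    proof (cases m)
      case 0
      then show ?thesis
        by (simp add: M_def F_def C_def D_def phi_one)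
    next
      case (Suc k)
      have "fps_nth M m = c * \<phi> (a ^ k) + d * (\<Sum>l<k. \<phi> (a ^ l) * \<phi> (a ^ (k - 1 - l)))"
        unfolding Suc c_def d_def
        using semicircular_moment_Suc[OF small, of k] by (simp add: M_def F_def)
      also have "(\<Sum>l<k. \<phi> (a ^ l) * \<phi> (a ^ (k - 1 - l))) = fps_nth (fps_X * (M * M)) k"
      proof (cases k)
        case (Suc l)
        have "fps_nth (fps_X * (M * M)) k = fps_nth (M * M) l"
          using Suc by simp
        then show ?thesis
          using Suc by (simp add: fps_mult_nth M_def F_def lessThan_Suc_atMost atLeast0AtMost)
      qed simp
      finally show ?thesis
        using Suc by (simp add: C_def D_def M_def F_def)
    qed
  qed
  have F1: "fps_X * F (Suc 0) = M - 1 - C * (fps_X * M)"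
  proof (rule fps_ext)
    fix m
    show "fps_nth (fps_X * F (Suc 0)) m = fps_nth (M - 1 - C * (fps_X * M)) m"
      by (cases m) (simp_all add: M_def F_def C_def phi_one right_diff_distrib cscale_mult_right
          phi_diff phi_cscale power_Suc2 del: power_Suc)
  qed
  \<comment> \<open>Multiplication by the variable shifts coefficients by one. The constant
    coefficient of \<open>F (Suc n)\<close> has no counterpart on the left and is
    subtracted.\<close>
  have F2: "fps_X * F (Suc (Suc n)) =
      F (Suc n) - fps_const (fps_nth (F (Suc n)) 0) - C * (fps_X * F (Suc n)) - D * (fps_X * F n)" for n
  proof (rule fps_ext)
    fix m
    show "fps_nth (fps_X * F (Suc (Suc n))) m =
      fps_nth (F (Suc n) - fps_const (fps_nth (F (Suc n)) 0) - C * (fps_X * F (Suc n)) - D * (fps_X * F n)) m"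
      by (cases m) (simp_all add: F_def C_def D_def right_diff_distrib left_diff_distrib
          cscale_mult_right cscale_mult_left phi_diff phi_cscale power_Suc2 mult.assoc del: power_Suc)
  qed
  \<comment> \<open>Two consecutive indices, because the recursion for \<open>cheb\<close> has three
    terms. For \<open>n \<ge> 1\<close> the power of \<open>fps_X\<close> removes the constant
    coefficient, which is \<open>\<phi>\<close> of the polynomial itself.\<close>
  have "F n = D ^ n * fps_X ^ n * M ^ Suc n \<and>
      F (Suc n) = D ^ Suc n * fps_X ^ Suc n * M ^ Suc (Suc n)" for n
  proof (induction n)
    case 0
    have "fps_X * F (Suc 0) = fps_X * (D * fps_X * M ^ 2)"
      unfolding F1 by (subst (1) M) (simp add: algebra_simps power2_eq_square)
    then show ?case
      by (simp add: M_def numeral_2_eq_2)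
  next
    case (Suc n)
    have "fps_nth (F (Suc n)) 0 = 0"
      using Suc.IH by simp
    then have "fps_X * F (Suc (Suc n)) = D ^ Suc n * fps_X ^ Suc n * M ^ Suc n *
        (M - C * (fps_X * M) - 1)"
      using Suc.IH by (simp add: F2 algebra_simps)
    also have "M - C * (fps_X * M) - 1 = D * (fps_X * (fps_X * (M * M)))"
      by (subst (1) M) simp
    finally have "fps_X * F (Suc (Suc n)) =
        fps_X * (D ^ Suc (Suc n) * fps_X ^ Suc (Suc n) * M ^ Suc (Suc (Suc n)))"
      by (simp add: algebra_simps)
    then show ?case
      using Suc.IH by simp
  qed
  then have "fps_nth (F n) 0 = 0"
    using \<open>n \<ge> 1\<close> by (simp add: fps_X_power_mult_nth mult.assoc mult.left_commute)
  then show ?thesis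
    by (simp add: F_def c_def d_def)
qed

end

section \<open>Words in centred powers\<close>

text \<open>A triple \<open>(j, k, c)\<close> stands for the factor \<open>\<Sum>i. (x\<^sub>i\<^sup>k - c) \<otimes> u\<^sub>i\<^sub>j\<^sup>k\<close>. In the cases at hand this is
  \<open>y\<^sub>j\<^sup>k - c\<close> with \<open>y\<^sub>j = \<Sum>i. x\<^sub>i \<otimes> u\<^sub>i\<^sub>j\<close>, if \<open>c\<close> is the \<open>k\<close>-th moment. The arguments \<open>a\<close> and \<open>w\<close>
  accumulate the two legs of the tensor product.\<close>

fun word_sum :: "('a::complex_star_algebra \<Rightarrow> complex) \<Rightarrow> ('n::finite \<Rightarrow> 'a) \<Rightarrow> (('n \<times> 'n) list \<Rightarrow> complex) \<Rightarrow>
    'a \<Rightarrow> ('n \<times> 'n) list \<Rightarrow> ('n \<times> nat \<times> complex) list \<Rightarrow> complex" where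
  "word_sum \<phi> x \<tau> a w [] = \<phi> a * \<tau> w"
| "word_sum \<phi> x \<tau> a w ((j, k, c) # L) =
    (\<Sum>i\<in>UNIV. word_sum \<phi> x \<tau> (a * (x i ^ k - cscale c 1)) (w @ replicate k (i, j)) L)"

text \<open>With exponents one and constants zero, \<open>word_sum\<close> is the sum in the
  invariance condition, evaluated by a functional.\<close>

lemma word_sum_letters:
  "word_sum \<phi> x \<tau> a w (map (\<lambda>j. (j, 1, 0)) js) =
    (\<Sum>is | length is = length js. \<phi> (a * prod_list (map x is)) * \<tau> (w @ zip is js))"
proof (induction js arbitrary: a w)
  case (Cons j js)
  have "word_sum \<phi> x \<tau> a w (map (\<lambda>j. (j, 1, 0)) (j # js)) =
    (\<Sum>i\<in>UNIV. \<Sum>is | length is = length js. \<phi> (a * x i * prod_list (map x is)) * \<tau> ((w @ [(i, j)]) @ zip is js))"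
    unfolding Cons.IH[symmetric] by simp
  then show ?case
    by (simp add: sum_lists_Suc mult.assoc)
qed simp

text \<open>Later factors only append letters on the right, so a linear relation between words that
  survives every continuation \<open>w'\<close> passes to \<open>word_sum\<close>.\<close>

lemma word_sum_relation:
  assumes "\<And>w'. (\<Sum>p\<in>P. s p * \<tau> (f p @ w')) = t * \<tau> (v @ w')"
  shows "(\<Sum>p\<in>P. s p * word_sum \<phi> x \<tau> a (f p) L) = t * word_sum \<phi> x \<tau> a v L"
  using assms
proof (induction L arbitrary: a f v)
  case Nil
  show ?case
    using arg_cong[OF Nil[of "[]"], of "(*) (\<phi> a)"] by (simp add: sum_distrib_left mult_ac)
next
  case (Cons e L)
  obtain j k c where e: "e = (j, k, c)"
    by (cases e)
  have "(\<Sum>p\<in>P. s p * word_sum \<phi> x \<tau> a (f p) (e # L)) =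
    (\<Sum>i\<in>UNIV. \<Sum>p\<in>P. s p * word_sum \<phi> x \<tau> (a * (x i ^ k - cscale c 1)) (f p @ replicate k (i, j)) L)"
    by (subst sum.swap) (simp add: e sum_distrib_left)
  also have "\<dots> =
    (\<Sum>i\<in>UNIV. t * word_sum \<phi> x \<tau> (a * (x i ^ k - cscale c 1)) (v @ replicate k (i, j)) L)"
    by (intro sum.cong refl Cons.IH) (simp add: Cons.prems)
  finally show ?case
    by (simp add: e sum_distrib_left)
qed

lemma word_sum_scale:
  assumes "\<And>w'. s * \<tau> (w @ w') = t * \<tau> (v @ w')"
  shows "s * word_sum \<phi> x \<tau> a w L = t * word_sum \<phi> x \<tau> a v L"
  using word_sum_relation[of "\<lambda>_. s" \<tau> "\<lambda>_. w" "{()}" t v] assms by simp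

lemma word_sum_eqI:
  assumes "\<And>w'. \<tau> (w @ w') = \<tau> (v @ w')"
  shows "word_sum \<phi> x \<tau> a w L = word_sum \<phi> x \<tau> a v L"
  using word_sum_scale[of 1 \<tau> w 1 v] assms by simp

lemma word_sum_zero:
  assumes "\<And>w'. \<tau> (w @ w') = 0"
  shows "word_sum \<phi> x \<tau> a w L = 0"
  using word_sum_scale[of 1 \<tau> w 0 w] assms by simp

text \<open>A prefix only changes the accumulated legs, so an identity valid for all of them
  persists behind any prefix. The four terms are those of a merge of two centred powers; commuting
  and centring use zero coefficients.\<close>

lemma word_sum_context:
  assumes "\<And>a w. word_sum \<phi> x \<tau> a w K = word_sum \<phi> x \<tau> a w K1 - c1 * word_sum \<phi> x \<tau> a w K2 -
      c2 * word_sum \<phi> x \<tau> a w K3 + c3 * word_sum \<phi> x \<tau> a w K4"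
  shows "word_sum \<phi> x \<tau> a w (L @ K) = word_sum \<phi> x \<tau> a w (L @ K1) -
      c1 * word_sum \<phi> x \<tau> a w (L @ K2) - c2 * word_sum \<phi> x \<tau> a w (L @ K3) +
      c3 * word_sum \<phi> x \<tau> a w (L @ K4)"
proof (induction L arbitrary: a w)
  case (Cons e L)
  obtain j k c where "e = (j, k, c)"
    by (cases e)
  then show ?case
    by (simp add: Cons.IH sum.distrib sum_subtractf sum_distrib_left)
qed (use assms in simp)

definition index_product :: "('n \<Rightarrow> 'a::complex_star_algebra) \<Rightarrow> 'n list \<Rightarrow> ('n \<times> nat \<times> complex) list \<Rightarrow> 'a" where
  "index_product x is L = prod_list (map2 (\<lambda>i (j, k, c). x i ^ k - cscale c 1) is L)"

definition index_word :: "'n list \<Rightarrow> ('n \<times> nat \<times> complex) list \<Rightarrow> ('n \<times> 'n) list" where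
  "index_word is L = concat (map2 (\<lambda>i (j, k, c). replicate k (i, j)) is L)"

lemma word_sum_termwise_zero:
  assumes "\<And>is. length is = length L \<Longrightarrow> \<phi> (a * index_product x is L) * \<tau> (w @ index_word is L) = 0"
  shows "word_sum \<phi> x \<tau> a w L = 0"
  using assms
proof (induction L arbitrary: a w)
  case Nil
  then show ?case
    by (simp add: index_product_def index_word_def)
next
  case (Cons e L)
  obtain j k c where e: "e = (j, k, c)"
    by (cases e)
  have "word_sum \<phi> x \<tau> (a * (x i ^ k - cscale c 1)) (w @ replicate k (i, j)) L = 0" for i
    using Cons.prems[of "i # _"]
    by (intro Cons.IH) (simp add: e index_product_def index_word_def mult.assoc)
  then show ?case
    by (simp add: e)
qed

text \<open>When the moment \<open>m k\<close> is nonzero, \<open>u\<^sub>i\<^sub>j\<^sup>k\<close>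
  acts as a unit on positive powers of the same entry and has column sums one. The factor
  \<open>m k\<close> makes the axioms void for vanishing moments, such as the odd ones of an even
  distribution.\<close>

locale power_word_functional = eps_word_functional \<epsilon> \<tau>
  for \<epsilon> :: "'n::finite \<Rightarrow> 'n \<Rightarrow> nat" and \<tau> +
  fixes m :: "nat \<Rightarrow> complex"
  assumes row_zero: "j \<noteq> l \<Longrightarrow> \<tau> (w @ (i, j) # (i, l) # w') = 0"
    and column_zero: "i \<noteq> i' \<Longrightarrow> \<tau> (w @ (i, j) # (i', j) # w') = 0"
    and power_shift: "\<lbrakk>k \<ge> 1; n \<ge> 1\<rbrakk> \<Longrightarrow>
      m k * \<tau> (w @ replicate (k + n) (i, j) @ w') = m k * \<tau> (w @ replicate n (i, j) @ w')"
    and power_sum: "k \<ge> 1 \<Longrightarrow>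
      m k * (\<Sum>i\<in>UNIV. \<tau> (w @ replicate k (i, j) @ w')) = m k * \<tau> (w @ w')"
begin

lemma adjacent_powers_zero:
  assumes "\<And>w w'. \<tau> (w @ p # q # w') = 0" "k \<ge> 1" "n \<ge> 1"
  shows "\<tau> (w @ replicate k p @ replicate n q @ w') = 0"
proof -
  obtain k' n' where k: "k = Suc k'" "n = Suc n'"
    using assms(2,3) by (cases k; cases n) auto
  have "w @ replicate k p @ replicate n q @ w' = (w @ replicate k' p) @ p # q # (replicate n' q @ w')"
    by (simp add: k replicate_append_same[symmetric] del: replicate_append_same)
  then show ?thesis
    by (simp only: assms(1))
qed

lemma powers_commute:
  assumes "\<epsilon> i i' = 1" "\<epsilon> j l = 1"
  shows "\<tau> (w @ replicate k (i, j) @ replicate n (i', l) @ w') =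
    \<tau> (w @ replicate n (i', l) @ replicate k (i, j) @ w')"
proof -
  have single: "\<tau> (w @ (i, j) # replicate n (i', l) @ w') = \<tau> (w @ replicate n (i', l) @ (i, j) # w')" for w w'
  proof (induction n arbitrary: w)
    case (Suc n)
    have "\<tau> (w @ (i, j) # replicate (Suc n) (i', l) @ w') =
        \<tau> ((w @ [(i', l)]) @ (i, j) # replicate n (i', l) @ w')"
      using swap[OF assms] by simp
    then show ?case
      by (simp only: Suc.IH) simp
  qed simp
  show ?thesis
  proof (induction k arbitrary: w')
    case (Suc k)
    have "\<tau> (w @ replicate (Suc k) (i, j) @ replicate n (i', l) @ w') =
      \<tau> ((w @ replicate k (i, j)) @ (i, j) # replicate n (i', l) @ w')"
      by (simp add: replicate_append_same[symmetric] del: replicate_append_same)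
    also have "\<dots> = \<tau> (w @ replicate k (i, j) @ replicate n (i', l) @ (i, j) # w')"
      unfolding single by simp
    also have "\<dots> = \<tau> (w @ replicate n (i', l) @ replicate k (i, j) @ (i, j) # w')"
      by (rule Suc.IH)
    finally show ?case
      by (simp add: replicate_append_same[symmetric] del: replicate_append_same)
  qed simp
qed

text \<open>The power of \<open>u a j\<close> is moved to the right. Past each factor, the rows
  commute: if the columns commute too, the powers are exchanged, and if not, the mixed relation
  gives zero. On arrival at the power of \<open>u a l\<close>, the columns \<open>j\<close> and
  \<open>l\<close> differ, since otherwise \<open>l\<close> could have been removed, and two
  different entries of one row multiply to zero.\<close>

lemma blocked_word_zero:
  assumes "length t = length K" "\<forall>b\<in>set t. \<epsilon> a b = 1" "\<forall>(j, k, c)\<in>set K. k \<ge> 1"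
    "remove_letter \<epsilon> j (map fst K @ l # v) = None" "k \<ge> 1" "n \<ge> 1"
  shows "\<tau> (w @ replicate k (a, j) @ index_word t K @ replicate n (a, l) @ w') = 0"
  using assms(1-4)
proof (induction t K arbitrary: w rule: list_induct2)
  case Nil
  then have "j \<noteq> l"
    by (auto split: if_splits)
  then show ?case
    using adjacent_powers_zero[OF row_zero assms(5,6)] by (simp add: index_word_def)
next
  case (Cons b t e K)
  obtain j' k' c where e: "e = (j', k', c)"
    by (cases e)
  have k': "k' \<ge> 1" and b: "\<epsilon> a b = 1"
    using Cons.prems e by auto
  have word: "index_word (b # t) (e # K) = replicate k' (b, j') @ index_word t K"
    by (simp add: index_word_def e)
  show ?case
  proof (cases "\<epsilon> j j' = 1")
    case True
    then have "remove_letter \<epsilon> j (map fst K @ l # v) = None"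
      using Cons.prems(3) e by (auto split: if_splits)
    then have "\<tau> ((w @ replicate k' (b, j')) @ replicate k (a, j) @ index_word t K @ replicate n (a, l) @ w') = 0"
      using Cons.prems by (intro Cons.IH) auto
    then show ?thesis
      using powers_commute[OF b True] by (simp add: word)
  next
    case False
    have "\<tau> (w @ replicate k (a, j) @ replicate k' (b, j') @ w'') = 0" for w''
      by (rule adjacent_powers_zero[OF mixed_zero assms(5) k']) (use b False in simp)
    then show ?thesis
      by (simp add: word)
  qed
qed

end

locale power_words = eps_independent_family \<epsilon> \<phi> x + power_word_functional \<epsilon> \<tau> m
  for \<epsilon> :: "'n::finite \<Rightarrow> 'n \<Rightarrow> nat" and \<phi> :: "'a::complex_star_algebra \<Rightarrow> complex"
    and x :: "'n \<Rightarrow> 'a" and \<tau> and m +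
  assumes moment: "\<phi> (x i ^ k) = m k"
begin

abbreviation r :: "'a \<Rightarrow> ('n \<times> 'n) list \<Rightarrow> ('n \<times> nat \<times> complex) list \<Rightarrow> complex" where
  "r \<equiv> word_sum \<phi> x \<tau>"

lemma power_diff_in_generated: "x i ^ k - cscale c 1 \<in> generated_subalgebra (x i)"
  by (intro subalgebra_diff subalgebra_power subalgebra_cscale subalgebra_one
      unital_subalgebra_generated generator_in_generated)

lemma r_add: "r (a + b) w L = r a w L + r b w L"
proof (induction L arbitrary: a b w)
  case (Cons e L)
  then show ?case
    by (cases e) (simp add: distrib_right sum.distrib)
qed (simp add: phi_add distrib_right)

lemma r_cscale: "r (cscale c a) w L = c * r a w L"
proof (induction L arbitrary: a w)
  case (Cons e L)
  then show ?case
    by (cases e) (simp add: cscale_mult_left sum_distrib_left)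
qed (simp add: phi_cscale)

lemma r_diff: "r (a - b) w L = r a w L - r b w L"
  using r_add[of "a - b" b w L] by simp

text \<open>For commuting rows both legs can be reordered; for the other rows the mixed relation
  makes the words in either order vanish.\<close>

lemma r_commute:
  assumes "\<epsilon> j l = 1" "k \<ge> 1" "n \<ge> 1"
  shows "r a w (K @ (j, k, c) # (l, n, d) # L) = r a w (K @ (l, n, d) # (j, k, c) # L)"
proof -
  let ?b = "\<lambda>i k c. x i ^ k - cscale c 1"
  have "r a w ((j, k, c) # (l, n, d) # L) = r a w ((l, n, d) # (j, k, c) # L)" for a w
  proof -
    have "r (a * ?b i k c * ?b i' n d) (w @ replicate k (i, j) @ replicate n (i', l)) L =
      r (a * ?b i' n d * ?b i k c) (w @ replicate n (i', l) @ replicate k (i, j)) L" for i i'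
    proof (cases "\<epsilon> i i' = 1")
      case True
      have "?b i k c * ?b i' n d = ?b i' n d * ?b i k c"
        by (rule generated_commute[OF True]) (rule power_diff_in_generated)+
      then have "a * ?b i k c * ?b i' n d = a * ?b i' n d * ?b i k c"
        by (simp only: mult.assoc)
      then show ?thesis
        using powers_commute[OF True assms(1)] by (auto intro!: word_sum_eqI)
    next
      case False
      have "\<tau> (w @ replicate k (i, j) @ replicate n (i', l) @ w') = 0" for w'
        by (rule adjacent_powers_zero[OF mixed_zero assms(2,3)]) (use False assms in simp)
      moreover have "\<tau> (w @ replicate n (i', l) @ replicate k (i, j) @ w') = 0" for w'
        by (rule adjacent_powers_zero[OF mixed_zero assms(3,2)])
          (use False assms eps_sym[of i i'] eps_sym[of j l] in simp)
      ultimately show ?thesis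
        by (simp add: word_sum_zero)
    qed
    then have "(\<Sum>i\<in>UNIV. \<Sum>i'\<in>UNIV.
        r (a * ?b i k c * ?b i' n d) (w @ replicate k (i, j) @ replicate n (i', l)) L) =
      (\<Sum>i\<in>UNIV. \<Sum>i'\<in>UNIV.
        r (a * ?b i' n d * ?b i k c) (w @ replicate n (i', l) @ replicate k (i, j)) L)"
      by simp
    also have "\<dots> = (\<Sum>i'\<in>UNIV. \<Sum>i\<in>UNIV.
        r (a * ?b i' n d * ?b i k c) (w @ replicate n (i', l) @ replicate k (i, j)) L)"
      by (rule sum.swap)
    finally show ?thesis
      by simp
  qed
  from word_sum_context[of \<phi> x \<tau> _ _ 0 _ 0 _ 0 _ a w K, of _ _ "[]" "[]" "[]"] this
  show ?thesis
    by simp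
qed

text \<open>Different rows in one column give zero, which leaves a product of two centred powers of
  a single variable, expanded in centred powers. The factors \<open>m k\<close> and
  \<open>m n\<close> allow the exponent \<open>k + n\<close> of the matrix entry to be lowered to
  that of the remaining variable.\<close>

lemma r_merge:
  assumes k: "k \<ge> 1" and n: "n \<ge> 1"
  shows "r a w (K @ (j, k, m k) # (j, n, m n) # L) =
    r a w (K @ (j, k + n, m (k + n)) # L) - m k * r a w (K @ (j, n, m n) # L) -
    m n * r a w (K @ (j, k, m k) # L) + (m (k + n) - m k * m n) * r a w (K @ L)"
proof (rule word_sum_context)
  fix a :: 'a and w :: "('n \<times> 'n) list"
  let ?b = "\<lambda>i k. x i ^ k - cscale (m k) 1"
  let ?s = "\<lambda>i k. w @ replicate k (i, j)"
  have "r a w ((j, k, m k) # (j, n, m n) # L) =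
    (\<Sum>i\<in>UNIV. \<Sum>i'\<in>UNIV. r (a * ?b i k * ?b i' n) (w @ replicate k (i, j) @ replicate n (i', j)) L)"
    by simp
  also have "\<dots> = (\<Sum>i\<in>UNIV. \<Sum>i'\<in>UNIV.
      if i = i' then r (a * ?b i k * ?b i n) (?s i (k + n)) L else 0)"
  proof (intro sum.cong refl)
    fix i i'
    show "r (a * ?b i k * ?b i' n) (w @ replicate k (i, j) @ replicate n (i', j)) L =
      (if i = i' then r (a * ?b i k * ?b i n) (?s i (k + n)) L else 0)"
    proof (cases "i = i'")
      case False
      then have "\<tau> (w @ replicate k (i, j) @ replicate n (i', j) @ w') = 0" for w'
        by (intro adjacent_powers_zero[OF _ k n] column_zero)
      then show ?thesis
        using False by (simp add: word_sum_zero)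
    qed (simp add: replicate_add)
  qed
  also have "\<dots> = (\<Sum>i\<in>UNIV. r (a * ?b i k * ?b i n) (?s i (k + n)) L)"
    by simp
  also have "\<dots> = (\<Sum>i\<in>UNIV. r (a * ?b i (k + n)) (?s i (k + n)) L - m k * r (a * ?b i n) (?s i (k + n)) L -
      m n * r (a * ?b i k) (?s i (k + n)) L + (m (k + n) - m k * m n) * r a (?s i (k + n)) L)"
  proof (rule sum.cong[OF refl])
    fix i
    have "a * ?b i k * ?b i n = a * ?b i (k + n) - cscale (m k) (a * ?b i n) - cscale (m n) (a * ?b i k) +
        cscale (m (k + n) - m k * m n) a"
      by (simp add: right_diff_distrib left_diff_distrib cscale_mult_left cscale_mult_right
          cscale_diff_right cscale_cscale power_add mult.assoc cscale_add_left[of _ "- _", simplified]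
          cscale_minus_left mult.commute[of "m n"])
    then show "r (a * ?b i k * ?b i n) (?s i (k + n)) L =
      r (a * ?b i (k + n)) (?s i (k + n)) L - m k * r (a * ?b i n) (?s i (k + n)) L -
      m n * r (a * ?b i k) (?s i (k + n)) L + (m (k + n) - m k * m n) * r a (?s i (k + n)) L"
      by (simp only: r_add r_diff r_cscale)
  qed
  also have "\<dots> = (\<Sum>i\<in>UNIV. r (a * ?b i (k + n)) (?s i (k + n)) L) -
      (\<Sum>i\<in>UNIV. m k * r (a * ?b i n) (?s i (k + n)) L) -
      (\<Sum>i\<in>UNIV. m n * r (a * ?b i k) (?s i (k + n)) L) +
      (\<Sum>i\<in>UNIV. (m (k + n) - m k * m n) * r a (?s i (k + n)) L)"
    by (simp only: sum.distrib sum_subtractf)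
  also have "(\<Sum>i\<in>UNIV. m k * r (a * ?b i n) (?s i (k + n)) L) =
      (\<Sum>i\<in>UNIV. m k * r (a * ?b i n) (?s i n) L)"
    using power_shift[OF k n] by (intro sum.cong refl word_sum_scale) simp
  also have "(\<Sum>i\<in>UNIV. m n * r (a * ?b i k) (?s i (k + n)) L) =
      (\<Sum>i\<in>UNIV. m n * r (a * ?b i k) (?s i k) L)"
    using power_shift[OF n k] by (intro sum.cong refl word_sum_scale) (simp add: add.commute)
  \<comment> \<open>The two parts of the constant are treated separately: the exponent
    \<open>k + n\<close> has its own weight \<open>m (k + n)\<close>, while \<open>m k * m n\<close>
    lowers the exponent to \<open>n\<close> before the column is summed.\<close>
  also have "(\<Sum>i\<in>UNIV. (m (k + n) - m k * m n) * r a (?s i (k + n)) L) =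
      (m (k + n) - m k * m n) * r a w L"
  proof (rule word_sum_relation)
    fix w'
    have "m k * m n * (\<Sum>i\<in>UNIV. \<tau> (?s i (k + n) @ w')) = m n * (\<Sum>i\<in>UNIV. m k * \<tau> (?s i (k + n) @ w'))"
      by (simp add: sum_distrib_left mult_ac)
    also have "\<dots> = m n * (\<Sum>i\<in>UNIV. m k * \<tau> (?s i n @ w'))"
      by (simp only: append_assoc power_shift[OF k n])
    also have "\<dots> = m k * m n * \<tau> (w @ w')"
      using power_sum[OF n, of w j w'] by (auto simp: sum_distrib_left[symmetric])
    finally show "(\<Sum>i\<in>UNIV. (m (k + n) - m k * m n) * \<tau> (?s i (k + n) @ w')) =
        (m (k + n) - m k * m n) * \<tau> (w @ w')"
      using power_sum[of "k + n" w j w'] k by (simp add: left_diff_distrib sum_subtractf sum_distrib_left)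
  qed
  finally show "r a w ((j, k, m k) # (j, n, m n) # L) =
    r a w ((j, k + n, m (k + n)) # L) - m k * r a w ((j, n, m n) # L) -
    m n * r a w ((j, k, m k) # L) + (m (k + n) - m k * m n) * r a w L"
    by (simp add: sum_distrib_left)
qed

lemma r_centre:
  assumes "k \<ge> 1"
  shows "r a w (K @ (j, k, 0) # L) = r a w (K @ (j, k, m k) # L) + m k * r a w (K @ L)"
proof -
  have "r a w ((j, k, 0) # L) = r a w ((j, k, m k) # L) + m k * r a w L" for a w
  proof -
    have "r (a * (x i ^ k)) v L = r (a * (x i ^ k - cscale (m k) 1)) v L + m k * r a v L" for i v
      using r_add[of "a * (x i ^ k - cscale (m k) 1)" "cscale (m k) a" v L]
      by (simp add: r_cscale right_diff_distrib cscale_mult_right)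
    moreover have "(\<Sum>i\<in>UNIV. m k * r a (w @ replicate k (i, j)) L) = m k * r a w L"
      by (rule word_sum_relation) (use power_sum[OF assms] in \<open>simp add: sum_distrib_left\<close>)
    ultimately show ?thesis
      by (simp add: sum.distrib)
  qed
  from word_sum_context[of \<phi> x \<tau> _ _ 0 _ 0 _ "m k" _ a w K, of _ _ "[]" "[]"] this
  show ?thesis
    by simp
qed

lemma r_alternating:
  assumes "L \<noteq> []" "\<forall>(j, k, c)\<in>set L. k \<ge> 1 \<and> c = m k" "alternating \<epsilon> (map fst L)"
  shows "r 1 [] L = 0"
proof (rule word_sum_termwise_zero)
  fix "is" :: "'n list" assume len: "length is = length L"
  show "\<phi> (1 * index_product x is L) * \<tau> ([] @ index_word is L) = 0"
  proof (cases "alternating \<epsilon> is")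
    case True
    have "\<phi> (index_product x is L) = 0"
      unfolding index_product_def
    proof (rule phi_alternating_product[OF _ _ True])
      fix p assume "p < length (map2 (\<lambda>i (j, k, c). x i ^ k - cscale c 1) is L)"
      then have p: "p < length is" "p < length L"
        by auto
      obtain j k c where e: "L ! p = (j, k, c)"
        by (cases "L ! p")
      then have "c = m k"
        using assms(2) nth_mem[OF p(2)] by auto
      then show "map2 (\<lambda>i (j, k, c). x i ^ k - cscale c 1) is L ! p \<in> generated_subalgebra (x (is ! p))"
        "\<phi> (map2 (\<lambda>i (j, k, c). x i ^ k - cscale c 1) is L ! p) = 0"
        using p e by (simp_all add: power_diff_in_generated phi_diff phi_cscale phi_one moment)
    qed (use len assms(1) in auto)
    then show ?thesis
      by simp
  next
    case False
    then obtain s a t v where is_eq: "is = s @ a # t @ a # v" "\<forall>b\<in>set t. \<epsilon> a b = 1"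
      by (rule not_alternatingE)
    define L1 where "L1 = take (length s) L"
    define K where "K = take (length t) (drop (Suc (length s)) L)"
    define e where "e = L ! length s"
    define e' where "e' = L ! (Suc (length s) + length t)"
    define L2 where "L2 = drop (Suc (Suc (length s) + length t)) L"
    have L: "L = L1 @ e # K @ e' # L2"
    proof -
      have "L = L1 @ e # drop (Suc (length s)) L"
        unfolding L1_def e_def using len is_eq by (simp add: id_take_nth_drop)
      also have "drop (Suc (length s)) L = K @ e' # L2"
        using id_take_nth_drop[of "length t" "drop (Suc (length s)) L"] len is_eq
        by (simp add: K_def e'_def L2_def add.commute)
      finally show ?thesis .
    qed
    have lens: "length s = length L1" "length t = length K"
      using len is_eq by (simp_all add: L1_def K_def)
    obtain j k c where e: "e = (j, k, c)"
      by (cases e)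
    obtain l n d where e': "e' = (l, n, d)"
      by (cases e')
    have alt: "alternating \<epsilon> v'" if "alternating \<epsilon> (u @ v')" for u v'
      using that by (induction u) auto
    have "alternating \<epsilon> (map fst (e # K @ e' # L2))"
      using alt[of "map fst L1" "map fst (e # K @ e' # L2)"] assms(3) L by simp
    then have "remove_letter \<epsilon> j (map fst K @ l # map fst L2) = None"
      by (simp add: e e')
    moreover have "\<forall>(j, k, c)\<in>set K. k \<ge> 1" "k \<ge> 1" "n \<ge> 1"
      using assms(2) L e e' by (auto simp: ball_Un case_prod_beta)
    \<comment> \<open>The rows allow the two factors with row \<open>a\<close> to meet, the
      alternating columns do not; this mismatch makes the word vanish.\<close>
    ultimately have "\<tau> (index_word s L1 @ replicate k (a, j) @ index_word t K @ replicate n (a, l) @ index_word v L2) = 0"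
      using lens(2) is_eq(2) by (intro blocked_word_zero)
    moreover have "index_word is L =
      index_word s L1 @ replicate k (a, j) @ index_word t K @ replicate n (a, l) @ index_word v L2"
      unfolding L is_eq(1) using lens by (simp add: index_word_def e e')
    ultimately show ?thesis
      by simp
  qed
qed

end

text \<open>Commuting and merging obey the same rules for both functionals, and all words on the
  right of a merge are shorter. The recursion ends at alternating words, with value zero, or at the
  empty word.\<close>

lemma power_words_unique:
  fixes \<epsilon> :: "'n::finite \<Rightarrow> 'n \<Rightarrow> nat" and x :: "'n \<Rightarrow> 'a::complex_star_algebra"
  assumes "power_words \<epsilon> \<phi> x \<tau> m" "power_words \<epsilon> \<phi> x \<tau>' m" "\<tau> [] = \<tau>' []"
    and L: "\<forall>(j, k, c)\<in>set L. k \<ge> 1 \<and> c = m k"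
  shows "word_sum \<phi> x \<tau> 1 [] L = word_sum \<phi> x \<tau>' 1 [] L"
proof -
  interpret p: power_words \<epsilon> \<phi> x \<tau> m by fact
  interpret p': power_words \<epsilon> \<phi> x \<tau>' m by fact
  show ?thesis
    using L
  proof (induction "length L" arbitrary: L rule: less_induct)
    case less
    show ?case
    proof (cases "L = [] \<or> alternating \<epsilon> (map fst L)")
      case True
      then show ?thesis
        using assms(3) p.r_alternating[of L] p'.r_alternating[of L] less.prems by (cases "L = []") auto
    next
      case False
      then obtain s j t v where *: "map fst L = s @ j # t @ j # v" "\<forall>b\<in>set t. \<epsilon> j b = 1"
        using p.not_alternatingE by metis
      then obtain L1 e K e' L2 where L: "L = L1 @ e # K @ e' # L2"
        "fst e = j" "fst e' = j" "map fst K = t"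
        by (auto simp: map_eq_append_conv map_eq_Cons_conv append_eq_map_conv Cons_eq_map_conv)
      obtain k n where e: "e = (j, k, m k)" "e' = (j, n, m n)" "k \<ge> 1" "n \<ge> 1"
        using less.prems L by (cases e; cases e') auto
      have K: "\<epsilon> j (fst f) = 1" "\<forall>(j, k, c)\<in>set [f]. k \<ge> 1 \<and> c = m k" if "f \<in> set K" for f
        using *(2) L that less.prems by auto
      have move: "word_sum \<phi> x \<sigma> 1 [] (L1 @ e # K @ e' # L2) = word_sum \<phi> x \<sigma> 1 [] (L1 @ K @ e # e' # L2)"
        if \<sigma>: "power_words \<epsilon> \<phi> x \<sigma> m" for \<sigma>
      proof -
        interpret q: power_words \<epsilon> \<phi> x \<sigma> m by fact
        have "word_sum \<phi> x \<sigma> 1 [] (L1 @ e # K @ M) = word_sum \<phi> x \<sigma> 1 [] (L1 @ K @ e # M)" for M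
          using K
        proof (induction K arbitrary: L1)
          case (Cons f K)
          obtain l i where f: "f = (l, i, m i)" "i \<ge> 1" "\<epsilon> j l = 1"
            using Cons.prems[of f] by (cases f) auto
          have "word_sum \<phi> x \<sigma> 1 [] (L1 @ e # f # K @ M) = word_sum \<phi> x \<sigma> 1 [] ((L1 @ [f]) @ e # K @ M)"
            using q.r_commute[OF f(3) e(3) f(2)] by (simp add: e f)
          also have "\<dots> = word_sum \<phi> x \<sigma> 1 [] ((L1 @ [f]) @ K @ e # M)"
            by (rule Cons.IH) (use Cons.prems in auto)
          finally show ?case
            by simp
        qed simp
        then show ?thesis .
      qed
      have short: "word_sum \<phi> x \<tau> 1 [] (L1 @ K @ M) = word_sum \<phi> x \<tau>' 1 [] (L1 @ K @ M)"
        if "length M < Suc (Suc (length L2))" "\<forall>(j, k, c)\<in>set M. k \<ge> 1 \<and> c = m k" for M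
        by (rule less.hyps) (use that L less.prems in \<open>simp_all add: ball_Un\<close>)
      have L2: "\<forall>(j, k, c)\<in>set L2. k \<ge> 1 \<and> c = m k"
        using less.prems L by (simp add: ball_Un)
      show ?thesis
        unfolding L(1) move[OF assms(1)] move[OF assms(2)]
        using p.r_merge[OF e(3,4), of 1 "[]" "L1 @ K" j L2] p'.r_merge[OF e(3,4), of 1 "[]" "L1 @ K" j L2]
          short[of "(j, k + n, m (k + n)) # L2"] short[of "(j, k, m k) # L2"] short[of "(j, n, m n) # L2"]
          short[of L2] L2 e by simp
    qed
  qed
qed

text \<open>The comparison functional \<open>\<tau>'\<close> belongs to the identity matrix, scaled
  to agree with \<open>\<tau>\<close> at the empty word. In its sum only the term with
  \<open>is = js\<close> survives.\<close>

lemma power_words_invariance: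
  fixes \<epsilon> :: "'n::finite \<Rightarrow> 'n \<Rightarrow> nat" and x :: "'n \<Rightarrow> 'a::complex_star_algebra"
  assumes "power_words \<epsilon> \<phi> x \<tau> m"
  shows "(\<Sum>is | length is = length js. \<phi> (prod_list (map x is)) * \<tau> (zip is js)) =
    \<phi> (prod_list (map x js)) * \<tau> []"
proof -
  interpret power_words \<epsilon> \<phi> x \<tau> m by fact
  define \<tau>' where "\<tau>' w = (if \<forall>(i, j)\<in>set w. i = j then \<tau> [] else 0)" for w :: "('n \<times> 'n) list"
  have trivial: "power_words \<epsilon> \<phi> x \<tau>' m"
  proof unfold_locales
    fix k :: nat and w w' :: "('n \<times> 'n) list" and j :: 'n assume k: "k \<ge> 1"
    have "\<tau>' (w @ replicate k (i, j) @ w') = (if i = j then \<tau>' (w @ w') else 0)" for i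
      using k by (auto simp: \<tau>'_def)
    then show "m k * (\<Sum>i\<in>UNIV. \<tau>' (w @ replicate k (i, j) @ w')) = m k * \<tau>' (w @ w')"
      by simp
  qed (auto simp: \<tau>'_def moment)
  have same: "\<tau> [] = \<tau>' []"
    by (simp add: \<tau>'_def)
  \<comment> \<open>The prefix \<open>L\<close> collects the factors that are already centred;
    \<open>r_centre\<close> treats one plain letter at a time.\<close>
  have "word_sum \<phi> x \<tau> 1 [] (L @ map (\<lambda>j. (j, 1, 0)) js) = word_sum \<phi> x \<tau>' 1 [] (L @ map (\<lambda>j. (j, 1, 0)) js)"
    if "\<forall>(j, k, c)\<in>set L. k \<ge> 1 \<and> c = m k" for L
    using that
  proof (induction js arbitrary: L)
    case Nil
    then show ?case
      using power_words_unique[OF assms trivial same] by simp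
  next
    case (Cons j js)
    interpret t: power_words \<epsilon> \<phi> x \<tau>' m by (rule trivial)
    show ?case
      using r_centre[of 1 1 "[]" L j] t.r_centre[of 1 1 "[]" L j]
        Cons.IH[of L] Cons.IH[of "L @ [(j, 1, m 1)]"] Cons.prems by simp
  qed
  from this[of "[]"] have "word_sum \<phi> x \<tau> 1 [] (map (\<lambda>j. (j, 1, 0)) js) =
      word_sum \<phi> x \<tau>' 1 [] (map (\<lambda>j. (j, 1, 0)) js)"
    by simp
  then have "(\<Sum>is | length is = length js. \<phi> (prod_list (map x is)) * \<tau> (zip is js)) =
      (\<Sum>is | length is = length js. \<phi> (prod_list (map x is)) * \<tau>' (zip is js))"
    unfolding word_sum_letters by simp
  also have "\<dots> = (\<Sum>is | length is = length js. if is = js then \<phi> (prod_list (map x js)) * \<tau> [] else 0)"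
  proof (rule sum.cong[OF refl])
    fix "is" :: "'n list" assume "is \<in> {is. length is = length js}"
    then have "(\<forall>(i, j)\<in>set (zip is js). i = j) \<longleftrightarrow> is = js"
      by (auto simp: list_eq_iff_nth_eq set_zip)
    then show "\<phi> (prod_list (map x is)) * \<tau>' (zip is js) =
        (if is = js then \<phi> (prod_list (map x js)) * \<tau> [] else 0)"
      by (simp add: \<tau>'_def)
  qed
  also have "\<dots> = \<phi> (prod_list (map x js)) * \<tau> []"
    using finite_lists_length_eq[of "UNIV :: 'n set" "length js"] by (simp add: sum.delta)
  finally show ?thesis .
qed

section \<open>Unital C*-algebras\<close>

context unital_cstar_algebra
begin

lemma scale_closed: "x \<in> carrier B \<Longrightarrow> c \<odot> x \<in> carrier B"
  and scale_add_left: "x \<in> carrier B \<Longrightarrow> (c + d) \<odot> x = c \<odot> x \<oplus> d \<odot> x"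
  and scale_add_right: "\<lbrakk>x \<in> carrier B; y \<in> carrier B\<rbrakk> \<Longrightarrow> c \<odot> (x \<oplus> y) = c \<odot> x \<oplus> c \<odot> y"
  and scale_scale: "x \<in> carrier B \<Longrightarrow> c \<odot> (d \<odot> x) = (c * d) \<odot> x"
  and scale_one: "x \<in> carrier B \<Longrightarrow> 1 \<odot> x = x"
  and scale_zero: "x \<in> carrier B \<Longrightarrow> 0 \<odot> x = \<zero>"
  and scale_null: "c \<odot> \<zero> = \<zero>"
  and scale_finsum: "\<lbrakk>finite A; f \<in> A \<rightarrow> carrier B\<rbrakk> \<Longrightarrow> c \<odot> finsum B f A = (\<Oplus>i\<in>A. c \<odot> f i)"
  using smult_closed[of c x] smult_l_distr[of c d x] smult_r_distr[of c x y] smult_assoc1[of c d x]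
    smult_one[of x] smult_l_null[of x] smult_r_null[of c] finsum_smult_ldistr[of A c f]
  by (auto simp: complex_ring_def)

lemma minus_eq_scale: "x \<in> carrier B \<Longrightarrow> \<ominus> x = (- 1) \<odot> x"
  using scale_add_left[of x "- 1" 1]
  by (intro minus_equality) (simp_all add: scale_closed scale_one scale_zero)

lemma cnorm_diff_le:
  assumes "x \<in> carrier B" "y \<in> carrier B"
  shows "cnorm B (x \<ominus> y) \<le> cnorm B x + cnorm B y"
proof -
  have "cnorm B (\<ominus> y) = cnorm B y"
    using assms cnorm_smult[of y "- 1"] by (simp add: minus_eq_scale)
  then show ?thesis
    using cnorm_triangle[of x "\<ominus> y"] assms by (simp add: minus_eq)
qed

lemma adjoint_one: "adjoint B \<one> = \<one>"
  using adjoint_mult[of "adjoint B \<one>" \<one>] by (simp add: adjoint_adjoint adjoint_closed)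

lemma adjoint_minus: "x \<in> carrier B \<Longrightarrow> adjoint B (\<ominus> x) = \<ominus> adjoint B x"
  using adjoint_smult[of x "- 1"] by (simp add: minus_eq_scale adjoint_closed)

section \<open>Norm geometry of projections\<close>

lemma cnorm_projection_le:
  assumes "p \<in> carrier B" "adjoint B p = p" "p \<otimes> p = p"
  shows "cnorm B p \<le> 1"
proof -
  have "cnorm B p * cnorm B p = cnorm B p"
    using cstar_identity[OF assms(1)] assms by (simp add: power2_eq_square)
  then show ?thesis
    by auto
qed

text \<open>The unit \<open>e\<close> of a corner is an extreme point of the unit ball: the bound \<open>\<parallel>e \<plusminus> h\<parallel> \<le> 1\<close> propagates
  from \<open>h\<close> to \<open>3/2 h\<close>, since \<open>e + 3/2 h = 3/4 (e + h)\<^sup>2 + 1/4 (e - 3 h\<^sup>2)\<close> and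
  \<open>2 (e - 3 h\<^sup>2) = (e + \<i> h)\<^sup>3 + (e - \<i> h)\<^sup>3\<close>, where
  \<open>\<parallel>e \<plusminus> \<i> h\<parallel>\<^sup>2 = \<parallel>e + h\<^sup>2\<parallel> \<le> 1\<close> because \<open>2 (e + h\<^sup>2) = (e + h)\<^sup>2 + (e - h)\<^sup>2\<close>.\<close>

lemma corner_extreme_step:
  assumes e: "e \<in> carrier B" "adjoint B e = e" "e \<otimes> e = e"
    and h: "h \<in> carrier B" "adjoint B h = h" "e \<otimes> h = h" "h \<otimes> e = h"
    and bound: "cnorm B (e \<oplus> h) \<le> 1" "cnorm B (e \<oplus> (- 1) \<odot> h) \<le> 1"
  shows "cnorm B (e \<oplus> (3 / 2) \<odot> h) \<le> 1"
proof -
  \<comment> \<open>Polynomials in \<open>h\<close> of degree at most three with \<open>e\<close> as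
    unit; identities between them become arithmetic of coefficients.\<close>
  define E where "E a b c d = a \<odot> e \<oplus> b \<odot> h \<oplus> c \<odot> (h \<otimes> h) \<oplus> d \<odot> (h \<otimes> h \<otimes> h)" for a b c d
  have closed: "E a b c d \<in> carrier B" for a b c d
    using e(1) h(1) by (simp add: E_def scale_closed)
  have lin: "E a b 0 0 = a \<odot> e \<oplus> b \<odot> h" for a b
    using e(1) h(1) by (simp add: E_def scale_closed scale_zero)
  have add: "E a b c d \<oplus> E a' b' c' d' = E (a + a') (b + b') (c + c') (d + d')" for a b c d a' b' c' d'
    using e(1) h(1) by (simp add: E_def scale_closed scale_add_left a_ac)
  have scale: "s \<odot> E a b c d = E (s * a) (s * b) (s * c) (s * d)" for s a b c d
    using e(1) h(1) by (simp add: E_def scale_closed scale_add_right scale_scale)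
  have eh: "e \<otimes> (h \<otimes> h) = h \<otimes> h"
    using e(1) h by (simp add: m_assoc[symmetric])
  have mult: "E a b 0 0 \<otimes> E a' b' c' 0 = E (a * a') (a * b' + b * a') (a * c' + b * b') (b * c')"
    for a b a' b' c'
    using e h eh by (simp add: E_def scale_closed scale_zero l_distr r_distr smult_mult_left
        smult_mult_right scale_scale scale_add_left scale_add_right a_ac m_assoc mult_ac)
  have norm_mult: "cnorm B (x \<otimes> y) \<le> 1"
    if "x \<in> carrier B" "y \<in> carrier B" "cnorm B x \<le> 1" "cnorm B y \<le> 1" for x y
    using cnorm_mult[OF that(1,2)] mult_le_one[OF that(3) cnorm_nonneg[OF that(2)] that(4)] by simp
  have convex: "cnorm B (of_real s \<odot> x \<oplus> of_real t \<odot> y) \<le> 1"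
    if "x \<in> carrier B" "y \<in> carrier B" "cnorm B x \<le> 1" "cnorm B y \<le> 1" "s \<ge> 0" "t \<ge> 0" "s + t = 1"
    for x y s t
  proof -
    have "cnorm B (of_real s \<odot> x \<oplus> of_real t \<odot> y) \<le> s * cnorm B x + t * cnorm B y"
      using cnorm_triangle[of "of_real s \<odot> x" "of_real t \<odot> y"] that by (simp add: scale_closed cnorm_smult)
    also have "\<dots> \<le> s * 1 + t * 1"
      using that by (intro add_mono mult_left_mono)
    finally show ?thesis
      using that by simp
  qed
  have plus: "cnorm B (E 1 1 0 0) \<le> 1" and minus: "cnorm B (E 1 (- 1) 0 0) \<le> 1"
    using bound e(1) h(1) by (simp_all add: lin scale_one)
  have sq: "cnorm B (E 1 2 1 0) \<le> 1" "cnorm B (E 1 (- 2) 1 0) \<le> 1"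
    using norm_mult[OF closed closed plus plus] norm_mult[OF closed closed minus minus]
    by (simp_all add: mult)
  have "cnorm B (E 1 0 1 0) \<le> 1"
    using convex[OF closed closed sq, of "1/2" "1/2"] by (simp add: scale add)
  moreover have "adjoint B (E 1 (- \<i>) 0 0) = E 1 \<i> 0 0" "adjoint B (E 1 \<i> 0 0) = E 1 (- \<i>) 0 0"
    using e h by (simp_all add: lin adjoint_add adjoint_smult scale_closed)
  ultimately have "(cnorm B (E 1 \<i> 0 0))\<^sup>2 \<le> 1" "(cnorm B (E 1 (- \<i>) 0 0))\<^sup>2 \<le> 1"
    using cstar_identity[OF closed, of 1 \<i> 0 0] cstar_identity[OF closed, of 1 "- \<i>" 0 0]
    by (simp_all add: mult)
  then have v: "cnorm B (E 1 \<i> 0 0) \<le> 1" "cnorm B (E 1 (- \<i>) 0 0) \<le> 1"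
    using cnorm_nonneg[OF closed] by (simp_all add: power_le_one_iff)
  have v2: "cnorm B (E 1 (2 * \<i>) (- 1) 0) \<le> 1" "cnorm B (E 1 (- 2 * \<i>) (- 1) 0) \<le> 1"
    using norm_mult[OF closed closed v(1) v(1)] norm_mult[OF closed closed v(2) v(2)]
    by (simp_all add: mult)
  have v3: "cnorm B (E 1 (3 * \<i>) (- 3) (- \<i>)) \<le> 1" "cnorm B (E 1 (- 3 * \<i>) (- 3) \<i>) \<le> 1"
  proof -
    have i: "\<i> * (2 * \<i>) = - 2"
      by (simp add: complex_eq_iff)
    show "cnorm B (E 1 (3 * \<i>) (- 3) (- \<i>)) \<le> 1" "cnorm B (E 1 (- 3 * \<i>) (- 3) \<i>) \<le> 1"
      using norm_mult[OF closed closed v(1) v2(1)] norm_mult[OF closed closed v(2) v2(2)]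
      by (simp_all add: mult i)
  qed
  have "cnorm B (E 1 0 (- 3) 0) \<le> 1"
    using convex[OF closed closed v3, of "1/2" "1/2"] by (simp add: scale add)
  then have "cnorm B (E 1 (3 / 2) 0 0) \<le> 1"
    using convex[OF closed closed sq(1), of 1 0 "- 3" 0 "3/4" "1/4"] by (simp add: scale add)
  then show ?thesis
    using e(1) by (simp add: lin scale_one)
qed

text \<open>Iteration of the step keeps both elements \<open>e \<plusminus> (3/2)^n h\<close> in the
  unit ball, so \<open>(3/2)^n\<close> times the norm of \<open>h\<close> stays bounded by
  two.\<close>

lemma corner_extreme:
  assumes e: "e \<in> carrier B" "adjoint B e = e" "e \<otimes> e = e"
    and h: "h \<in> carrier B" "adjoint B h = h" "e \<otimes> h = h" "h \<otimes> e = h"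
    and bound: "cnorm B (e \<oplus> h) \<le> 1" "cnorm B (e \<oplus> (- 1) \<odot> h) \<le> 1"
  shows "h = \<zero>"
proof -
  have iter: "cnorm B (e \<oplus> of_real ((3 / 2) ^ n) \<odot> h) \<le> 1 \<and>
      cnorm B (e \<oplus> of_real (- ((3 / 2) ^ n)) \<odot> h) \<le> 1" for n
  proof (induction n)
    case 0
    then show ?case
      using bound h(1) by (simp add: scale_one)
  next
    case (Suc n)
    have step: "cnorm B (e \<oplus> of_real (3 / 2 * t) \<odot> h) \<le> 1"
      if "cnorm B (e \<oplus> of_real t \<odot> h) \<le> 1" "cnorm B (e \<oplus> of_real (- t) \<odot> h) \<le> 1" for t :: real
      using corner_extreme_step[OF e, of "of_real t \<odot> h"] that e h
      by (simp add: scale_closed adjoint_smult smult_mult_left smult_mult_right scale_scale)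
    show ?case
      using step[of "(3 / 2) ^ n"] step[of "- ((3 / 2) ^ n)"] Suc.IH by simp
  qed
  have "(3 / 2) ^ n * cnorm B h \<le> 2" for n
  proof -
    let ?t = "of_real ((3 / 2) ^ n) :: complex"
    have "cnorm B (?t \<odot> h) \<le> cnorm B (e \<oplus> ?t \<odot> h) + cnorm B e"
      using cnorm_diff_le[of "e \<oplus> ?t \<odot> h" e] e(1) h(1)
      by (simp add: scale_closed minus_eq a_ac r_neg2)
    also have "\<dots> \<le> 2"
      using iter[of n] cnorm_projection_le[OF e] by simp
    finally show ?thesis
      using h(1) by (simp add: cnorm_smult norm_power)
  qed
  then have "cnorm B h \<le> 2 * (2 / 3) ^ n" for n
    by (simp add: field_simps)
  moreover have "(\<lambda>n. 2 * (2 / 3) ^ n) \<longlonglongrightarrow> (2 * 0 :: real)"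
    by (intro tendsto_intros LIMSEQ_realpow_zero) auto
  ultimately have "cnorm B h \<le> 0"
    using LIMSEQ_le_const[of "\<lambda>n. 2 * (2 / 3) ^ n" "2 * 0" "cnorm B h"] by auto
  then show ?thesis
    using cnorm_nonneg[OF h(1)] cnorm_eq_zero[OF h(1)] by simp
qed

text \<open>Compression by \<open>e = p j\<close> gives elements \<open>b k\<close> with sum
  \<open>e\<close> and \<open>b j = e\<close>, so the remaining ones sum to zero. From
  \<open>b i = - (\<Sum>k\<in>R. b k)\<close> and norm of \<open>e - b k\<close> at most one, a
  small multiple of \<open>b i\<close> can be both added to and subtracted from \<open>e\<close>
  inside the unit ball. Extremality of \<open>e\<close> then forces \<open>b i\<close> to
  vanish.\<close>

lemma projections_orthogonal:
  fixes p :: "'i::finite \<Rightarrow> 'b"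
  assumes closed: "\<And>i. p i \<in> carrier B" and sa: "\<And>i. adjoint B (p i) = p i"
    and idem: "\<And>i. p i \<otimes> p i = p i" and sum: "(\<Oplus>i\<in>UNIV. p i) = \<one>" and "i \<noteq> j"
  shows "p i \<otimes> p j = \<zero>"
proof -
  define e where "e = p j"
  have e: "e \<in> carrier B" "adjoint B e = e" "e \<otimes> e = e"
    by (auto simp: e_def closed sa idem)
  define b where "b k = e \<otimes> p k \<otimes> e" for k
  have b: "b k \<in> carrier B" for k
    using e closed by (simp add: b_def)
  have near: "cnorm B (e \<ominus> b k) \<le> 1" for k
  proof -
    have "cnorm B (\<one> \<ominus> p k) \<le> 1"
      by (rule cnorm_projection_le)
        (simp_all add: closed sa idem minus_eq adjoint_add adjoint_minus adjoint_one l_distr r_distr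
          l_minus r_minus r_neg a_assoc l_neg)
    moreover have "e \<ominus> b k = e \<otimes> (\<one> \<ominus> p k) \<otimes> e"
      using e closed by (simp add: b_def minus_eq r_distr l_distr r_minus l_minus)
    ultimately show ?thesis
      using cnorm_projection_le[OF e] cnorm_mult[of "e \<otimes> (\<one> \<ominus> p k)" e] cnorm_mult[of e "\<one> \<ominus> p k"] e closed
        mult_le_one[of "cnorm B e" "cnorm B (\<one> \<ominus> p k)"]
        mult_le_one[of "cnorm B (e \<otimes> (\<one> \<ominus> p k))" "cnorm B e"]
        cnorm_nonneg[of "\<one> \<ominus> p k"] cnorm_nonneg[of e]
      by simp
  qed
  have near_sum: "cnorm B (of_nat (card F) \<odot> e \<ominus> (\<Oplus>k\<in>F. b k)) \<le> card F" if "finite F" for F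
    using that
  proof induction
    case empty
    then show ?case
      using e(1) cnorm_eq_zero[of \<zero>] by (simp add: scale_zero minus_eq)
  next
    case (insert k F)
    have F: "finsum B b F \<in> carrier B"
      using b by (intro finsum_closed) auto
    have "of_nat (card (insert k F)) \<odot> e \<ominus> finsum B b (insert k F) =
      (e \<ominus> b k) \<oplus> (of_nat (card F) \<odot> e \<ominus> finsum B b F)"
      using insert.hyps e(1) b F
      by (simp add: scale_add_left scale_one scale_closed minus_eq minus_add a_ac)
    also have "cnorm B \<dots> \<le> cnorm B (e \<ominus> b k) + cnorm B (of_nat (card F) \<odot> e \<ominus> finsum B b F)"
      using e(1) b F by (intro cnorm_triangle) (simp_all add: scale_closed)
    finally show ?case
      using near[of k] insert by simp
  qed
  define R where "R = UNIV - {i, j}"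
  have R: "finsum B b R \<in> carrier B"
    using b by (intro finsum_closed) auto
  have "e = e \<otimes> (\<Oplus>k\<in>UNIV. p k) \<otimes> e"
    using e by (simp add: sum)
  also have "\<dots> = (\<Oplus>k\<in>UNIV. b k)"
    using e closed by (simp add: finsum_rdistr finsum_ldistr b_def)
  also have "UNIV = insert j (insert i R)"
    by (auto simp: R_def)
  also have "finsum B b \<dots> = e \<oplus> (b i \<oplus> finsum B b R)"
    using \<open>i \<noteq> j\<close> b e by (simp add: R_def) (simp add: b_def e_def idem closed)
  finally have "b i \<oplus> finsum B b R = \<zero>"
    using e(1) b R by (metis M.add.m_closed M.add.r_cancel_one' M.a_comm)
  then have bi: "\<ominus> finsum B b R = b i"
    using b R by (simp add: minus_equality)
  \<comment> \<open>With \<open>r = card R\<close>, both \<open>e + s b i\<close> and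
    \<open>e - s b i\<close> are \<open>s\<close> times a sum with norm at most
    \<open>r + 1\<close>; this choice of \<open>s\<close> brings the bound to one.\<close>
  define s where "s = 1 / (real (card R) + 1)"
  define h where "h = of_real s \<odot> b i"
  have s: "s > 0" "s * (real (card R) + 1) = 1"
    by (simp_all add: s_def)
  have h: "h \<in> carrier B" "adjoint B h = h" "e \<otimes> h = h" "h \<otimes> e = h"
    using e closed b by (simp_all add: h_def b_def scale_closed adjoint_smult adjoint_mult sa
        smult_mult_left smult_mult_right m_assoc) (simp_all add: m_assoc[symmetric])
  have norm_scaled: "cnorm B (of_real s \<odot> (y \<oplus> z)) \<le> 1"
    if "y \<in> carrier B" "z \<in> carrier B" "cnorm B y \<le> 1" "cnorm B z \<le> real (card R)" for y z
  proof -
    have "cnorm B (of_real s \<odot> (y \<oplus> z)) = s * cnorm B (y \<oplus> z)"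
      using s that by (simp add: cnorm_smult)
    also have "\<dots> \<le> s * (1 + real (card R))"
      using s that cnorm_triangle[OF that(1,2)] by (intro mult_left_mono) auto
    finally show ?thesis
      using s by (simp add: add.commute)
  qed
  have unit: "of_real s \<odot> (e \<oplus> of_nat (card R) \<odot> e) = e"
  proof -
    have "of_real s \<odot> (e \<oplus> of_nat (card R) \<odot> e) = of_real (s * (real (card R) + 1)) \<odot> e"
      using e(1) by (simp add: scale_add_right scale_add_left scale_scale scale_closed scale_one
          distrib_left a_comm)
    then show ?thesis
      using e(1) s by (simp add: scale_one)
  qed
  have norm_e: "cnorm B e \<le> 1"
    by (rule cnorm_projection_le[OF e])
  have "e \<oplus> h = of_real s \<odot> (e \<oplus> (of_nat (card R) \<odot> e \<ominus> finsum B b R))"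
    by (subst unit[symmetric]) (use e(1) b R in \<open>simp add: h_def minus_eq bi scale_closed
        scale_add_right[symmetric] a_assoc\<close>)
  then have "cnorm B (e \<oplus> h) \<le> 1"
    using norm_scaled[of e "of_nat (card R) \<odot> e \<ominus> finsum B b R"] near_sum[of R] norm_e e(1) R
    by (simp add: scale_closed)
  moreover have "e \<oplus> (- 1) \<odot> h = of_real s \<odot> ((e \<ominus> b i) \<oplus> of_nat (card R) \<odot> e)"
  proof -
    have "(- 1) \<odot> h = of_real s \<odot> \<ominus> b i"
      using b by (simp add: h_def minus_eq_scale scale_scale)
    then show ?thesis
      by (subst unit[symmetric]) (use e(1) b in \<open>simp add: minus_eq scale_closed
        scale_add_right[symmetric] a_ac\<close>)
  qed
  then have "cnorm B (e \<oplus> (- 1) \<odot> h) \<le> 1"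
    using norm_scaled[of "e \<ominus> b i" "of_nat (card R) \<odot> e"] near[of i] norm_e e(1) b
    by (simp add: scale_closed cnorm_smult mult_left_le)
  ultimately have "h = \<zero>"
    using corner_extreme[OF e h] by simp
  then have "cnorm B (b i) = 0"
    using s cnorm_smult[OF b, of "of_real s" i] cnorm_eq_zero[of h] h(1) by (simp add: h_def)
  \<comment> \<open>The C*-identity passes from the vanishing compression to the product
    \<open>p i \<otimes> e\<close> itself.\<close>
  moreover have "adjoint B (p i \<otimes> e) \<otimes> (p i \<otimes> e) = b i"
    using e closed by (simp add: adjoint_mult sa b_def m_assoc) (simp add: m_assoc[symmetric] idem)
  ultimately have "cnorm B (p i \<otimes> e) = 0"
    using cstar_identity[of "p i \<otimes> e"] e closed by simp
  then show ?thesis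
    using cnorm_eq_zero[of "p i \<otimes> e"] e closed by (simp add: e_def)
qed

text \<open>The functional is purely algebraic, without continuity. As the carrier is only a subset
  of its type, linear algebra is done with formal linear combinations of its elements, and
  \<open>ev\<close> evaluates them in the algebra.\<close>

lemma separating_functional:
  assumes z: "z \<in> carrier B" "z \<noteq> \<zero>"
  obtains \<Lambda> :: "'b \<Rightarrow> complex" where
    "\<And>x y. \<lbrakk>x \<in> carrier B; y \<in> carrier B\<rbrakk> \<Longrightarrow> \<Lambda> (x \<oplus> y) = \<Lambda> x + \<Lambda> y"
    "\<And>c x. x \<in> carrier B \<Longrightarrow> \<Lambda> (c \<odot> x) = c * \<Lambda> x" "\<Lambda> z \<noteq> 0"
proof -
  define sc :: "complex \<Rightarrow> ('b \<Rightarrow> complex) \<Rightarrow> 'b \<Rightarrow> complex" where "sc c p = (\<lambda>b. c * p b)" for c p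
  interpret V: vector_space sc
    by unfold_locales (auto simp: sc_def fun_eq_iff algebra_simps)
  interpret VP: vector_space_pair sc "(*) :: complex \<Rightarrow> complex \<Rightarrow> complex"
    by unfold_locales (auto simp: algebra_simps)
  define \<delta> :: "'b \<Rightarrow> 'b \<Rightarrow> complex" where "\<delta> b = (\<lambda>c. if c = b then 1 else 0)" for b
  define supp :: "('b \<Rightarrow> complex) \<Rightarrow> 'b set" where "supp p = {b. p b \<noteq> 0}" for p
  define S where "S = {p. finite (supp p) \<and> supp p \<subseteq> carrier B}"
  define ev where "ev p = (\<Oplus>b\<in>supp p. p b \<odot> b)" for p
  have ev_eq: "ev p = (\<Oplus>b\<in>A. p b \<odot> b)" if "finite A" "supp p \<subseteq> A" "A \<subseteq> carrier B" for p A
    unfolding ev_def using that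
    by (intro M.add.finprod_mono_neutral_cong_left) (auto simp: supp_def scale_zero scale_closed)
  have ev_closed: "ev p \<in> carrier B" if "p \<in> S" for p
    unfolding ev_def using that by (intro finsum_closed) (auto simp: S_def scale_closed)
  have S_add: "p + q \<in> S" if "p \<in> S" "q \<in> S" for p q
  proof -
    have "supp (p + q) \<subseteq> supp p \<union> supp q"
      by (auto simp: supp_def)
    then show ?thesis
      using that by (auto simp: S_def intro: finite_subset)
  qed
  have S_sc: "sc c p \<in> S" if "p \<in> S" for c p
  proof -
    have "supp (sc c p) \<subseteq> supp p"
      by (auto simp: supp_def sc_def)
    then show ?thesis
      using that by (auto simp: S_def intro: finite_subset)
  qed
  have ev_add: "ev (p + q) = ev p \<oplus> ev q" if "p \<in> S" "q \<in> S" for p q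
  proof -
    let ?A = "supp p \<union> supp q"
    have A: "finite ?A" "?A \<subseteq> carrier B"
      using that by (auto simp: S_def)
    have "supp (p + q) \<subseteq> ?A"
      by (auto simp: supp_def)
    then have "ev (p + q) = (\<Oplus>b\<in>?A. (p + q) b \<odot> b)"
      by (rule ev_eq[OF A(1) _ A(2)])
    also have "\<dots> = (\<Oplus>b\<in>?A. p b \<odot> b \<oplus> q b \<odot> b)"
      by (rule finsum_cong') (use A in \<open>auto simp: scale_closed scale_add_left subset_iff\<close>)
    also have "\<dots> = (\<Oplus>b\<in>?A. p b \<odot> b) \<oplus> (\<Oplus>b\<in>?A. q b \<odot> b)"
      using A by (intro finsum_addf) (auto simp: scale_closed)
    finally show ?thesis
      using A by (simp add: ev_eq[of ?A])
  qed
  have ev_sc: "ev (sc c p) = c \<odot> ev p" if "p \<in> S" for c p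
  proof -
    have A: "finite (supp p)" "supp p \<subseteq> carrier B" "supp (sc c p) \<subseteq> supp p"
      using that by (auto simp: S_def supp_def sc_def)
    then have "ev (sc c p) = (\<Oplus>b\<in>supp p. c \<odot> (p b \<odot> b))"
      by (subst ev_eq[of "supp p"]) (auto intro!: finsum_cong' simp: scale_closed scale_scale sc_def subset_iff)
    also have "\<dots> = c \<odot> ev p"
      unfolding ev_def using A by (intro scale_finsum[symmetric]) (auto simp: scale_closed)
    finally show ?thesis .
  qed
  have \<delta>: "\<delta> b \<in> S" "ev (\<delta> b) = b" if "b \<in> carrier B" for b
  proof -
    have "supp (\<delta> b) = {b}"
      by (auto simp: supp_def \<delta>_def)
    then show "\<delta> b \<in> S" "ev (\<delta> b) = b"
      using that by (simp_all add: S_def ev_def scale_closed) (simp add: \<delta>_def scale_one)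
  qed
  \<comment> \<open>The kernel of the evaluation. The formal element \<open>\<delta> z\<close> lies
    outside it, so some linear \<open>g\<close> vanishes on \<open>K\<close> but not at
    \<open>\<delta> z\<close>; such a \<open>g\<close> descends to the carrier.\<close>
  define K where "K = {p \<in> S. ev p = \<zero>}"
  have "0 \<in> S" "ev 0 = \<zero>"
    by (simp_all add: S_def supp_def ev_def)
  then have K: "V.subspace K"
    by (auto simp: V.subspace_def K_def S_add S_sc ev_add ev_sc scale_null)
  obtain T where T: "T \<subseteq> K" "V.independent T" "K \<subseteq> V.span T"
    using V.maximal_independent_subset[of K] by blast
  have "V.span T \<subseteq> K"
    by (rule V.span_minimal[OF T(1) K])
  moreover have "\<delta> z \<notin> K"
    using \<delta>[OF z(1)] z(2) by (simp add: K_def)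
  ultimately have "V.independent (insert (\<delta> z) T)"
    using T(2) by (auto simp: V.independent_insert)
  then obtain g where g: "Vector_Spaces.linear sc (*) g"
    "\<forall>p\<in>insert (\<delta> z) T. g p = (if p = \<delta> z then 1 else 0)"
    using VP.linear_independent_extend[of _ "\<lambda>p. if p = \<delta> z then 1 else 0"] by blast
  interpret g: Vector_Spaces.linear sc "(*)" g
    by (rule g(1))
  have "\<delta> z \<notin> T"
    using T(1) \<open>\<delta> z \<notin> K\<close> by blast
  then have "g p = 0" if "p \<in> T" for p
    using g(2) that by auto
  then have gK: "g p = 0" if "p \<in> K" for p
    using VP.linear_eq_0_on_span[OF g(1), of T p] T(3) that by blast
  have g_eq: "g p = g q" if "p \<in> S" "q \<in> S" "ev p = ev q" for p q
  proof -
    have "ev (p + sc (- 1) q) = \<zero>"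
      unfolding ev_add[OF that(1) S_sc[OF that(2)]] ev_sc[OF that(2)]
      using that ev_closed[of q] by (simp add: minus_eq_scale[symmetric] r_neg)
    moreover have "p + sc (- 1) q \<in> S"
      by (intro S_add S_sc that)
    ultimately have "g (p + sc (- 1) q) = 0"
      by (intro gK) (simp add: K_def)
    then show ?thesis
      unfolding g.add g.scale by simp
  qed
  show thesis
  proof (rule that[of "\<lambda>b. g (\<delta> b)"])
    fix x y assume xy: "x \<in> carrier B" "y \<in> carrier B"
    have "g (\<delta> (x \<oplus> y)) = g (\<delta> x + \<delta> y)"
      by (rule g_eq) (simp_all add: xy \<delta> S_add ev_add)
    then show "g (\<delta> (x \<oplus> y)) = g (\<delta> x) + g (\<delta> y)"
      by (simp add: g.add)
  next
    fix c x assume x: "x \<in> carrier B"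
    have "g (\<delta> (c \<odot> x)) = g (sc c (\<delta> x))"
      by (rule g_eq) (simp_all add: x \<delta> S_sc ev_sc scale_closed)
    then show "g (\<delta> (c \<odot> x)) = c * g (\<delta> x)"
      by (simp add: g.scale)
  next
    show "g (\<delta> z) \<noteq> 0"
      using g(2) by simp
  qed
qed

lemma functionals_separate_points:
  assumes "x \<in> carrier B" "y \<in> carrier B" "x \<noteq> y"
  obtains \<Lambda> :: "'b \<Rightarrow> complex" where
    "\<And>a b. \<lbrakk>a \<in> carrier B; b \<in> carrier B\<rbrakk> \<Longrightarrow> \<Lambda> (a \<oplus> b) = \<Lambda> a + \<Lambda> b"
    "\<And>c a. a \<in> carrier B \<Longrightarrow> \<Lambda> (c \<odot> a) = c * \<Lambda> a" "\<Lambda> x \<noteq> \<Lambda> y"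
proof -
  have diff: "x \<ominus> y \<in> carrier B"
    using assms by simp
  have x: "x = (x \<ominus> y) \<oplus> y"
    using assms(1,2) by (simp add: minus_eq a_assoc l_neg)
  then have nonzero: "x \<ominus> y \<noteq> \<zero>"
    using assms(2,3) by auto
  show thesis
  proof (rule separating_functional[OF diff nonzero])
    fix \<Lambda> :: "'b \<Rightarrow> complex"
    assume \<Lambda>: "\<And>a b. \<lbrakk>a \<in> carrier B; b \<in> carrier B\<rbrakk> \<Longrightarrow> \<Lambda> (a \<oplus> b) = \<Lambda> a + \<Lambda> b"
      "\<And>c a. a \<in> carrier B \<Longrightarrow> \<Lambda> (c \<odot> a) = c * \<Lambda> a" "\<Lambda> (x \<ominus> y) \<noteq> 0"
    have "\<Lambda> x = \<Lambda> (x \<ominus> y) + \<Lambda> y"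
      by (subst x) (rule \<Lambda>(1)[OF diff assms(2)])
    then show thesis
      using \<Lambda> by (intro that[of \<Lambda>]) auto
  qed
qed

end

section \<open>Linear functionals on the entries of a matrix\<close>

locale matrix_functional = unital_cstar_algebra B
  for B :: "'b cstar_structure" (structure) +
  fixes u :: "'n::finite \<Rightarrow> 'n \<Rightarrow> 'b" and \<Lambda> :: "'b \<Rightarrow> complex"
  assumes u_closed: "u i j \<in> carrier B"
    and functional_add: "\<lbrakk>a \<in> carrier B; b \<in> carrier B\<rbrakk> \<Longrightarrow> \<Lambda> (a \<oplus> b) = \<Lambda> a + \<Lambda> b"
    and functional_scale: "a \<in> carrier B \<Longrightarrow> \<Lambda> (c \<odot> a) = c * \<Lambda> a"
begin

definition entry_product :: "('n \<times> 'n) list \<Rightarrow> 'b" where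
  "entry_product w = foldr (\<otimes>) (map (\<lambda>(i, j). u i j) w) \<one>"

lemma entry_product_simps [simp]:
  "entry_product [] = \<one>" "entry_product ((i, j) # w) = u i j \<otimes> entry_product w"
  by (simp_all add: entry_product_def)

lemma entry_product_closed [simp]: "entry_product w \<in> carrier B"
  by (induction w) (auto simp: u_closed)

lemma entry_product_append: "entry_product (w @ w') = entry_product w \<otimes> entry_product w'"
  by (induction w) (auto simp: u_closed m_assoc)

lemma functional_finsum:
  assumes "finite A" "\<And>a. a \<in> A \<Longrightarrow> f a \<in> carrier B"
  shows "\<Lambda> (\<Oplus>a\<in>A. f a) = (\<Sum>a\<in>A. \<Lambda> (f a))"
  using assms
proof induction
  case empty
  then show ?case
    using functional_scale[of \<zero> 0] by (simp add: scale_zero)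
next
  case (insert a A)
  then show ?case
    by (simp add: functional_add Pi_iff)
qed

definition word_functional :: "('n \<times> 'n) list \<Rightarrow> complex" where
  "word_functional w = \<Lambda> (entry_product w)"

lemma word_functional_eqI:
  "entry_product v = entry_product v' \<Longrightarrow> word_functional (w @ v @ w') = word_functional (w @ v' @ w')"
  by (simp add: word_functional_def entry_product_append)

lemma word_functional_zeroI:
  assumes "entry_product v = \<zero>"
  shows "word_functional (w @ v @ w') = 0"
  using functional_scale[of \<zero> 0] by (simp add: word_functional_def entry_product_append assms scale_zero)

text \<open>Multiplying a relation by the products of entries on both sides carries it into the
  middle of any word before the functional is applied.\<close>

lemma word_functional_sumI:
  assumes "finite A" "(\<Oplus>a\<in>A. entry_product (v a)) = c \<odot> \<one>"
  shows "(\<Sum>a\<in>A. word_functional (w @ v a @ w')) = c * word_functional (w @ w')"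
proof -
  have "(\<Oplus>a\<in>A. entry_product (w @ v a @ w')) =
      entry_product w \<otimes> (\<Oplus>a\<in>A. entry_product (v a)) \<otimes> entry_product w'"
    using assms(1) by (simp add: finsum_rdistr finsum_ldistr entry_product_append m_assoc)
  also have "\<dots> = c \<odot> entry_product (w @ w')"
    by (simp add: assms(2) entry_product_append smult_mult_left smult_mult_right)
  finally have "\<Lambda> (\<Oplus>a\<in>A. entry_product (w @ v a @ w')) = c * word_functional (w @ w')"
    by (simp add: functional_scale word_functional_def)
  then show ?thesis
    by (simp add: functional_finsum[OF assms(1)] word_functional_def)
qed

lemma eps_word_functionalI:
  assumes "commutation_matrix \<epsilon>" "R_ring_eps \<epsilon> B u"
  shows "eps_word_functional \<epsilon> word_functional"
proof -
  interpret commutation_matrix \<epsilon> by fact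
  show ?thesis
  proof unfold_locales
    fix i j k l w w'
    show "word_functional (w @ (i, k) # (j, l) # w') = word_functional (w @ (j, l) # (i, k) # w')"
      if "\<epsilon> i j = 1" "\<epsilon> k l = 1"
    proof -
      have "u i k \<otimes> u j l = u j l \<otimes> u i k"
        using assms(2) that unfolding R_ring_eps_def by metis
      then have "entry_product [(i, k), (j, l)] = entry_product [(j, l), (i, k)]"
        by (simp add: u_closed)
      from word_functional_eqI[OF this, of w w'] show ?thesis
        by simp
    qed
    show "word_functional (w @ (i, k) # (j, l) # w') = 0" if "(\<epsilon> i j = 1) \<noteq> (\<epsilon> k l = 1)"
    proof -
      have "u i k \<otimes> u j l = \<zero>"
        using assms(2) that eps_eq_0_iff[of i j] eps_eq_0_iff[of k l] unfolding R_ring_eps_def by metis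
      then show ?thesis
        using word_functional_zeroI[of "[(i, k), (j, l)]" w w'] by (simp add: u_closed)
    qed
  qed
qed

lemma orthogonal_word_functionalI:
  assumes "eps_word_functional \<epsilon> word_functional" "orthogonal_relations B u"
  shows "orthogonal_word_functional \<epsilon> word_functional"
proof -
  interpret eps_word_functional \<epsilon> word_functional by fact
  show ?thesis
  proof unfold_locales
    fix w k l w'
    show "(\<Sum>i\<in>UNIV. word_functional (w @ (i, k) # (i, l) # w')) =
        (if k = l then word_functional (w @ w') else 0)"
      using word_functional_sumI[of UNIV "\<lambda>i. [(i, k), (i, l)]" "if k = l then 1 else 0" w w'] assms(2)
      by (simp add: orthogonal_relations_def u_closed scale_one scale_zero)
  qed
qed

lemma power_word_functionalI:
  assumes "eps_word_functional \<epsilon> word_functional"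
    and row: "\<And>i j l. j \<noteq> l \<Longrightarrow> u i j \<otimes> u i l = \<zero>"
    and column: "\<And>i i' j. i \<noteq> i' \<Longrightarrow> u i j \<otimes> u i' j = \<zero>"
    and shift: "\<And>k n i j. \<lbrakk>m k \<noteq> 0; k \<ge> 1; n \<ge> 1\<rbrakk> \<Longrightarrow>
      entry_product (replicate (k + n) (i, j)) = entry_product (replicate n (i, j))"
    and total: "\<And>k j. \<lbrakk>m k \<noteq> 0; k \<ge> 1\<rbrakk> \<Longrightarrow> (\<Oplus>i\<in>UNIV. entry_product (replicate k (i, j))) = \<one>"
  shows "power_word_functional \<epsilon> word_functional m"
proof -
  interpret eps_word_functional \<epsilon> word_functional by fact
  show ?thesis
  proof unfold_locales
    fix i i' j l w w'
    show "word_functional (w @ (i, j) # (i, l) # w') = 0" if "j \<noteq> l"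
      using word_functional_zeroI[of "[(i, j), (i, l)]" w w'] row[OF that] by (simp add: u_closed)
    show "word_functional (w @ (i, j) # (i', j) # w') = 0" if "i \<noteq> i'"
      using word_functional_zeroI[of "[(i, j), (i', j)]" w w'] column[OF that] by (simp add: u_closed)
    fix k n :: nat assume k: "k \<ge> 1"
    show "m k * word_functional (w @ replicate (k + n) (i, j) @ w') =
        m k * word_functional (w @ replicate n (i, j) @ w')" if "n \<ge> 1"
      using word_functional_eqI[OF shift[OF _ k that]] by (cases "m k = 0") auto
    show "m k * (\<Sum>i\<in>UNIV. word_functional (w @ replicate k (i, j) @ w')) = m k * word_functional (w @ w')"
      using word_functional_sumI[of UNIV "\<lambda>i. replicate k (i, j)" 1 w w'] total[OF _ k, of j]
      by (cases "m k = 0") (auto simp: scale_one)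
  qed
qed

end

lemma invariant_underI:
  fixes B :: "'b cstar_structure" and u :: "'n::finite \<Rightarrow> 'n \<Rightarrow> 'b"
  assumes "unital_cstar_algebra B" and closed: "\<And>i j. u i j \<in> carrier B"
    and "\<And>\<Lambda> js. matrix_functional B u \<Lambda> \<Longrightarrow>
      (\<Sum>is | length is = length js. \<phi> (prod_list (map x is)) * matrix_functional.word_functional B u \<Lambda> (zip is js)) =
      \<phi> (prod_list (map x js)) * matrix_functional.word_functional B u \<Lambda> []"
  shows "invariant_under \<phi> x B u"
  unfolding invariant_under_def
proof (intro allI, rule ccontr)
  interpret unital_cstar_algebra B by fact
  fix js :: "'n list"
  let ?W = "\<lambda>is. foldr (\<otimes>\<^bsub>B\<^esub>) (map2 u is js) \<one>\<^bsub>B\<^esub>"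
  let ?lhs = "\<phi> (prod_list (map x js)) \<odot>\<^bsub>B\<^esub> \<one>\<^bsub>B\<^esub>"
  let ?rhs = "\<Oplus>\<^bsub>B\<^esub>is\<in>{is. length is = length js}. \<phi> (prod_list (map x is)) \<odot>\<^bsub>B\<^esub> ?W is"
  assume "?lhs \<noteq> ?rhs"
  have "foldr (\<otimes>\<^bsub>B\<^esub>) (map2 u is js) \<one>\<^bsub>B\<^esub> \<in> carrier B" for "is" js
    by (induction "is" js rule: list_induct2') (auto simp: closed)
  then have W: "?W is \<in> carrier B" for "is"
    by blast
  have mem: "?lhs \<in> carrier B" "?rhs \<in> carrier B"
    using W by (auto intro!: finsum_closed scale_closed)
  show False
  proof (rule functionals_separate_points[OF mem \<open>?lhs \<noteq> ?rhs\<close>])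
    fix \<Lambda> :: "'b \<Rightarrow> complex"
    assume \<Lambda>: "\<And>a b. \<lbrakk>a \<in> carrier B; b \<in> carrier B\<rbrakk> \<Longrightarrow> \<Lambda> (a \<oplus>\<^bsub>B\<^esub> b) = \<Lambda> a + \<Lambda> b"
      "\<And>c a. a \<in> carrier B \<Longrightarrow> \<Lambda> (c \<odot>\<^bsub>B\<^esub> a) = c * \<Lambda> a" "\<Lambda> ?lhs \<noteq> \<Lambda> ?rhs"
    interpret matrix_functional B u \<Lambda>
      by unfold_locales (use closed \<Lambda> in auto)
    have "\<Lambda> ?rhs = (\<Sum>is | length is = length js. \<phi> (prod_list (map x is)) * word_functional (zip is js))"
      using finite_lists_length_eq[of "UNIV :: 'n set" "length js"] W
      by (simp add: functional_finsum scale_closed functional_scale word_functional_def entry_product_def)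
    also have "\<dots> = \<Lambda> ?lhs"
      using assms(3)[OF matrix_functional_axioms] by (simp add: functional_scale word_functional_def)
    finally show False
      using \<Lambda>(3) by simp
  qed
qed

section \<open>Invariance\<close>

text \<open>The common part of the cases \<open>S\<^sub>n\<^sup>\<epsilon>\<close> and
  \<open>H\<^sub>n\<^sup>\<epsilon>\<close>. Powers of entries are written with
  \<open>foldr\<close>, since the assumptions on \<open>u\<close> precede the choice of a
  functional.\<close>

lemma invariant_power_words:
  fixes \<epsilon> :: "'n::finite \<Rightarrow> 'n \<Rightarrow> nat" and B :: "'b cstar_structure"
  assumes "eps_independent_family \<epsilon> \<phi> x" and moment: "\<And>i k. \<phi> (x i ^ k) = m k"
    and B: "unital_cstar_algebra B" "\<And>i j. u i j \<in> carrier B" "R_ring_eps \<epsilon> B u"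
    and rows: "\<And>i j l. j \<noteq> l \<Longrightarrow> u i j \<otimes>\<^bsub>B\<^esub> u i l = \<zero>\<^bsub>B\<^esub>"
    and columns: "\<And>i i' j. i \<noteq> i' \<Longrightarrow> u i j \<otimes>\<^bsub>B\<^esub> u i' j = \<zero>\<^bsub>B\<^esub>"
    and shift: "\<And>k n i j. \<lbrakk>m k \<noteq> 0; k \<ge> 1; n \<ge> 1\<rbrakk> \<Longrightarrow>
      foldr (\<otimes>\<^bsub>B\<^esub>) (replicate (k + n) (u i j)) \<one>\<^bsub>B\<^esub> = foldr (\<otimes>\<^bsub>B\<^esub>) (replicate n (u i j)) \<one>\<^bsub>B\<^esub>"
    and total: "\<And>k j. \<lbrakk>m k \<noteq> 0; k \<ge> 1\<rbrakk> \<Longrightarrow>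
      (\<Oplus>\<^bsub>B\<^esub>i\<in>UNIV. foldr (\<otimes>\<^bsub>B\<^esub>) (replicate k (u i j)) \<one>\<^bsub>B\<^esub>) = \<one>\<^bsub>B\<^esub>"
  shows "invariant_under \<phi> x B u"
proof (rule invariant_underI[OF B(1,2)])
  interpret eps_independent_family \<epsilon> \<phi> x by fact
  fix \<Lambda> js assume "matrix_functional B u \<Lambda>"
  then interpret matrix_functional B u \<Lambda> .
  have "eps_word_functional \<epsilon> word_functional"
    by (rule eps_word_functionalI[OF commutation_matrix_axioms B(3)])
  then have "power_word_functional \<epsilon> word_functional m"
    by (rule power_word_functionalI)
      (auto simp: rows columns shift total entry_product_def simp del: foldr_replicate)
  then have "power_words \<epsilon> \<phi> x word_functional m"
    by (intro power_words.intro power_words_axioms.intro moment eps_independent_family_axioms)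
  then show "(\<Sum>is | length is = length js. \<phi> (prod_list (map x is)) * word_functional (zip is js)) =
      \<phi> (prod_list (map x js)) * word_functional []"
    by (rule power_words_invariance)
qed

lemma invariant_S:
  fixes \<epsilon> :: "'n::finite \<Rightarrow> 'n \<Rightarrow> nat"
  assumes "eps_independent_family \<epsilon> \<phi> x" "identically_distributed \<phi> x" "C_S \<epsilon> B u"
  shows "invariant_under \<phi> x B u"
proof -
  have B: "unital_cstar_algebra B" "\<And>i j. u i j \<in> carrier B" "selfadjoint_entries B u"
    "\<And>i j. u i j \<otimes>\<^bsub>B\<^esub> u i j = u i j" "row_column_sums_one B u" "R_ring_eps \<epsilon> B u"
    using assms(3) by (auto simp: C_S_def universal_cstar_algebra_def)
  interpret unital_cstar_algebra B by fact
  have power: "foldr (\<otimes>\<^bsub>B\<^esub>) (replicate k (u i j)) \<one>\<^bsub>B\<^esub> = u i j" if "k \<ge> 1" for k i j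
    using that by (induction k rule: dec_induct) (simp_all add: B)
  \<comment> \<open>Here \<open>undefined\<close> is just some index; identical distribution makes
    the choice irrelevant.\<close>
  have m: "\<phi> (x i ^ k) = \<phi> (x undefined ^ k)" for i k
    using assms(2) by (auto simp: identically_distributed_def)
  show ?thesis
  proof (rule invariant_power_words[OF assms(1) m B(1,2,6)])
    show "u i j \<otimes>\<^bsub>B\<^esub> u i l = \<zero>\<^bsub>B\<^esub>" if "j \<noteq> l" for i j l
      by (rule projections_orthogonal[of "u i"])
        (use B that in \<open>auto simp: selfadjoint_entries_def row_column_sums_one_def\<close>)
    show "u i j \<otimes>\<^bsub>B\<^esub> u i' j = \<zero>\<^bsub>B\<^esub>" if "i \<noteq> i'" for i i' j
      by (rule projections_orthogonal[of "\<lambda>i. u i j"])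
        (use B that in \<open>auto simp: selfadjoint_entries_def row_column_sums_one_def\<close>)
  qed (use B(5) in \<open>auto simp: power row_column_sums_one_def simp del: foldr_replicate\<close>)
qed

lemma invariant_H:
  fixes \<epsilon> :: "'n::finite \<Rightarrow> 'n \<Rightarrow> nat"
  assumes family: "eps_independent_family \<epsilon> \<phi> x" and "identically_distributed \<phi> x"
    and even: "\<And>i k. odd k \<Longrightarrow> free_cumulant \<phi> (x i) k = 0" and "C_H \<epsilon> B u"
  shows "invariant_under \<phi> x B u"
proof -
  interpret eps_independent_family \<epsilon> \<phi> x by fact
  have B: "unital_cstar_algebra B" "\<And>i j. u i j \<in> carrier B" "orthogonal_relations B u"
    "\<And>i j k. i \<noteq> j \<Longrightarrow> u i k \<otimes>\<^bsub>B\<^esub> u j k = \<zero>\<^bsub>B\<^esub>" "\<And>i j k. i \<noteq> j \<Longrightarrow> u k i \<otimes>\<^bsub>B\<^esub> u k j = \<zero>\<^bsub>B\<^esub>"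
    "R_ring_eps \<epsilon> B u"
    using assms(4) by (auto simp: C_H_def universal_cstar_algebra_def)
  interpret unital_cstar_algebra B by fact
  \<comment> \<open>Multiplying the unit row sum of squares by \<open>u i j\<close> leaves one term,
    because different entries of a row have product zero.\<close>
  have cube: "u i j \<otimes>\<^bsub>B\<^esub> (u i j \<otimes>\<^bsub>B\<^esub> u i j) = u i j" for i j
  proof -
    have "u i j = u i j \<otimes>\<^bsub>B\<^esub> (\<Oplus>\<^bsub>B\<^esub>k\<in>UNIV. u i k \<otimes>\<^bsub>B\<^esub> u i k)"
      using B(2,3) by (simp add: orthogonal_relations_def)
    also have "\<dots> = (\<Oplus>\<^bsub>B\<^esub>k\<in>UNIV. u i j \<otimes>\<^bsub>B\<^esub> (u i k \<otimes>\<^bsub>B\<^esub> u i k))"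
      using B(2) by (simp add: finsum_rdistr)
    also have "\<dots> = (\<Oplus>\<^bsub>B\<^esub>k\<in>UNIV. if j = k then u i k \<otimes>\<^bsub>B\<^esub> (u i k \<otimes>\<^bsub>B\<^esub> u i k) else \<zero>\<^bsub>B\<^esub>)"
      by (rule finsum_cong') (use B(2,5) in \<open>auto simp: m_assoc[symmetric]\<close>)
    also have "\<dots> = u i j \<otimes>\<^bsub>B\<^esub> (u i j \<otimes>\<^bsub>B\<^esub> u i j)"
      using B(2) by (intro finsum_singleton[where f = "\<lambda>k. u i k \<otimes>\<^bsub>B\<^esub> (u i k \<otimes>\<^bsub>B\<^esub> u i k)"]) auto
    finally show ?thesis ..
  qed
  let ?p = "\<lambda>k i j. foldr (\<otimes>\<^bsub>B\<^esub>) (replicate k (u i j)) \<one>\<^bsub>B\<^esub>"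
  have closed: "?p k i j \<in> carrier B" for k i j
    by (induction k) (simp_all add: B)
  have reduce: "?p (2 * k + n) i j = ?p n i j" if n: "n \<ge> 1" for k n i j
  proof (induction k)
    case (Suc k)
    obtain n' where "n = Suc n'"
      using n by (cases n) auto
    then have "?p (2 * Suc k + n) i j = u i j \<otimes>\<^bsub>B\<^esub> (u i j \<otimes>\<^bsub>B\<^esub> u i j) \<otimes>\<^bsub>B\<^esub> ?p (2 * k + n') i j"
      using B(2) closed by (simp add: m_assoc)
    also have "\<dots> = ?p (2 * k + n) i j"
      using \<open>n = Suc n'\<close> by (simp add: cube)
    finally show ?case
      using Suc.IH by simp
  qed simp
  have m: "\<phi> (x i ^ k) = \<phi> (x undefined ^ k)" for i k
    using assms(2) by (auto simp: identically_distributed_def)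
  have nonzero: "\<exists>l. k = 2 * l" if "\<phi> (x undefined ^ k) \<noteq> 0" for k
    using odd_moment_zero[OF even, of k undefined] that by (cases "even k") auto
  show ?thesis
  proof (rule invariant_power_words[OF family m B(1,2,6,5,4)])
    fix k n i j assume "\<phi> (x undefined ^ k) \<noteq> 0" "n \<ge> (1 :: nat)"
    then show "?p (k + n) i j = ?p n i j"
      using nonzero reduce by blast
  next
    fix k j assume "\<phi> (x undefined ^ k) \<noteq> 0" "k \<ge> 1"
    \<comment> \<open>A nonzero moment has even order, and the cube relation lowers the exponent by
      two at a time down to the square, whose column sums are one by orthogonality.\<close>
    then obtain l where "k = 2 * l + 2"
      using nonzero[of k] by (metis One_nat_def add.commute mult_Suc_right mult_zero_right not0_implies_Suc not_one_le_zero)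
    then have "?p k i j = u i j \<otimes>\<^bsub>B\<^esub> u i j" for i
      using reduce[of 2 l i j] B(2) by (simp add: numeral_2_eq_2)
    then show "(\<Oplus>\<^bsub>B\<^esub>i\<in>UNIV. ?p k i j) = \<one>\<^bsub>B\<^esub>"
      using B(3) by (simp add: orthogonal_relations_def)
  qed auto
qed

text \<open>One argument for \<open>B\<^sub>n\<^sup>\<epsilon>\<close> and
  \<open>O\<^sub>n\<^sup>\<epsilon>\<close>: either the column sums are one, or the mean, which is
  the coefficient of the column sums, is zero.\<close>

lemma invariant_semicircular:
  fixes \<epsilon> :: "'n::finite \<Rightarrow> 'n \<Rightarrow> nat" and B :: "'b cstar_structure"
  assumes family: "eps_independent_family \<epsilon> \<phi> x" and "identically_distributed \<phi> x"
    and small: "\<And>i k. k \<ge> 3 \<Longrightarrow> free_cumulant \<phi> (x i) k = 0"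
    and B: "unital_cstar_algebra B" "\<And>i j. u i j \<in> carrier B" "orthogonal_relations B u" "R_ring_eps \<epsilon> B u"
    and sums: "(\<forall>i. free_cumulant \<phi> (x i) 1 = 0) \<or> row_column_sums_one B u"
  shows "invariant_under \<phi> x B u"
proof (rule invariant_underI[OF B(1,2)])
  interpret eps_independent_family \<epsilon> \<phi> x by fact
  fix \<Lambda> js assume "matrix_functional B u \<Lambda>"
  then interpret matrix_functional B u \<Lambda> .
  let ?c = "free_cumulant \<phi> (x undefined) 1" and ?d = "free_cumulant \<phi> (x undefined) 2"
  have "(\<lambda>k. \<phi> (x i ^ k)) = (\<lambda>k. \<phi> (x undefined ^ k))" for i
    using assms(2) by (auto simp: identically_distributed_def)
  then have same: "free_cumulant \<phi> (x i) k = free_cumulant \<phi> (x undefined) k" for i k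
    unfolding free_cumulant_def by (rule arg_cong[of _ _ "\<lambda>M. free_cumulant_of_moments M k"])
  have "\<phi> (cheb ?c ?d (x i) n) = 0" if "n \<ge> 1" for i n
    using phi_cheb_cumulants[OF small that, of i] by (simp only: same[of i])
  then have "semicircular_family \<epsilon> \<phi> x ?c ?d"
    by unfold_locales
  moreover have "orthogonal_word_functional \<epsilon> word_functional"
    by (intro orthogonal_word_functionalI eps_word_functionalI commutation_matrix_axioms B)
  moreover have "?c * (\<Sum>i\<in>UNIV. word_functional (w @ (i, j) # w')) = ?c * word_functional (w @ w')" for w w' j
    using sums
  proof
    assume "row_column_sums_one B u"
    then show ?thesis
      using word_functional_sumI[of UNIV "\<lambda>i. [(i, j)]" 1 w w']
      by (simp add: row_column_sums_one_def u_closed scale_one)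
  qed simp
  ultimately show "(\<Sum>is | length is = length js. \<phi> (prod_list (map x is)) * word_functional (zip is js)) =
      \<phi> (prod_list (map x js)) * word_functional []"
    by (rule semicircular_invariance)
qed

theorem theorem9p6:
  fixes \<epsilon> :: "'n::finite \<Rightarrow> 'n \<Rightarrow> nat"
    and \<phi> :: "'a::complex_star_algebra \<Rightarrow> complex"
    and x :: "'n \<Rightarrow> 'a"
    and B :: "'b cstar_structure"
    and u :: "'n \<Rightarrow> 'n \<Rightarrow> 'b"
  assumes "\<forall>i j. \<epsilon> i j \<in> {0, 1}"
    and "\<forall>i j. \<epsilon> i j = \<epsilon> j i"
    and "\<forall>i. \<epsilon> i i = 0"
    and "unital_linear_functional \<phi>"
    and "\<forall>i. selfadjoint (x i)"
    and "\<forall>i j. \<epsilon> i j = 1 \<longrightarrow> x i * x j = x j * x i"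
    and "eps_independent \<epsilon> \<phi> x"
    and "identically_distributed \<phi> x"
  shows "(C_S \<epsilon> B u \<longrightarrow> invariant_under \<phi> x B u) \<and>
    ((\<forall>i m. odd m \<longrightarrow> free_cumulant \<phi> (x i) m = 0) \<longrightarrow>
      C_H \<epsilon> B u \<longrightarrow> invariant_under \<phi> x B u) \<and>
    ((\<forall>i m. m \<ge> 1 \<and> m \<notin> {1, 2} \<longrightarrow> free_cumulant \<phi> (x i) m = 0) \<longrightarrow>
      C_B \<epsilon> B u \<longrightarrow> invariant_under \<phi> x B u) \<and>
    ((\<forall>i m. m \<ge> 1 \<and> m \<noteq> 2 \<longrightarrow> free_cumulant \<phi> (x i) m = 0) \<longrightarrow>
      C_O \<epsilon> B u \<longrightarrow> invariant_under \<phi> x B u)"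
proof -
  have family: "eps_independent_family \<epsilon> \<phi> x"
    by unfold_locales (use assms in auto)
  show ?thesis
  proof (intro conjI impI)
    show "invariant_under \<phi> x B u" if "C_S \<epsilon> B u"
      by (rule invariant_S[OF family assms(8) that])
    show "invariant_under \<phi> x B u"
      if "\<forall>i m. odd m \<longrightarrow> free_cumulant \<phi> (x i) m = 0" "C_H \<epsilon> B u"
      by (rule invariant_H[OF family assms(8) _ that(2)]) (use that(1) in auto)
    show "invariant_under \<phi> x B u"
      if "\<forall>i m. m \<ge> 1 \<and> m \<notin> {1, 2} \<longrightarrow> free_cumulant \<phi> (x i) m = 0" "C_B \<epsilon> B u"
      by (rule invariant_semicircular[OF family assms(8)])
        (use that in \<open>auto simp: C_B_def universal_cstar_algebra_def\<close>)
    show "invariant_under \<phi> x B u"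
      if "\<forall>i m. m \<ge> 1 \<and> m \<noteq> 2 \<longrightarrow> free_cumulant \<phi> (x i) m = 0" "C_O \<epsilon> B u"
      by (rule invariant_semicircular[OF family assms(8)])
        (use that in \<open>auto simp: C_O_def universal_cstar_algebra_def\<close>)
  qed
qed

end
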